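(* Let $\mathscr P_\bullet$ be a non-degenerate shaded planar algebra over $\mathbb C$ with circle parameter $\delta$, generated by an element $R\in\mathscr P_{2,+}$ with a Yang-Baxter relation, such that $\dim\mathscr P_{3,\pm}=15$, $R$ is uncappable, $R=\overline R$, $R^2=aR+id-e$, $\mathcal F(R)^2=a'\mathcal F(R)+id-e$ for some $a,a'\in\mathbb C$, and $$\begin{aligned}R_1F_2R_1={}&A\,h_2+B\,h_1+C(1+h_1h_2+h_2h_1)+D(R_1+h_1F_2+F_2h_1)\\&+E(F_2+R_1h_2+h_2R_1)+F(R_1h_2R_1+F_2R_1+R_1F_2)+G\,F_2R_1F_2\end{aligned}$$ in $\mathscr P_{3,+}$ with scalars $A,\dots,G\in\mathbb C$. Then $$G=\pm1,\quad A=\frac{Ga}{\delta},\quad B=-A,\quad C=0,\quad (G\delta^2-2\delta)D=1-Ga^2\delta,\quad E=-GD,\quad F=0,\quad a'=Ga.$$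
   Context: A shaded planar algebra over $\mathbb C$ is a family of vector spaces $\mathscr P_{m,\pm}$ on which shaded planar tangles act multilinearly, compatibly with isotopy and composition, with $\mathscr P_{0,\pm}$ one-dimensional spanned by the empty diagram; closed circles equal $\delta$. It is non-degenerate if the bilinear forms $(x,y)\mapsto tr_m(xy)$ are non-degenerate, where $tr_m$ closes an $m$-box with $m$ arcs on the right. Boxes are rectangles with $m$ bottom and $m$ top points; $xy$ is $y$ stacked on top of $x$; $1$ is a through string. $id$ is the identity 2-box, $h$ is the 2-box formed by an arc joining the two top points and an arc joining the two bottom points (in either shading), $e=\frac1\delta h$. $\mathcal F:\mathscr P_{2,\pm}\to\mathscr P_{2,\mp}$ is the one-click (counterclockwise) rotation and $\overline R=\mathcal F^2(R)$ is the 180-degree rotation. $R$ uncappable: joining any two adjacent boundary points of $R$ by an arc gives $0$. In $\mathscr P_{3,+}$: $R_1=R\otimes1$, $h_1=h\otimes1$, $h_2=1\otimes h$, $F_2=1\otimes\mathcal F(R)$ (so that $h_1h_2R_1=h_1F_2$), and $1$ is the identity 3-box. The symbols $A,B,C,D,E,F,G$ are scalars. Yang-Baxter relation: for all 2-boxes $R_i,R_j,R_k$ with compatible shading (both shadings), $(1\otimes R_i)(R_j\otimes1)(1\otimes R_k)$ is a linear combination of elements $(R_{k'}\otimes1)(1\otimes R_{j'})(R_{i'}\otimes1)$ with 2-boxes $R_{i'},R_{j'},R_{k'}$. *)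

theory Defs
  imports Complex_Main
begin

section \<open>Shaded planar tangles\<close>

text \<open>
  A planar tangle is drawn inside a rectangle with m points on the bottom and m points on the top
  edge, all discs being rectangles whose distinguished boundary interval is the left edge.  It is
  put in general position with respect to height and then cut into horizontal layers, each of which
  contains exactly one local maximum of a string, one local minimum of a string, or one input box,
  next to vertical strings.  A tangle is the list of these layers from bottom to top.  The layer
  \<open>(k, x)\<close> has \<open>k\<close> strings to the left of \<open>x\<close>.
  Input boxes carry pairwise distinct labels; \<open>Box i m\<close> is the input box with label
  \<open>i\<close> and m points on its bottom and on its top edge.
\<close>

datatype element =
    Cup  \<comment> \<open>local minimum: an arc joining two adjacent points above it\<close>
  | Cap  \<comment> \<open>local maximum: an arc joining two adjacent points below it\<close>
  | Box nat nat

type_synonym tangle = "(nat \<times> element) list"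

fun points_below :: "element \<Rightarrow> nat" where
  "points_below Cup = 0"
| "points_below Cap = 2"
| "points_below (Box i m) = m"

fun points_above :: "element \<Rightarrow> nat" where
  "points_above Cup = 2"
| "points_above Cap = 0"
| "points_above (Box i m) = m"

text \<open>\<open>strings n T n'\<close>: the layers of \<open>T\<close> fit on top of each other, with
  \<open>n\<close> strings entering at the bottom and \<open>n'\<close> strings leaving at the top.\<close>

fun strings :: "nat \<Rightarrow> tangle \<Rightarrow> nat \<Rightarrow> bool" where
  "strings n [] n' \<longleftrightarrow> n = n'"
| "strings n ((k, x) # T) n' \<longleftrightarrow>
     k + points_below x \<le> n \<and> strings (n - points_below x + points_above x) T n'"

fun labels :: "tangle \<Rightarrow> nat list" where
  "labels [] = []"
| "labels ((k, Box i m) # T) = i # labels T"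
| "labels ((k, Cup) # T) = labels T"
| "labels ((k, Cap) # T) = labels T"

definition is_tangle :: "nat \<Rightarrow> tangle \<Rightarrow> bool" where
  "is_tangle m T \<longleftrightarrow> strings m T m \<and> distinct (labels T)"

text \<open>The regions are shaded alternately.  A box has sign \<open>Plus\<close> or
  \<open>Minus\<close> according to the shading of the region at its left edge.  In a tangle whose
  leftmost region has shading \<open>s\<close>, the region to the right of the k-th string has shading
  \<open>(flip ^^ k) s\<close>.\<close>

datatype shading = Plus | Minus

fun flip :: "shading \<Rightarrow> shading" where
  "flip Plus = Minus"
| "flip Minus = Plus"

definition inputs :: "shading \<Rightarrow> tangle \<Rightarrow> (nat \<times> nat \<times> shading) set" where
  "inputs s T = {(i, m, (flip ^^ k) s) | i m k. (k, Box i m) \<in> set T}"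

definition shift :: "nat \<Rightarrow> tangle \<Rightarrow> tangle" where
  "shift k T = map (\<lambda>(j, x). (k + j, x)) T"

text \<open>m nested arcs on 2m adjacent points, the first of which has number \<open>k\<close>.\<close>

definition cups :: "nat \<Rightarrow> nat \<Rightarrow> tangle" where
  "cups k m = map (\<lambda>j. (k + j, Cup)) [0..<m]"

definition caps :: "nat \<Rightarrow> nat \<Rightarrow> tangle" where
  "caps k m = map (\<lambda>j. (k + j, Cap)) (rev [0..<m])"

text \<open>
  Planar isotopy is generated by the moves that can occur between tangles in general position:
  exchanging the heights of two elements lying side by side; cancelling a local minimum against an
  adjacent local maximum; and rotating an input box by 360 degrees.  The last move is expressed by
  saying that the box rotated counterclockwise by 180 degrees (its top points are bent down on the
  left, its bottom points are bent up on the right) is isotopic to the box rotated clockwise by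
  180 degrees.
\<close>

inductive local_move :: "tangle \<Rightarrow> tangle \<Rightarrow> bool" where
  exchange: "k + points_above x \<le> l \<Longrightarrow>
    local_move [(k, x), (l, y)] [(l - points_above x + points_below x, y), (k, x)]"
| zigzag_left: "local_move [(k, Cup), (k + 1, Cap)] []"
| zigzag_right: "local_move [(k + 1, Cup), (k, Cap)] []"
| rotate: "local_move
    (cups (k + m) m @ [(k + m, Box i m)] @ caps k m)
    (cups k m @ [(k + m, Box i m)] @ caps (k + m) m)"

inductive isotopic :: "nat \<Rightarrow> tangle \<Rightarrow> tangle \<Rightarrow> bool" for m where
  isotopic_move: "local_move X Y \<Longrightarrow> is_tangle m (U @ X @ V) \<Longrightarrow> is_tangle m (U @ Y @ V)
    \<Longrightarrow> isotopic m (U @ X @ V) (U @ Y @ V)"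
| isotopic_refl: "is_tangle m T \<Longrightarrow> isotopic m T T"
| isotopic_sym: "isotopic m S T \<Longrightarrow> isotopic m T S"
| isotopic_trans: "isotopic m S T \<Longrightarrow> isotopic m T U \<Longrightarrow> isotopic m S U"


section \<open>Shaded planar algebras\<close>

text \<open>
  The spaces \<open>P m s\<close> are subspaces of one complex vector space (any family of vector spaces
  can be placed in its direct sum).  \<open>Z m s T v\<close> is the value of the tangle \<open>T\<close>
  with boundary of type \<open>(m, s)\<close> when the box with label \<open>i\<close> is filled with
  \<open>v i\<close>.
\<close>

locale shaded_planar_algebra = vector_space scale
  for scale :: "complex \<Rightarrow> 'v::ab_group_add \<Rightarrow> 'v" (infixr "*s" 75)
    and P :: "nat \<Rightarrow> shading \<Rightarrow> 'v set"
    and Z :: "nat \<Rightarrow> shading \<Rightarrow> tangle \<Rightarrow> (nat \<Rightarrow> 'v) \<Rightarrow> 'v"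
    and \<delta> :: complex +
  assumes subspace_P: "subspace (P m s)"
    and action_closed: "is_tangle m T \<Longrightarrow> (\<And>i n t. (i, n, t) \<in> inputs s T \<Longrightarrow> v i \<in> P n t)
      \<Longrightarrow> Z m s T v \<in> P m s"
    and action_cong: "is_tangle m T \<Longrightarrow> (\<And>i. i \<in> set (labels T) \<Longrightarrow> v i = w i)
      \<Longrightarrow> Z m s T v = Z m s T w"
    and action_multilinear: "is_tangle m T \<Longrightarrow> (\<And>i n t. (i, n, t) \<in> inputs s T \<Longrightarrow> v i \<in> P n t)
      \<Longrightarrow> (j, n', t') \<in> inputs s T \<Longrightarrow> x \<in> P n' t' \<Longrightarrow> y \<in> P n' t'
      \<Longrightarrow> Z m s T (v(j := c *s x + y)) = c *s Z m s T (v(j := x)) + Z m s T (v(j := y))"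
    and action_isotopy: "isotopic m S T \<Longrightarrow> (\<And>i n t. (i, n, t) \<in> inputs s S \<Longrightarrow> v i \<in> P n t)
      \<Longrightarrow> Z m s S v = Z m s T v"
    and action_identity: "x \<in> P m s \<Longrightarrow> Z m s [(0, Box i m)] (\<lambda>_. x) = x"
    and action_compose: "is_tangle m (U @ [(k, Box i n)] @ V) \<Longrightarrow> is_tangle n S
      \<Longrightarrow> is_tangle m (U @ shift k S @ V)
      \<Longrightarrow> (\<And>j l t. (j, l, t) \<in> inputs s (U @ shift k S @ V) \<Longrightarrow> v j \<in> P l t)
      \<Longrightarrow> Z m s (U @ shift k S @ V) v =
          Z m s (U @ [(k, Box i n)] @ V) (v(i := Z n ((flip ^^ k) s) S v))"
    and P_0: "P 0 s = span {Z 0 s [] (\<lambda>_. 0)}"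
    and dim_P_0: "dim (P 0 s) = 1"
    and circle: "Z 0 s [(0, Cup), (0, Cap)] (\<lambda>_. 0) = \<delta> *s Z 0 s [] (\<lambda>_. 0)"


section \<open>Operations on boxes\<close>

context
  fixes Z :: "nat \<Rightarrow> shading \<Rightarrow> tangle \<Rightarrow> (nat \<Rightarrow> 'v::ab_group_add) \<Rightarrow> 'v"
begin

text \<open>The diagram of a product \<open>x y\<close> has \<open>y\<close> on top of \<open>x\<close>.\<close>

definition box_mult :: "nat \<Rightarrow> shading \<Rightarrow> 'v \<Rightarrow> 'v \<Rightarrow> 'v" where
  "box_mult m s x y = Z m s [(0, Box 0 m), (0, Box 1 m)] (\<lambda>i. if i = 0 then x else y)"

definition box_id :: "nat \<Rightarrow> shading \<Rightarrow> 'v" where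
  "box_id m s = Z m s [] (\<lambda>_. 0)"

definition box_h :: "shading \<Rightarrow> 'v" where
  "box_h s = Z 2 s [(0, Cap), (0, Cup)] (\<lambda>_. 0)"

text \<open>Juxtaposition with a through string: \<open>add_right m s x\<close> is \<open>x\<close> with
  a string on its right, \<open>add_left m s x\<close> has the string on the left.  Here
  \<open>s\<close> is the shading of the result, so in \<open>add_left m s x\<close> the box
  \<open>x\<close> has shading \<open>flip s\<close>.\<close>

definition add_right :: "nat \<Rightarrow> shading \<Rightarrow> 'v \<Rightarrow> 'v" where
  "add_right m s x = Z (m + 1) s [(0, Box 0 m)] (\<lambda>_. x)"

definition add_left :: "nat \<Rightarrow> shading \<Rightarrow> 'v \<Rightarrow> 'v" where
  "add_left m s x = Z (m + 1) s [(1, Box 0 m)] (\<lambda>_. x)"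

text \<open>One-click counterclockwise rotation of a 2-box of shading \<open>s\<close>: the upper left
  point is bent down on the left and the lower right point is bent up on the right.\<close>

definition click :: "shading \<Rightarrow> 'v \<Rightarrow> 'v" where
  "click s x = Z 2 (flip s) [(2, Cup), (1, Box 0 2), (0, Cap)] (\<lambda>_. x)"

text \<open>The arcs join the two top points, the two bottom points, the two right points, and
  the two left points of the box, respectively.\<close>

definition uncappable :: "shading \<Rightarrow> 'v \<Rightarrow> bool" where
  "uncappable s x \<longleftrightarrow>
     Z 1 s [(1, Cup), (0, Box 0 2), (0, Cap)] (\<lambda>_. x) = 0 \<and>
     Z 1 s [(0, Cup), (0, Box 0 2), (1, Cap)] (\<lambda>_. x) = 0 \<and>
     Z 1 s [(1, Cup), (0, Box 0 2), (1, Cap)] (\<lambda>_. x) = 0 \<and>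
     Z 1 (flip s) [(0, Cup), (1, Box 0 2), (0, Cap)] (\<lambda>_. x) = 0"

definition right_closure :: "nat \<Rightarrow> shading \<Rightarrow> 'v \<Rightarrow> 'v" where
  "right_closure m s x = Z 0 s (cups 0 m @ [(0, Box 0 m)] @ caps 0 m) (\<lambda>_. x)"

end

context shaded_planar_algebra
begin

definition tr :: "nat \<Rightarrow> shading \<Rightarrow> 'v \<Rightarrow> complex" where
  "tr m s x = (THE c. right_closure Z m s x = c *s box_id Z 0 s)"

definition nondegenerate :: bool where
  "nondegenerate \<longleftrightarrow> (\<forall>m s.
     (\<forall>x\<in>P m s. (\<forall>y\<in>P m s. tr m s (box_mult Z m s x y) = 0) \<longrightarrow> x = 0) \<and>
     (\<forall>y\<in>P m s. (\<forall>x\<in>P m s. tr m s (box_mult Z m s x y) = 0) \<longrightarrow> y = 0))"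

definition generated_by :: "'v \<Rightarrow> nat \<Rightarrow> shading \<Rightarrow> bool" where
  "generated_by R n t \<longleftrightarrow> R \<in> P n t \<and> (\<forall>m s. P m s =
     span {Z m s T (\<lambda>_. R) | T. is_tangle m T \<and> (\<forall>(i, n', t') \<in> inputs s T. n' = n \<and> t' = t)})"

definition yang_baxter :: bool where
  "yang_baxter \<longleftrightarrow> (\<forall>s. \<forall>x\<in>P 2 (flip s). \<forall>y\<in>P 2 s. \<forall>z\<in>P 2 (flip s).
     box_mult Z 3 s (box_mult Z 3 s (add_left Z 2 s x) (add_right Z 2 s y)) (add_left Z 2 s z)
     \<in> span {box_mult Z 3 s (box_mult Z 3 s (add_right Z 2 s x') (add_left Z 2 s y')) (add_right Z 2 s z')
            | x' y' z'. x' \<in> P 2 s \<and> y' \<in> P 2 (flip s) \<and> z' \<in> P 2 s})"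

end

end

theory Submission
  imports Defs
begin

text \<open>
  Up to isotopy, every tangle filled with vectors is a row of cups on the right, followed by a word in
  2-boxes, followed by a row of caps on the right; the Yang-Baxter relation turns the closing of strings
  into partial traces, so \<open>P 3\<close> is spanned by the products \<open>x\<^sub>1 y\<^sub>2 z\<^sub>1\<close> with
  2-boxes \<open>x, y, z\<close>.  Non-degeneracy and \<open>dim P 3 = 15\<close> bound the smaller spaces: too
  many independent tensor products would fit into \<open>P 3\<close> unless \<open>P 1\<close> consists of
  scalars and \<open>P 2\<close> is spanned by \<open>id\<close>, \<open>h\<close> and the generator.  Hence the
  fifteen diagrams on the right of the given relation form a basis of \<open>P 3\<close>.

  Multiplying the relation by \<open>h\<^sub>1\<close>, \<open>h\<^sub>2\<close> and \<open>R\<^sub>1\<close> and comparing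
  coefficients gives the claim when \<open>F = 0\<close>.  Otherwise it forces \<open>D = - G\<close> and scalars
  \<open>s, t\<close> such that \<open>p = R\<^sub>1 + s + t h\<^sub>1\<close> and \<open>q = F\<^sub>2 + t + s h\<^sub>2\<close> satisfy
  \<open>p\<^sup>2 = c p\<close>, \<open>q\<^sup>2 = c' q\<close> and \<open>p q p = G q p q\<close>.  Then \<open>w = p q - q p\<close>, \<open>w p\<close> and
  \<open>w q\<close> span a right ideal on which the trace vanishes, so \<open>w = 0\<close> by non-degeneracy,
  which contradicts the independence of \<open>R\<^sub>1 F\<^sub>2\<close> and \<open>F\<^sub>2 R\<^sub>1\<close>.
\<close>

section \<open>Words\<close>

text \<open>The order of the dimension counts is forced by an obstacle: words can be reduced only if
  capping a 2-box on the right gives a scalar, that is, once the 1-boxes that arise are scalars. So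
  the 1-boxes are treated before any use of the generator, by non-degeneracy and
  \<open>dim (P 3 s) = 15\<close> alone. Capping off one factor of a tensor product leaves a
  multiple of the other factor, and the trace pairing separates these multiples, which makes
  products of independent boxes independent.

  The normal form is therefore proved for an abstract family of 2-boxes and used twice. With the
  span of \<open>id\<close> and \<open>h\<close> it shows that the generator lies outside this span,
  since otherwise five diagrams would span \<open>P 3\<close>. With all 2-boxes, after the 1-boxes
  are known to be scalars, it gives the spanning products of \<open>P 3\<close>; only then are the
  2-boxes replaced by their three spanning elements.\<close>

text \<open>A word is a tangle whose boxes carry the vectors themselves instead of labels.\<close>

datatype 'v letter = LCup | LCap | LBox nat 'v

type_synonym 'v word = "(nat \<times> 'v letter) list"

fun src :: "'v letter \<Rightarrow> nat" where
  "src LCup = 0"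
| "src LCap = 2"
| "src (LBox n x) = n"

fun tgt :: "'v letter \<Rightarrow> nat" where
  "tgt LCup = 2"
| "tgt LCap = 0"
| "tgt (LBox n x) = n"

fun vec :: "'v::zero letter \<Rightarrow> 'v" where
  "vec (LBox n x) = x"
| "vec _ = 0"

fun label :: "nat \<Rightarrow> 'v letter \<Rightarrow> element" where
  "label i LCup = Cup"
| "label i LCap = Cap"
| "label i (LBox n x) = Box i n"

text \<open>Cups and caps consume a label as well, so the label of a box is its position in the
  word, and labels are distinct automatically.\<close>

fun labelled :: "nat \<Rightarrow> 'v word \<Rightarrow> tangle" where
  "labelled i [] = []"
| "labelled i ((k, x) # w) = (k, label i x) # labelled (Suc i) w"

fun fill1 :: "(nat \<Rightarrow> 'v) \<Rightarrow> element \<Rightarrow> 'v letter" where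
  "fill1 v Cup = LCup"
| "fill1 v Cap = LCap"
| "fill1 v (Box i n) = LBox n (v i)"

definition fill :: "(nat \<Rightarrow> 'v) \<Rightarrow> tangle \<Rightarrow> 'v word" where
  "fill v T = map (\<lambda>(k, x). (k, fill1 v x)) T"

definition shiftw :: "nat \<Rightarrow> 'v word \<Rightarrow> 'v word" where
  "shiftw k w = map (\<lambda>(j, x). (k + j, x)) w"

lemma fill_simps [simp]:
  "fill v [] = []" "fill v ((k, x) # T) = (k, fill1 v x) # fill v T"
  "fill v (S @ T) = fill v S @ fill v T" "length (fill v T) = length T"
  by (simp_all add: fill_def)

lemma shiftw_simps [simp]:
  "shiftw k [] = []" "shiftw k ((j, x) # w) = (k + j, x) # shiftw k w"
  "shiftw k (u @ w) = shiftw k u @ shiftw k w" "length (shiftw k w) = length w"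
  by (simp_all add: shiftw_def)

lemma shift_simps [simp]:
  "shift k [] = []" "shift k ((j, x) # T) = (k + j, x) # shift k T"
  "shift k (S @ T) = shift k S @ shift k T"
  by (simp_all add: shift_def)

lemma shiftw_0 [simp]: "shiftw 0 w = w"
  by (simp add: shiftw_def)

lemma labelled_append [simp]: "labelled i (u @ w) = labelled i u @ labelled (i + length u) w"
  by (induction u arbitrary: i) auto

lemma labelled_shiftw: "labelled i (shiftw k w) = shift k (labelled i w)"
  by (induction w arbitrary: i) auto

lemma fill_shift: "fill v (shift k T) = shiftw k (fill v T)"
  by (induction T) auto

lemma fill_labelled:
  "(\<And>j. j < length w \<Longrightarrow> v (i + j) = vec (snd (w ! j))) \<Longrightarrow> fill v (labelled i w) = w"
proof (induction w arbitrary: i)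
  case (Cons a w)
  obtain k x where a: "a = (k, x)" by force
  have "v i = vec x" using Cons.prems[of 0] a by simp
  then have "fill1 v (label i x) = x" by (cases x) auto
  moreover have "fill v (labelled (Suc i) w) = w"
    using Cons.prems[of "Suc j" for j] by (intro Cons.IH) auto
  ultimately show ?case by (simp add: a)
qed auto

lemma labels_append [simp]: "labels (S @ T) = labels S @ labels T"
  by (induction S rule: labels.induct) auto

lemma labels_Cons: "labels ((k, x) # T) = (case x of Box i n \<Rightarrow> i # labels T | _ \<Rightarrow> labels T)"
  by (cases x) auto

lemma set_labels_labelled: "set (labels (labelled i w)) \<subseteq> {i..<i + length w}"
  by (induction i w rule: labelled.induct) (auto simp: labels_Cons split: element.splits elim: label.elims)

lemma distinct_labels_labelled: "distinct (labels (labelled i w))"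
proof (induction i w rule: labelled.induct)
  case (2 i k x w)
  then show ?case using set_labels_labelled[of "Suc i" w] by (cases x) auto
qed auto

lemma fill_cong: "(\<And>i. i \<in> set (labels T) \<Longrightarrow> v i = w i) \<Longrightarrow> fill v T = fill w T"
  by (induction T rule: labels.induct) auto

lemma labels_shift [simp]: "labels (shift k T) = labels T"
  by (induction T rule: labels.induct) auto

lemma strings_append: "strings n (S @ T) n' \<longleftrightarrow> (\<exists>l. strings n S l \<and> strings l T n')"
  by (induction n S n' rule: strings.induct) auto

lemma flip_flip [simp]: "flip (flip s) = s"
  by (cases s) auto

lemma flip_pow_add: "(flip ^^ k) ((flip ^^ j) s) = (flip ^^ (k + j)) s"
  by (simp add: funpow_add)

section \<open>Values of words, independently of the choice of labels\<close>

context shaded_planar_algebra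
begin

fun good :: "shading \<Rightarrow> 'v letter \<Rightarrow> bool" where
  "good t (LBox n x) \<longleftrightarrow> x \<in> P n t"
| "good t LCup \<longleftrightarrow> True"
| "good t LCap \<longleftrightarrow> True"

text \<open>Combines the shape condition \<open>strings\<close> with the membership conditions that
  the axioms on \<open>Z\<close> impose on a filling; see \<open>ok_fill\<close>.\<close>

fun ok :: "nat \<Rightarrow> shading \<Rightarrow> 'v word \<Rightarrow> nat \<Rightarrow> bool" where
  "ok n s [] n' \<longleftrightarrow> n = n'"
| "ok n s ((k, x) # w) n' \<longleftrightarrow>
     k + src x \<le> n \<and> good ((flip ^^ k) s) x \<and> ok (n - src x + tgt x) s w n'"

text \<open>The value 0 at cups, caps and beyond the word is a dummy: by \<open>action_cong\<close>
  only the labels of boxes matter.\<close>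

definition eval :: "nat \<Rightarrow> shading \<Rightarrow> 'v word \<Rightarrow> 'v" where
  "eval m s w = Z m s (labelled 0 w) (\<lambda>j. if j < length w then vec (snd (w ! j)) else 0)"

lemma ok_append: "ok n s (u @ w) n' \<longleftrightarrow> (\<exists>l. ok n s u l \<and> ok l s w n')"
  by (induction n s u n' rule: ok.induct) auto

lemma inputs_simps [simp]: "inputs s [] = {}"
  "inputs s ((k, Box i n) # T) = insert (i, n, (flip ^^ k) s) (inputs s T)"
  "inputs s ((k, Cup) # T) = inputs s T"
  "inputs s ((k, Cap) # T) = inputs s T"
  "inputs s (S @ T) = inputs s S \<union> inputs s T"
  by (auto simp: inputs_def)

lemma ok_fill: "ok n s (fill v T) n' \<longleftrightarrow> strings n T n' \<and> (\<forall>i l t. (i, l, t) \<in> inputs s T \<longrightarrow> v i \<in> P l t)"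
proof (induction T arbitrary: n)
  case (Cons a T)
  obtain k x where a: "a = (k, x)" by force
  then show ?case using Cons by (cases x) auto
qed auto

lemma strings_labelled: "ok n s w n' \<Longrightarrow> strings n (labelled i w) n'"
proof (induction w arbitrary: n i)
  case (Cons a w)
  obtain k x where a: "a = (k, x)" by force
  then show ?case using Cons by (cases x) auto
qed auto

lemma is_tangle_labelled: "ok m s w m \<Longrightarrow> is_tangle m (labelled i w)"
  by (simp add: is_tangle_def strings_labelled distinct_labels_labelled)

text \<open>The composition axiom for a one-box tangle is the only means to change a label.\<close>

lemma rename_one:
  assumes "is_tangle m (U @ [(k, Box j n)] @ V)" "is_tangle m (U @ [(k, Box i n)] @ V)"
    and v: "\<And>j' l t. (j', l, t) \<in> inputs s (U @ [(k, Box j n)] @ V) \<Longrightarrow> v j' \<in> P l t"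
    and "v i = v j"
  shows "Z m s (U @ [(k, Box j n)] @ V) v = Z m s (U @ [(k, Box i n)] @ V) v"
proof -
  let ?S = "[(0, Box j n)]"
  have vj: "v j \<in> P n ((flip ^^ k) s)" by (rule v) simp
  have S: "is_tangle n ?S" by (simp add: is_tangle_def)
  have "Z m s (U @ shift k ?S @ V) v =
      Z m s (U @ [(k, Box i n)] @ V) (v(i := Z n ((flip ^^ k) s) ?S v))"
    by (rule action_compose) (use assms(1,2) S in \<open>auto intro!: v\<close>)
  moreover have "Z n ((flip ^^ k) s) ?S v = Z n ((flip ^^ k) s) ?S (\<lambda>_. v j)"
    by (rule action_cong[OF S]) auto
  moreover have "Z n ((flip ^^ k) s) ?S (\<lambda>_. v j) = v i"
    using action_identity[OF vj] assms(4) action_cong[OF S] by auto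
  ultimately show ?thesis by simp
qed

text \<open>\<open>rename_one\<close> is applied layer by layer, with \<open>U\<close> the part
  already renamed. The new labels must avoid all labels still present, and \<open>v\<close> must
  hold the vectors at the new labels from the start, because a renaming does not change the
  filling.\<close>

lemma relabel_step:
  assumes "is_tangle m (U @ T)"
    and "\<And>i l t. (i, l, t) \<in> inputs s (U @ T) \<Longrightarrow> v i \<in> P l t"
    and "set (labels (U @ T)) \<inter> {N..<N + length T} = {}"
    and "\<And>j. j < length T \<Longrightarrow> v (N + j) = vec (snd (fill v T ! j))"
  shows "Z m s (U @ T) v = Z m s (U @ labelled N (fill v T)) v"
  using assms
proof (induction T arbitrary: U N)
  case (Cons a T)
  obtain k x where a: "a = (k, x)" by force
  define a' where "a' = (k, label N (fill1 v x))"
  have vN: "v N = vec (fill1 v x)" using Cons.prems(4)[of 0] by (simp add: a)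
  have IH: "Z m s ((U @ [a']) @ T) v = Z m s ((U @ [a']) @ labelled (Suc N) (fill v T)) v"
    if t: "is_tangle m ((U @ [a']) @ T)"
  proof (rule Cons.IH[OF t])
    show "v i \<in> P l t" if "(i, l, t) \<in> inputs s ((U @ [a']) @ T)" for i l t
      using that Cons.prems(2) vN by (cases x) (auto simp: a a'_def)
    show "set (labels ((U @ [a']) @ T)) \<inter> {Suc N..<Suc N + length T} = {}"
      using Cons.prems(3) by (cases x) (auto simp: a a'_def)
    show "v (Suc N + j) = vec (snd (fill v T ! j))" if "j < length T" for j
      using that Cons.prems(4)[of "Suc j"] by (simp add: a)
  qed
  show ?case
  proof (cases x)
    case (Box i n)
    have t: "is_tangle m (U @ [(k, Box N n)] @ T)"
      using Cons.prems(1,3) by (auto simp: is_tangle_def strings_append a Box)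
    have "Z m s (U @ [(k, Box i n)] @ T) v = Z m s (U @ [(k, Box N n)] @ T) v"
      by (rule rename_one) (use Cons.prems(1,2) t vN in \<open>auto simp: a Box\<close>)
    then show ?thesis using IH t by (simp add: a a'_def Box)
  qed (use IH Cons.prems(1) in \<open>simp_all add: a a'_def\<close>)
qed simp

lemma relabel_fresh:
  assumes T: "is_tangle m T" and v: "\<And>i l t. (i, l, t) \<in> inputs s T \<Longrightarrow> v i \<in> P l t"
    and N: "\<And>i. i \<in> set (labels T) \<Longrightarrow> i < N"
  shows "Z m s T v = Z m s (labelled N (fill v T)) (\<lambda>j. vec (snd (fill v T ! (j - N))))"
proof -
  define v' where "v' = (\<lambda>j. if j < N then v j else vec (snd (fill v T ! (j - N))))"
  have fv: "fill v' T = fill v T"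
    by (rule fill_cong) (use N in \<open>auto simp: v'_def\<close>)
  have ok: "ok m s (fill v T) m" using T v by (auto simp: ok_fill is_tangle_def)
  have "Z m s T v = Z m s T v'"
    by (rule action_cong[OF T]) (use N in \<open>auto simp: v'_def\<close>)
  also have "\<dots> = Z m s (labelled N (fill v' T)) v'"
  proof -
    have "v' i \<in> P l t" if "(i, l, t) \<in> inputs s T" for i l t
      using that ok unfolding fv[symmetric] ok_fill by blast
    moreover have "v' (N + j) = vec (snd (fill v' T ! j))" for j
      unfolding fv by (simp add: v'_def)
    ultimately show ?thesis
      using relabel_step[of m "[]" T s v' N] T N by fastforce
  qed
  also have "\<dots> = Z m s (labelled N (fill v T)) (\<lambda>j. vec (snd (fill v T ! (j - N))))"
    unfolding fv using set_labels_labelled[of N "fill v T"]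
    by (intro action_cong is_tangle_labelled[OF ok]) (auto simp: v'_def)
  finally show ?thesis .
qed

text \<open>Renaming directly to 0, 1, 2, ... could collide with labels still in use. Both
  \<open>T\<close> and the standard labelling of its word are therefore renamed to a third range,
  which starts above the labels of either.\<close>

theorem Z_eq_eval:
  assumes T: "is_tangle m T" and v: "\<And>i l t. (i, l, t) \<in> inputs s T \<Longrightarrow> v i \<in> P l t"
  shows "Z m s T v = eval m s (fill v T)"
proof -
  let ?w = "fill v T" and ?u = "\<lambda>j. if j < length (fill v T) then vec (snd (fill v T ! j)) else 0"
  define N where "N = Suc (Max (set (labels T) \<union> {length T}))"
  have N: "i < N" if "i \<in> set (labels T) \<or> i \<le> length T" for i
  proof -
    have "i \<le> Max (set (labels T) \<union> {length T})" if "i \<in> set (labels T)" using that by simp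
    moreover have "length T \<le> Max (set (labels T) \<union> {length T})" by simp
    ultimately show ?thesis using that unfolding N_def by linarith
  qed
  have ok: "ok m s ?w m" using T v by (auto simp: ok_fill is_tangle_def)
  have f: "fill ?u (labelled 0 ?w) = ?w" by (rule fill_labelled) simp
  have "eval m s ?w = Z m s (labelled N (fill ?u (labelled 0 ?w)))
      (\<lambda>j. vec (snd (fill ?u (labelled 0 ?w) ! (j - N))))"
    unfolding eval_def
  proof (rule relabel_fresh[OF is_tangle_labelled[OF ok]])
    show "?u i \<in> P l t" if "(i, l, t) \<in> inputs s (labelled 0 ?w)" for i l t
      using ok that ok_fill[of m s ?u "labelled 0 ?w" m] unfolding f by blast
    show "i < N" if "i \<in> set (labels (labelled 0 ?w))" for i
      using that set_labels_labelled[of 0 ?w] N[of i] by auto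
  qed
  also have "\<dots> = Z m s T v"
    unfolding f by (rule relabel_fresh[symmetric, OF T v]) (use N in auto)
  finally show ?thesis by simp
qed

lemma eval_eq_Z:
  assumes "ok m s w m" "is_tangle m T" "fill v T = w"
  shows "eval m s w = Z m s T v"
  using assms ok_fill[of m s v T m] Z_eq_eval by metis

lemma eval_in_P [simp]:
  assumes "ok m s w m" shows "eval m s w \<in> P m s"
proof -
  let ?u = "\<lambda>j. if j < length w then vec (snd (w ! j)) else 0"
  have "fill ?u (labelled 0 w) = w" by (rule fill_labelled) simp
  then show ?thesis
    unfolding eval_def using assms ok_fill[of m s ?u "labelled 0 w" m]
    by (intro action_closed is_tangle_labelled) auto
qed

lemma eval_single: "x \<in> P m s \<Longrightarrow> eval m s [(0, LBox m x)] = x"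
  using action_identity[of x m s] Z_eq_eval[of m "[(0, Box 0 m)]" s "\<lambda>_. x"]
  by (auto simp: is_tangle_def)

lemma eval_linear:
  assumes "ok m s (U @ [(k, LBox n x)] @ V) m" "ok m s (U @ [(k, LBox n y)] @ V) m"
  shows "eval m s (U @ [(k, LBox n (c *s x + y))] @ V) =
    c *s eval m s (U @ [(k, LBox n x)] @ V) + eval m s (U @ [(k, LBox n y)] @ V)"
proof -
  define w where "w = (\<lambda>z. U @ [(k, LBox n z)] @ V)"
  define u where "u = (\<lambda>z j. if j < length (w z) then vec (snd (w z ! j)) else 0)"
  define T where "T = labelled 0 U @ [(k, Box (length U) n)] @ labelled (Suc (length U)) V"
  have l: "labelled 0 (w z) = T" for z by (simp add: w_def T_def)
  have u: "u z = (u x)(length U := z)" for z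
    by (auto simp: u_def w_def nth_append nth_Cons fun_eq_iff split: nat.splits)
  have f: "fill (u z) T = w z" for z unfolding l[of z, symmetric]
    by (rule fill_labelled) (simp add: u_def)
  have ev: "eval m s (w z) = Z m s T (u z)" for z
    by (simp add: eval_def u_def l)
  have okx: "ok m s (w x) m" using assms by (simp add: w_def)
  have T: "is_tangle m T" using is_tangle_labelled[OF okx, of 0] by (simp add: l)
  have xy: "x \<in> P n ((flip ^^ k) s)" "y \<in> P n ((flip ^^ k) s)"
    using assms by (auto simp: ok_append)
  have "Z m s T ((u x)(length U := c *s x + y)) =
      c *s Z m s T ((u x)(length U := x)) + Z m s T ((u x)(length U := y))"
    by (rule action_multilinear[OF T, where n' = n and t' = "(flip ^^ k) s"])
      (use okx xy ok_fill[of m s "u x" T m] f[of x] in \<open>auto simp: T_def\<close>)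
  then show ?thesis using ev[unfolded w_def] u by metis
qed

lemma ok_shiftw:
  "ok n ((flip ^^ k) s) S n' \<Longrightarrow> k + n \<le> l \<Longrightarrow> ok l s (shiftw k S) (l - n + n')"
proof (induction S arbitrary: n l)
  case (Cons a S)
  obtain j x where a: "a = (j, x)" by force
  have 1: "j + src x \<le> n" "good ((flip ^^ (k + j)) s) x" "ok (n - src x + tgt x) ((flip ^^ k) s) S n'"
    using Cons.prems(1) unfolding a ok.simps flip_pow_add add.commute[of j k] by blast+
  have "ok (l - src x + tgt x) s (shiftw k S) (l - src x + tgt x - (n - src x + tgt x) + n')"
    using 1 Cons.prems(2) by (intro Cons.IH) auto
  moreover have "l - src x + tgt x - (n - src x + tgt x) = l - n" using 1 Cons.prems(2) by auto
  ultimately show ?case using 1(1,2) Cons.prems(2) by (simp add: a)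
qed auto

lemma eval_compose:
  assumes U: "ok m s U l" and V: "ok l s V m" and l: "k + n \<le> l" and S: "ok n ((flip ^^ k) s) S n"
  shows "eval m s (U @ shiftw k S @ V) =
    eval m s (U @ [(k, LBox n (eval n ((flip ^^ k) s) S))] @ V)"
proof -
  define w where "w = U @ shiftw k S @ V"
  define v where "v = (\<lambda>j. if j < length w then vec (snd (w ! j)) else 0)"
  define A where "A = labelled 0 U"
  define B where "B = labelled (length U) S"
  define C where "C = labelled (length U + length S) V"
  have lw: "labelled 0 w = A @ shift k B @ C"
    by (simp add: w_def A_def B_def C_def labelled_shiftw)
  have fA: "fill v A = U"
    unfolding A_def by (rule fill_labelled) (simp add: v_def w_def nth_append)
  have fB: "fill v B = S"
    unfolding B_def by (rule fill_labelled) (simp add: v_def w_def nth_append shiftw_def case_prod_beta)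
  have fC: "fill v C = V"
    unfolding C_def by (rule fill_labelled) (simp add: v_def w_def nth_append)
  have okw: "ok m s w m"
    using U V ok_shiftw[OF S l] l by (auto simp: w_def ok_append)
  have B: "is_tangle n B"
    using is_tangle_labelled[OF S] by (simp add: B_def)
  have inB: "v i \<in> P l t" if "(i, l, t) \<in> inputs ((flip ^^ k) s) B" for i l t
    using that ok_fill[of n "(flip ^^ k) s" v B n] S fB by auto
  have ABC: "is_tangle m (A @ shift k B @ C)" using is_tangle_labelled[OF okw, of 0] by (simp add: lw)
  have inw: "v i \<in> P l t" if "(i, l, t) \<in> inputs s (A @ shift k B @ C)" for i l t
    using that ok_fill[of m s v "A @ shift k B @ C" m] okw unfolding fill_simps fill_shift fA fB fC w_def by blast
  \<comment> \<open>This label does not occur in \<open>labelled 0 w\<close>, so overriding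
    \<open>v\<close> there leaves the fillings of \<open>U\<close> and \<open>V\<close>
    unchanged.\<close>
  define i where "i = length w"
  let ?v = "v(i := Z n ((flip ^^ k) s) B v)"
  have fresh: "i \<notin> set (labels A)" "i \<notin> set (labels C)"
    using set_labels_labelled[of 0 U] set_labels_labelled[of "length U + length S" V]
    by (auto simp: A_def C_def i_def w_def)
  have cong: "fill ?v T = fill v T" if "i \<notin> set (labels T)" for T
    using that by (intro fill_cong) auto
  have f': "fill ?v A = U" "fill ?v C = V" using cong fresh fA fC by auto
  have ZB: "Z n ((flip ^^ k) s) B v = eval n ((flip ^^ k) s) S"
    using Z_eq_eval[OF B inB] fB by simp
  let ?T = "A @ [(k, Box i n)] @ C" and ?w = "U @ [(k, LBox n (eval n ((flip ^^ k) s) S))] @ V"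
  have f: "fill ?v ?T = ?w" using f' ZB by simp
  have ok': "ok m s ?w m" using U V l S by (auto simp: ok_append)
  have T: "is_tangle m ?T"
    using ok_fill[of m s ?v ?T m] ok' ABC fresh f by (auto simp: is_tangle_def)
  have "eval m s w = Z m s (A @ shift k B @ C) v"
    by (simp add: eval_def v_def lw)
  also have "\<dots> = Z m s ?T ?v"
    by (rule action_compose[OF T B ABC inw])
  also have "\<dots> = eval m s ?w"
    using eval_eq_Z[OF ok' T f] by simp
  finally show ?thesis by (simp add: w_def)
qed


section \<open>Planar isotopy for words\<close>

lemma labels_cups_caps [simp]: "labels (cups k m) = []" "labels (caps k m) = []"
  by (induction m) (auto simp: cups_def caps_def)

lemma local_move_labels: "local_move X Y \<Longrightarrow>
    set (labels X) = set (labels Y) \<and> distinct (labels X) = distinct (labels Y)"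
proof (induction rule: local_move.induct)
  case (exchange k x l y)
  then show ?case by (cases x; cases y) auto
qed auto

text \<open>\<open>Y\<close> carries the labels of the old piece, so one filling serves both sides.
  A local move preserves the set of labels and their distinctness, hence only \<open>strings\<close>
  has to be checked for the new tangle. The disjunction allows a move in either direction.\<close>

lemma eval_move:
  assumes lm: "local_move (labelled (length U) x) Y \<or> local_move Y (labelled (length U) x)"
    and y: "\<And>v. (\<And>j. j < length x \<Longrightarrow> v (length U + j) = vec (snd (x ! j))) \<Longrightarrow> fill v Y = y"
    and okx: "ok m s (U @ x @ V) m" and oky: "ok m s (U @ y @ V) m"
  shows "eval m s (U @ x @ V) = eval m s (U @ y @ V)"
proof -
  define w where "w = U @ x @ V"
  define v where "v = (\<lambda>j. if j < length w then vec (snd (w ! j)) else 0)"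
  define A where "A = labelled 0 U"
  define B where "B = labelled (length U) x"
  define C where "C = labelled (length U + length x) V"
  have lw: "labelled 0 w = A @ B @ C"
    by (simp add: w_def A_def B_def C_def)
  have fA: "fill v A = U"
    unfolding A_def by (rule fill_labelled) (simp add: v_def w_def nth_append)
  have fB: "fill v B = x"
    unfolding B_def by (rule fill_labelled) (simp add: v_def w_def nth_append)
  have fC: "fill v C = V"
    unfolding C_def by (rule fill_labelled) (simp add: v_def w_def nth_append)
  have fY: "fill v Y = y"
    by (rule y) (simp add: v_def w_def nth_append)
  have X: "is_tangle m (A @ B @ C)" using is_tangle_labelled[OF okx, of 0] by (simp add: lw flip: w_def)
  have inX: "v i \<in> P l t" if "(i, l, t) \<in> inputs s (A @ B @ C)" for i l t
    using that ok_fill[of m s v "A @ B @ C" m] okx unfolding fill_simps fA fB fC by blast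
  have "strings m (A @ Y @ C) m"
    using ok_fill[of m s v "A @ Y @ C" m] oky unfolding fill_simps fA fY fC by blast
  then have Y: "is_tangle m (A @ Y @ C)"
    using X lm local_move_labels[of B Y] local_move_labels[of Y B] by (auto simp: is_tangle_def B_def)
  have "isotopic m (A @ B @ C) (A @ Y @ C)"
    using lm isotopic_move[of B Y m A C] isotopic_sym[OF isotopic_move[of Y B m A C]] X Y
    by (auto simp: B_def)
  then have "Z m s (A @ B @ C) v = Z m s (A @ Y @ C) v"
    by (rule action_isotopy) (rule inX)
  moreover have "eval m s (U @ x @ V) = Z m s (A @ B @ C) v"
    by (rule eval_eq_Z[OF okx X]) (simp add: fA fB fC)
  moreover have "eval m s (U @ y @ V) = Z m s (A @ Y @ C) v"
    by (rule eval_eq_Z[OF oky Y]) (simp add: fA fY fC)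
  ultimately show ?thesis by simp
qed

lemma points_label [simp]: "points_below (label i x) = src x" "points_above (label i x) = tgt x"
  by (cases x; simp)+

lemma eval_exchange:
  assumes "k + tgt x \<le> l"
    and "ok m s (U @ [(k, x), (l, y)] @ V) m" "ok m s (U @ [(l - tgt x + src x, y), (k, x)] @ V) m"
  shows "eval m s (U @ [(k, x), (l, y)] @ V) = eval m s (U @ [(l - tgt x + src x, y), (k, x)] @ V)"
proof (rule eval_move[OF disjI1 _ assms(2,3)])
  show "local_move (labelled (length U) [(k, x), (l, y)])
      [(l - tgt x + src x, label (Suc (length U)) y), (k, label (length U) x)]"
    using exchange[of k "label (length U) x" l "label (Suc (length U)) y"] assms(1) by simp
  show "fill v [(l - tgt x + src x, label (Suc (length U)) y), (k, label (length U) x)] =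
      [(l - tgt x + src x, y), (k, x)]"
    if "\<And>j. j < length [(k, x), (l, y)] \<Longrightarrow> v (length U + j) = vec (snd ([(k, x), (l, y)] ! j))" for v
    using that[of 0] that[of 1] by (cases x; cases y) auto
qed

lemma eval_zigzag:
  assumes "ok m s (U @ V) m"
  shows "ok m s (U @ [(k, LCup), (Suc k, LCap)] @ V) m \<Longrightarrow>
      eval m s (U @ [(k, LCup), (Suc k, LCap)] @ V) = eval m s (U @ V)"
    and "ok m s (U @ [(Suc k, LCup), (k, LCap)] @ V) m \<Longrightarrow>
      eval m s (U @ [(Suc k, LCup), (k, LCap)] @ V) = eval m s (U @ V)"
  using eval_move[of U "[(k, LCup), (Suc k, LCap)]" "[]" "[]" m s V] zigzag_left[of k] assms
    eval_move[of U "[(Suc k, LCup), (k, LCap)]" "[]" "[]" m s V] zigzag_right[of k] by simp_all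

end

section \<open>Equivalence and reduction of words\<close>

lemma even_tgt_src: "even (tgt x + src x)"
  by (cases x) auto

text \<open>A letter that passes a cup or a cap moves by two strings; equal parity keeps the shading
  at its left edge.\<close>

lemma flip_pow_parity: "even (i + j) \<Longrightarrow> (flip ^^ i) s = (flip ^^ j) s"
proof -
  have e: "(flip ^^ (2 * k)) s = s" for k s by (induction k) auto
  have "i \<le> j \<Longrightarrow> even (i + j) \<Longrightarrow> (flip ^^ i) s = (flip ^^ j) s" for i j s
  proof -
    assume "i \<le> j" "even (i + j)"
    then obtain k where "j = i + 2 * k" by (metis dvdE even_diff_nat add.commute le_add_diff_inverse even_add)
    then show ?thesis by (simp add: e flip: flip_pow_add)
  qed
  then show "even (i + j) \<Longrightarrow> (flip ^^ i) s = (flip ^^ j) s"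
    by (metis add.commute nat_le_linear)
qed

context shaded_planar_algebra
begin

lemma ok_parity: "ok n s w n' \<Longrightarrow> even (n + n')"
proof (induction n s w n' rule: ok.induct)
  case (2 n s k x w n')
  have 1: "src x \<le> n" "even (n - src x + tgt x + n')" using 2 by auto
  then show ?case using even_tgt_src[of x] by presburger
qed auto

text \<open>\<open>equ\<close> and \<open>red\<close> quantify over all surrounding words, which makes them congruences.\<close>

definition equ :: "shading \<Rightarrow> nat \<Rightarrow> 'v word \<Rightarrow> 'v word \<Rightarrow> nat \<Rightarrow> bool" where
  "equ s n w w' n' \<longleftrightarrow> ok n s w n' \<and> ok n s w' n' \<and>
    (\<forall>m U V. ok m s U n \<longrightarrow> ok n' s V m \<longrightarrow> eval m s (U @ w @ V) = eval m s (U @ w' @ V))"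

lemma equ_refl: "ok n s w n' \<Longrightarrow> equ s n w w n'"
  by (simp add: equ_def)

lemma equ_sym: "equ s n w w' n' \<Longrightarrow> equ s n w' w n'"
  by (auto simp: equ_def)

lemma equ_trans: "equ s n w w' n' \<Longrightarrow> equ s n w' w'' n' \<Longrightarrow> equ s n w w'' n'"
  by (auto simp: equ_def)

lemma equ_okD: "equ s n w w' n' \<Longrightarrow> ok n s w n'" "equ s n w w' n' \<Longrightarrow> ok n s w' n'"
  by (auto simp: equ_def)

lemma equ_ctx:
  assumes "equ s n w w' n'" "ok l s U n" "ok n' s V l'"
  shows "equ s l (U @ w @ V) (U @ w' @ V) l'"
  unfolding equ_def
proof (intro conjI allI impI)
  fix m A B assume "ok m s A l" "ok l' s B m"
  then have "ok m s (A @ U) n" "ok n' s (V @ B) m"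
    using assms by (auto simp: ok_append)
  then have "eval m s ((A @ U) @ w @ (V @ B)) = eval m s ((A @ U) @ w' @ (V @ B))"
    using assms(1) unfolding equ_def by blast
  then show "eval m s (A @ (U @ w @ V) @ B) = eval m s (A @ (U @ w' @ V) @ B)"
    by simp
qed (use assms in \<open>auto simp: equ_def ok_append\<close>)

lemma equ_exchange:
  assumes "k + tgt x \<le> l" "ok n s [(k, x), (l, y)] n'"
  shows "equ s n [(k, x), (l, y)] [(l - tgt x + src x, y), (k, x)] n'"
proof -
  have "even (l - tgt x + src x + l)"
    using even_tgt_src[of x] assms(1) by presburger
  then have "good ((flip ^^ (l - tgt x + src x)) s) y"
    using assms flip_pow_parity by (metis ok.simps(2))
  moreover have "n - src y + tgt y - src x + tgt x = n - src x + tgt x - src y + tgt y"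
    using assms by auto
  ultimately have "ok n s [(l - tgt x + src x, y), (k, x)] n'"
    using assms by auto
  then show ?thesis
    using assms unfolding equ_def ok_append
    by (intro conjI allI impI eval_exchange) (auto simp only: ok_append)
qed

lemma equ_zigzag_left: "k \<le> n \<Longrightarrow> 1 \<le> n - k \<Longrightarrow> equ s n [(k, LCup), (Suc k, LCap)] [] n"
  unfolding equ_def by (auto simp: ok_append intro!: eval_zigzag(1)[simplified])

lemma equ_zigzag_right: "k \<le> n \<Longrightarrow> 1 \<le> n - k \<Longrightarrow> equ s n [(Suc k, LCup), (k, LCap)] [] n"
  unfolding equ_def by (auto simp: ok_append intro!: eval_zigzag(2)[simplified])

lemma equ_box:
  assumes "k + n \<le> l" "ok n ((flip ^^ k) s) S n"
  shows "equ s l (shiftw k S) [(k, LBox n (eval n ((flip ^^ k) s) S))] l"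
  unfolding equ_def
  using assms ok_shiftw[OF assms(2,1)] by (intro conjI allI impI eval_compose) auto

text \<open>\<open>y\<close> stands to the right of the \<open>N\<close> strings on which
  \<open>u\<close> acts, at distance \<open>j\<close>. It slides up through \<open>u\<close> by one
  exchange per letter, and its position follows the changing number of strings on its left.\<close>

lemma equ_commute1:
  "ok N s u N' \<Longrightarrow> good ((flip ^^ (N + j)) s) y \<Longrightarrow> N + j + src y \<le> l \<Longrightarrow>
    equ s l ((N + j, y) # u) (u @ [(N' + j, y)]) (l - N + N' - src y + tgt y)"
proof (induction u arbitrary: N l)
  case (Cons a u)
  obtain k x where a: "a = (k, x)" by force
  let ?M = "N - src x + tgt x" and ?l = "l - src x + tgt x"
  have k: "k + src x \<le> N" "good ((flip ^^ k) s) x" and u: "ok ?M s u N'"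
    using Cons.prems(1) by (auto simp: a)
  have par: "even (?M + j + (N + j))" using k(1) even_tgt_src[of x]
    by presburger
  have gy: "good ((flip ^^ (?M + j)) s) y" using Cons.prems(2) flip_pow_parity[OF par] by simp
  have IH: "equ s ?l ((?M + j, y) # u) (u @ [(N' + j, y)]) (?l - ?M + N' - src y + tgt y)"
    by (rule Cons.IH[OF u gy]) (use Cons.prems(3) k in auto)
  have e1: "equ s l [(k, x), (?M + j, y)] [(N + j, y), (k, x)] (?l - src y + tgt y)"
  proof -
    have "?M + j - tgt x + src x = N + j" using k by auto
    moreover have "ok l s [(k, x), (?M + j, y)] (?l - src y + tgt y)"
      using k gy Cons.prems(3) by auto
    ultimately show ?thesis
      using equ_exchange[of k x "?M + j" l s y "?l - src y + tgt y"] k by auto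
  qed
  have fin: "?l - ?M + N' - src y + tgt y = l - N + N' - src y + tgt y"
    using k Cons.prems(3) by auto
  have oku: "ok (?l - src y + tgt y) s u (l - N + N' - src y + tgt y)"
    using equ_okD(1)[OF IH] unfolding ok.simps fin by blast
  have 1: "equ s l ([] @ [(N + j, y), (k, x)] @ u) ([] @ [(k, x), (?M + j, y)] @ u)
      (l - N + N' - src y + tgt y)"
    by (rule equ_ctx[OF equ_sym[OF e1] _ oku]) simp
  have 2: "equ s l ([(k, x)] @ ((?M + j, y) # u) @ []) ([(k, x)] @ (u @ [(N' + j, y)]) @ [])
      (l - N + N' - src y + tgt y)"
    by (rule equ_ctx[OF IH]) (use k fin Cons.prems(3) in auto)
  show ?case
    using equ_trans[OF 1, of "(k, x) # u @ [(N' + j, y)]"] 2 by (simp add: a)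
qed (auto intro: equ_refl)

lemma equ_commute:
  "ok N s u N' \<Longrightarrow> ok L ((flip ^^ N) s) r L' \<Longrightarrow>
    equ s (N + L) (shiftw N r @ u) (u @ shiftw N' r) (N' + L')"
proof (induction r arbitrary: L)
  case Nil
  then show ?case using ok_shiftw[of N 0 s u N' "N + L"] by (auto simp: add.commute intro!: equ_refl)
next
  case (Cons a r)
  obtain j y where a: "a = (j, y)" by force
  let ?L = "L - src y + tgt y"
  have y: "j + src y \<le> L" "good ((flip ^^ (N + j)) s) y" "ok ?L ((flip ^^ N) s) r L'"
    using Cons.prems(2) unfolding a ok.simps flip_pow_add by (auto simp: add.commute)
  have IH: "equ s (N + ?L) (shiftw N r @ u) (u @ shiftw N' r) (N' + L')"
    by (rule Cons.IH) (use Cons.prems y in auto)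
  have c: "equ s (N + L) ((N + j, y) # u) (u @ [(N' + j, y)]) (N' + ?L)"
  proof -
    have "N + L - N + N' - src y + tgt y = N' + ?L" using y(1) by auto
    then show ?thesis using equ_commute1[OF Cons.prems(1) y(2), of "N + L"] y(1) by auto
  qed
  have p: "(flip ^^ N) s = (flip ^^ N') s"
    by (rule flip_pow_parity) (rule ok_parity[OF Cons.prems(1)])
  have o: "ok (N' + ?L) s (shiftw N' r) (N' + L')"
    using ok_shiftw[of ?L N' s r L' "N' + ?L"] y(3) unfolding p by simp
  have 1: "equ s (N + L) ([(N + j, y)] @ (shiftw N r @ u) @ []) ([(N + j, y)] @ (u @ shiftw N' r) @ []) (N' + L')"
    by (rule equ_ctx[OF IH]) (use y in auto)
  have 2: "equ s (N + L) ([] @ ((N + j, y) # u) @ shiftw N' r) ([] @ (u @ [(N' + j, y)]) @ shiftw N' r) (N' + L')"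
    by (rule equ_ctx[OF c _ o]) simp
  have "equ s (N + L) ((N + j, y) # shiftw N r @ u) (u @ (N' + j, y) # shiftw N' r) (N' + L')"
    using equ_trans[OF 1, of "u @ (N' + j, y) # shiftw N' r"] 2 by simp
  then show ?case by (simp add: a)
qed

definition red :: "shading \<Rightarrow> nat \<Rightarrow> 'v word \<Rightarrow> 'v word set \<Rightarrow> nat \<Rightarrow> bool" where
  "red s n w A n' \<longleftrightarrow> ok n s w n' \<and>
    (\<forall>m U V. ok m s U n \<longrightarrow> ok n' s V m \<longrightarrow>
      eval m s (U @ w @ V) \<in> span ((\<lambda>w'. eval m s (U @ w' @ V)) ` {w' \<in> A. ok n s w' n'}))"

lemma red_self: "w \<in> A \<Longrightarrow> ok n s w n' \<Longrightarrow> red s n w A n'"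
  by (auto simp: red_def intro!: span_base)

lemma red_trans:
  assumes "red s n w A n'" and B: "\<And>w'. w' \<in> A \<Longrightarrow> ok n s w' n' \<Longrightarrow> red s n w' B n'"
  shows "red s n w B n'"
  unfolding red_def
proof (intro conjI allI impI)
  fix m U V assume UV: "ok m s U n" "ok n' s V m"
  let ?f = "\<lambda>w'. eval m s (U @ w' @ V)"
  have "?f w \<in> span (?f ` {w' \<in> A. ok n s w' n'})" using assms UV by (simp add: red_def)
  moreover have "?f ` {w' \<in> A. ok n s w' n'} \<subseteq> span (?f ` {w' \<in> B. ok n s w' n'})"
    using B UV by (auto simp: red_def)
  ultimately show "?f w \<in> span (?f ` {w' \<in> B. ok n s w' n'})"
    using span_minimal subspace_span by blast
qed (use assms in \<open>simp add: red_def\<close>)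

lemma red_mono: "red s n w A n' \<Longrightarrow> A \<subseteq> B \<Longrightarrow> red s n w B n'"
  by (erule red_trans) (auto intro: red_self)

lemma red_equ: "equ s n w w' n' \<Longrightarrow> red s n w' A n' \<Longrightarrow> red s n w A n'"
  by (simp add: equ_def red_def)

lemma red_ctx:
  assumes "red s n w A n'" "ok l s U n" "ok n' s V l'"
  shows "red s l (U @ w @ V) {U @ w' @ V | w'. w' \<in> A} l'"
  unfolding red_def
proof (intro conjI allI impI)
  show "ok l s (U @ w @ V) l'" using assms by (auto simp: red_def ok_append)
next
  fix m A' B' assume *: "ok m s A' l" "ok l' s B' m"
  have "ok m s (A' @ U) n" "ok n' s (V @ B') m" using * assms by (auto simp: ok_append)
  then have "eval m s ((A' @ U) @ w @ (V @ B')) \<in>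
      span ((\<lambda>w'. eval m s ((A' @ U) @ w' @ (V @ B'))) ` {w' \<in> A. ok n s w' n'})"
    using assms(1) unfolding red_def by blast
  moreover have "(\<lambda>w'. eval m s ((A' @ U) @ w' @ (V @ B'))) ` {w' \<in> A. ok n s w' n'} \<subseteq>
      (\<lambda>w'. eval m s (A' @ w' @ B')) ` {w' \<in> {U @ w' @ V | w'. w' \<in> A}. ok l s w' l'}"
    using assms by (force simp: ok_append)
  ultimately show "eval m s (A' @ (U @ w @ V) @ B') \<in>
      span ((\<lambda>w'. eval m s (A' @ w' @ B')) ` {w' \<in> {U @ w' @ V | w'. w' \<in> A}. ok l s w' l'})"
    using span_mono by (simp only: append.assoc) blast
qed

text \<open>This is how linear relations among boxes enter the reduction of words.\<close>

lemma red_box: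
  assumes X: "x \<in> span X" "X \<subseteq> P n ((flip ^^ k) s)" "k + n \<le> l"
  shows "red s l [(k, LBox n x)] {[(k, LBox n b)] | b. b \<in> X} l"
proof -
  have PX: "x \<in> P n ((flip ^^ k) s)"
    using X(1,2) subspace_P span_minimal by blast
  show ?thesis unfolding red_def
  proof (intro conjI allI impI)
    show "ok l s [(k, LBox n x)] l" using PX X(3) by auto
  next
    fix m U V assume UV: "ok m s U l" "ok l s V m"
    let ?f = "\<lambda>x. eval m s (U @ [(k, LBox n x)] @ V)"
    let ?S = "(\<lambda>w'. eval m s (U @ w' @ V)) ` {w' \<in> {[(k, LBox n b)] | b. b \<in> X}. ok l s w' l}"
    have lin: "?f (c *s y + z) = c *s ?f y + ?f z"
      if "y \<in> P n ((flip ^^ k) s)" "z \<in> P n ((flip ^^ k) s)" for c y z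
      by (rule eval_linear) (use UV X(3) that in \<open>auto simp: ok_append\<close>)
    have z: "?f 0 = 0"
      using lin[of 0 0 1] subspace_0[OF subspace_P] by simp
    have "x \<in> P n ((flip ^^ k) s) \<and> ?f x \<in> span ?S"
      using X(1)
    proof (induction rule: span_induct_alt)
      case base
      then show ?case using z subspace_0[OF subspace_P] span_zero by simp
    next
      case (step c y z)
      have y: "y \<in> P n ((flip ^^ k) s)" using X(2) step by auto
      then have fy: "?f y \<in> ?S"
        using X(3) step by (intro image_eqI[of _ _ "[(k, LBox n y)]"]) auto
      have "?f (c *s y + z) \<in> span ?S"
        unfolding lin[OF y conjunct1[OF step(2)]]
        by (rule span_add[OF span_scale[OF span_base[OF fy]] conjunct2[OF step(2)]])
      moreover have "c *s y + z \<in> P n ((flip ^^ k) s)"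
        using y step subspace_P by (simp add: subspace_add subspace_scale)
      ultimately show ?case by simp
    qed
    then show "?f x \<in> span ?S" by simp
  qed
qed

lemma red_eval: "red s n w A n \<Longrightarrow> eval n s w \<in> span (eval n s ` {w' \<in> A. ok n s w' n})"
  unfolding red_def by (drule conjunct2, drule spec[of _ n], drule spec[of _ "[]"], drule spec[of _ "[]"]) simp

lemma ok_letter:
  "ok n s ((k, LCup) # w) n' \<longleftrightarrow> k \<le> n \<and> ok (n + 2) s w n'"
  "ok n s ((k, LCap) # w) n' \<longleftrightarrow> k + 2 \<le> n \<and> ok (n - 2) s w n'"
  "ok n s ((k, LBox m x) # w) n' \<longleftrightarrow> k + m \<le> n \<and> x \<in> P m ((flip ^^ k) s) \<and> ok n s w n'"
  by auto

declare ok.simps(2) [simp del] ok_letter [simp]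

end

section \<open>Normal form of words\<close>

text \<open>\<open>Q\<close> is kept abstract because the normal form is needed for two choices: the
  span of \<open>id\<close> and \<open>h\<close> in \<open>brick_algebra_TL\<close>, and all 2-boxes
  in \<open>brick_algebra_P_2\<close>. \<open>Q_cap\<close> is the only assumption that concerns
  1-boxes.\<close>

locale brick_algebra = shaded_planar_algebra +
  fixes Q :: "shading \<Rightarrow> 'a set"
  assumes Q_subset: "Q t \<subseteq> P 2 t"
    and Q_id: "eval 2 t [] \<in> Q t"
    and Q_h: "eval 2 t [(0, LCap), (0, LCup)] \<in> Q t"
    and Q_mult: "x \<in> Q t \<Longrightarrow> y \<in> Q t \<Longrightarrow> eval 2 t [(0, LBox 2 x), (0, LBox 2 y)] \<in> Q t"
    and Q_yang_baxter: "x \<in> Q (flip t) \<Longrightarrow> y \<in> Q t \<Longrightarrow> z \<in> Q (flip t) \<Longrightarrow>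
      eval 3 t [(1, LBox 2 x), (0, LBox 2 y), (1, LBox 2 z)] \<in>
      span {eval 3 t [(0, LBox 2 x'), (1, LBox 2 y'), (0, LBox 2 z')] | x' y' z'.
        x' \<in> Q t \<and> y' \<in> Q (flip t) \<and> z' \<in> Q t}"
    and Q_cap: "x \<in> Q t \<Longrightarrow>
      eval 1 t [(1, LCup), (0, LBox 2 x), (1, LCap)] \<in> span {eval 1 t []}"
begin

definition bricks :: "shading \<Rightarrow> nat \<Rightarrow> 'a word set" where
  "bricks s n = {w. \<forall>a\<in>set w. \<exists>k x. a = (k, LBox 2 x) \<and> k + 2 \<le> n \<and> x \<in> Q ((flip ^^ k) s)}"

lemma bricks_simps [simp]: "[] \<in> bricks s n" "u @ w \<in> bricks s n \<longleftrightarrow> u \<in> bricks s n \<and> w \<in> bricks s n"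
  "(k, LBox 2 x) # w \<in> bricks s n \<longleftrightarrow> k + 2 \<le> n \<and> x \<in> Q ((flip ^^ k) s) \<and> w \<in> bricks s n"
  by (auto simp: bricks_def)

lemma bricks_mono: "n \<le> n' \<Longrightarrow> w \<in> bricks s n \<Longrightarrow> w \<in> bricks s n'"
  by (fastforce simp: bricks_def)

lemma bricks_narrow: "n \<le> 1 \<Longrightarrow> w \<in> bricks s n \<Longrightarrow> w = []"
  by (cases w) (auto simp: bricks_def)

lemma Q_P: "x \<in> Q t \<Longrightarrow> x \<in> P 2 t"
  using Q_subset by auto

lemma bricks_ok: "w \<in> bricks s n \<Longrightarrow> n \<le> n' \<Longrightarrow> ok n' s w n'"
proof (induction w)
  case (Cons a w)
  then obtain k x where "a = (k, LBox 2 x)" "k + 2 \<le> n" "x \<in> Q ((flip ^^ k) s)"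
    by (auto simp: bricks_def)
  then show ?case using Cons Q_P by auto
qed auto

definition id2 :: "nat \<Rightarrow> shading \<Rightarrow> nat \<times> 'a letter" where
  "id2 k s = (k, LBox 2 (eval 2 ((flip ^^ k) s) []))"

definition h2 :: "nat \<Rightarrow> shading \<Rightarrow> nat \<times> 'a letter" where
  "h2 k s = (k, LBox 2 (eval 2 ((flip ^^ k) s) [(0, LCap), (0, LCup)]))"

lemma equ_id2: "k + 2 \<le> n \<Longrightarrow> equ s n [] [id2 k s] n"
  using equ_box[of k 2 n s "[]"] by (simp add: id2_def)

lemma equ_h2: "k + 2 \<le> n \<Longrightarrow> equ s n [(k, LCap), (k, LCup)] [h2 k s] n"
  using equ_box[of k 2 n s "[(0, LCap), (0, LCup)]"] by (simp add: h2_def numeral_2_eq_2)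

lemma h2_brick [simp]: "h2 k s # w \<in> bricks s n \<longleftrightarrow> k + 2 \<le> n \<and> w \<in> bricks s n"
  by (simp add: h2_def Q_h)

text \<open>\<open>Q_yang_baxter\<close> is a statement about vectors, so the three bricks are
  packed into one 3-box, expanded linearly, and each resulting 3-box is unpacked again.\<close>

lemma yang_baxter_red:
  assumes "x \<in> Q ((flip ^^ Suc k) s)" "y \<in> Q ((flip ^^ k) s)" "z \<in> Q ((flip ^^ Suc k) s)" "k + 3 \<le> n"
  shows "red s n [(Suc k, LBox 2 x), (k, LBox 2 y), (Suc k, LBox 2 z)]
    {[(k, LBox 2 x'), (Suc k, LBox 2 y'), (k, LBox 2 z')] | x' y' z'.
      x' \<in> Q ((flip ^^ k) s) \<and> y' \<in> Q ((flip ^^ Suc k) s) \<and> z' \<in> Q ((flip ^^ k) s)} n"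
proof -
  let ?t = "(flip ^^ k) s"
  let ?w = "[(1, LBox 2 x), (0, LBox 2 y), (1, LBox 2 z)]"
  let ?X = "{eval 3 ?t [(0, LBox 2 x'), (1, LBox 2 y'), (0, LBox 2 z')] | x' y' z'.
        x' \<in> Q ?t \<and> y' \<in> Q (flip ?t) \<and> z' \<in> Q ?t}"
  have ok3: "ok 3 ?t [(0, LBox 2 x'), (1, LBox 2 y'), (0, LBox 2 z')] 3"
    if "x' \<in> Q ?t" "y' \<in> Q (flip ?t)" "z' \<in> Q ?t" for x' y' z' using that Q_P by auto
  have "equ s n (shiftw k ?w) [(k, LBox 3 (eval 3 ?t ?w))] n"
    by (rule equ_box) (use assms Q_P in auto)
  moreover have "red s n [(k, LBox 3 (eval 3 ?t ?w))] {[(k, LBox 3 b)] | b. b \<in> ?X} n"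
  proof (rule red_box)
    show "eval 3 ?t ?w \<in> span ?X" using assms by (intro Q_yang_baxter) auto
    show "?X \<subseteq> P 3 ?t" using ok3 by (auto intro!: eval_in_P simp del: ok_letter)
  qed (use assms in auto)
  moreover have "red s n w {[(k, LBox 2 x'), (Suc k, LBox 2 y'), (k, LBox 2 z')] | x' y' z'.
      x' \<in> Q ?t \<and> y' \<in> Q (flip ?t) \<and> z' \<in> Q ?t} n" if "w \<in> {[(k, LBox 3 b)] | b. b \<in> ?X}" for w
  proof -
    from that obtain x' y' z' where *: "x' \<in> Q ?t" "y' \<in> Q (flip ?t)" "z' \<in> Q ?t"
      and w: "w = [(k, LBox 3 (eval 3 ?t [(0, LBox 2 x'), (1, LBox 2 y'), (0, LBox 2 z')]))]" by auto
    have "equ s n (shiftw k [(0, LBox 2 x'), (1, LBox 2 y'), (0, LBox 2 z')]) w n"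
      unfolding w by (rule equ_box) (use ok3 * assms in auto)
    from equ_sym[OF this] have e: "equ s n w [(k, LBox 2 x'), (Suc k, LBox 2 y'), (k, LBox 2 z')] n"
      by simp
    show ?thesis by (rule red_equ[OF e red_self]) (use * equ_okD(2)[OF e] in auto)
  qed
  ultimately have "red s n (shiftw k ?w) {[(k, LBox 2 x'), (Suc k, LBox 2 y'), (k, LBox 2 z')] | x' y' z'.
      x' \<in> Q ?t \<and> y' \<in> Q (flip ?t) \<and> z' \<in> Q ?t} n"
    by (rule red_equ[OF _ red_trans])
  then show ?thesis by simp
qed

lemma brick_commute:
  assumes "u \<in> bricks s n" "ok l s [(n, x)] l'" "n \<le> l'"
  shows "equ s l ((n, x) # u) (u @ [(n, x)]) l'"
proof -
  have 1: "good ((flip ^^ n) s) x" "n + src x \<le> l" "l' = l - n + n - src x + tgt x"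
    using assms(2) by (auto simp: ok.simps(2))
  show ?thesis
    using equ_commute1[OF bricks_ok[OF assms(1) order_refl], of 0 x l] 1(1,2) unfolding 1(3) by simp
qed

lemma mult_equ:
  assumes "x \<in> Q ((flip ^^ k) s)" "y \<in> Q ((flip ^^ k) s)" "k + 2 \<le> n"
  shows "\<exists>z\<in>Q ((flip ^^ k) s). equ s n [(k, LBox 2 x), (k, LBox 2 y)] [(k, LBox 2 z)] n"
  using equ_box[of k 2 n s "[(0, LBox 2 x), (0, LBox 2 y)]"] assms Q_mult Q_P by auto

text \<open>Brick words on \<open>n + 1\<close> strings that meet the last string exactly
  once.\<close>

definition split :: "shading \<Rightarrow> nat \<Rightarrow> 'a word set" where
  "split s n = {a @ [(n - 1, LBox 2 x)] @ b | a b x.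
     a \<in> bricks s n \<and> b \<in> bricks s n \<and> x \<in> Q ((flip ^^ (n - 1)) s)}"

lemma splitI: "a \<in> bricks s n \<Longrightarrow> b \<in> bricks s n \<Longrightarrow> x \<in> Q ((flip ^^ (n - 1)) s) \<Longrightarrow>
    a @ [(n - 1, LBox 2 x)] @ b \<in> split s n"
  by (auto simp: split_def)

text \<open>The reduction known from Hecke algebras: bricks at the last position are merged until
  one is left. Between two of them, induction leaves a single brick at the position before; the rest
  commutes outwards, and the Yang-Baxter relation trades the two outer bricks for one.\<close>

lemma brick_split: "1 \<le> n \<Longrightarrow> w \<in> bricks s (Suc n) \<Longrightarrow> Suc n \<le> l \<Longrightarrow> red s l w (split s n) l"
proof (induction n arbitrary: w rule: less_induct)
  case (less n)
  note nl = less.prems(3)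
  show ?case using less.prems(2)
  proof (induction w rule: rev_induct)
    case Nil
    \<comment> \<open>An identity brick is inserted, so that exactly one brick at the last position
      is present from the beginning.\<close>
    have "[] @ [id2 (n - 1) s] @ [] \<in> split s n"
      unfolding id2_def by (rule splitI) (auto simp: Q_id)
    then show ?case
      using equ_id2[of "n - 1" l s] less.prems(1) nl
      by (intro red_equ[OF _ red_self]) (auto dest: equ_okD)
  next
    case (snoc g w)
    then obtain k y where l: "g = (k, LBox 2 y)" "k + 2 \<le> Suc n" "y \<in> Q ((flip ^^ k) s)"
      and w: "w \<in> bricks s (Suc n)"
      by (auto simp: bricks_def)
    have okl: "ok l s [g] l" using l Q_P nl by auto
    have "red s l ([] @ w @ [g]) {[] @ w' @ [g] | w'. w' \<in> split s n} l"
      by (rule red_ctx[OF snoc.IH[OF w]]) (use okl in auto)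
    moreover have "red s l v (split s n) l"
      if v: "v \<in> {[] @ w' @ [g] | w'. w' \<in> split s n}" for v
    proof -
      from v obtain a b x where ab: "a \<in> bricks s n" "b \<in> bricks s n" and x: "x \<in> Q ((flip ^^ (n - 1)) s)"
        and v: "v = a @ [(n - 1, LBox 2 x)] @ b @ [g]" by (auto simp: split_def)
      have oka: "ok l s a l" and okb: "ok l s b l"
        using ab nl by (auto intro!: bricks_ok[of _ s n])
      have okx: "ok l s [(n - 1, LBox 2 x)] l" using x less.prems(1) nl Q_P by auto
      have okv: "ok l s v l"
        using oka okb okx okl unfolding v ok_append by blast
      show ?thesis
      proof (cases "k + 2 \<le> n")
        case True
        then have "v \<in> split s n" using splitI[of a s n "b @ [g]" x] ab x l by (auto simp: v)
        then show ?thesis using okv by (rule red_self)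
      next
        case False
        then have k: "k = n - 1" using l by auto
        show ?thesis
        \<comment> \<open>With two strings nothing separates the two bricks, so they
          multiply.\<close>
        proof (cases "n = 1")
          case True
          then have "b = []" by (intro bricks_narrow[OF _ ab(2)]) simp
          moreover obtain z where z: "z \<in> Q ((flip ^^ k) s)"
            and e: "equ s l [(k, LBox 2 x), (k, LBox 2 y)] [(k, LBox 2 z)] l"
            using mult_equ[of x k s y l] x l k nl by auto
          have "equ s l (a @ [(k, LBox 2 x), (k, LBox 2 y)] @ []) (a @ [(k, LBox 2 z)] @ []) l"
            by (rule equ_ctx[OF e oka]) simp
          moreover have "a @ [(k, LBox 2 z)] @ [] \<in> split s n"
            using splitI[of a s n "[]" z] ab z k by simp
          ultimately show ?thesis
            using red_equ red_self equ_okD(2) unfolding v l(1) k by (metis append_Cons append_Nil)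
        next
          case n1: False
          define n' where "n' = n - 2"
          have n: "n = Suc (Suc n')" using n1 less.prems(1) nl by (auto simp: n'_def)
          have k': "k = Suc n'" by (simp add: k n)
          have rb: "red s l b (split s (Suc n')) l"
            using less.IH[of "Suc n'" b] ab n nl by auto
          have "red s l ((a @ [(n - 1, LBox 2 x)]) @ b @ [g])
              {(a @ [(n - 1, LBox 2 x)]) @ b' @ [g] | b'. b' \<in> split s (Suc n')} l"
            by (rule red_ctx[OF rb]) (use oka okx okl in \<open>auto simp: ok_append\<close>)
          then have rv: "red s l v {(a @ [(n - 1, LBox 2 x)]) @ b' @ [g] | b'. b' \<in> split s (Suc n')} l"
            by (simp add: v)
          show ?thesis
          proof (rule red_trans[OF rv])
            fix v' assume "v' \<in> {(a @ [(n - 1, LBox 2 x)]) @ b' @ [g] | b'. b' \<in> split s (Suc n')}"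
            then obtain c d z where cd: "c \<in> bricks s (Suc n')" "d \<in> bricks s (Suc n')"
              and z: "z \<in> Q ((flip ^^ n') s)"
              and v': "v' = a @ [(k, LBox 2 x)] @ c @ [(n', LBox 2 z)] @ d @ [(k, LBox 2 y)]"
              by (auto simp: split_def l k)
            have okcd: "ok l s c l" "ok l s d l"
              using cd nl n by (auto intro!: bricks_ok[of _ s "Suc n'"])
            have okz: "ok l s [(n', LBox 2 z)] l" using z Q_P nl by (auto simp: n)
            have okxk: "ok l s [(k, LBox 2 x)] l" using okx k by simp
            have okyk: "ok l s [(k, LBox 2 y)] l" using okl l by simp
            \<comment> \<open>\<open>c\<close> and \<open>d\<close> act on strings to the left of
              \<open>x\<close> and \<open>y\<close>; moving them away leaves three adjacent bricks
              in the pattern of \<open>yang_baxter_red\<close>.\<close>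
            have c1: "equ s l ((k, LBox 2 x) # c) (c @ [(k, LBox 2 x)]) l"
              using brick_commute[of c s k l "LBox 2 x" l] cd okxk by (simp add: k')
            have c2: "equ s l ((k, LBox 2 y) # d) (d @ [(k, LBox 2 y)]) l"
              using brick_commute[of d s k l "LBox 2 y" l] cd okyk by (simp add: k')
            have "equ s l (a @ ((k, LBox 2 x) # c) @ ([(n', LBox 2 z)] @ d @ [(k, LBox 2 y)]))
                (a @ (c @ [(k, LBox 2 x)]) @ ([(n', LBox 2 z)] @ d @ [(k, LBox 2 y)])) l"
              by (rule equ_ctx[OF c1 oka]) (use okz okcd okyk in \<open>simp only: ok_append, blast\<close>)
            then have e1: "equ s l v' (a @ c @ [(k, LBox 2 x), (n', LBox 2 z)] @ d @ [(k, LBox 2 y)]) l"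
              by (simp add: v')
            have "equ s l ((a @ c @ [(k, LBox 2 x), (n', LBox 2 z)]) @ (d @ [(k, LBox 2 y)]) @ [])
                ((a @ c @ [(k, LBox 2 x), (n', LBox 2 z)]) @ ((k, LBox 2 y) # d) @ []) l"
              by (rule equ_ctx[OF equ_sym[OF c2]])
                (use oka okcd okxk okz in \<open>auto simp: ok_append\<close>)
            then have e2: "equ s l (a @ c @ [(k, LBox 2 x), (n', LBox 2 z)] @ d @ [(k, LBox 2 y)])
                ((a @ c) @ [(k, LBox 2 x), (n', LBox 2 z), (k, LBox 2 y)] @ d) l"
              by simp
            have "red s l ((a @ c) @ [(k, LBox 2 x), (n', LBox 2 z), (k, LBox 2 y)] @ d) (split s n) l"
            proof (rule red_mono[OF red_ctx])
              show "red s l [(k, LBox 2 x), (n', LBox 2 z), (k, LBox 2 y)]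
                {[(n', LBox 2 x'), (Suc n', LBox 2 y'), (n', LBox 2 z')] | x' y' z'.
                  x' \<in> Q ((flip ^^ n') s) \<and> y' \<in> Q ((flip ^^ Suc n') s) \<and> z' \<in> Q ((flip ^^ n') s)} l"
                using yang_baxter_red[of x n' s z y l] x z l(3) nl by (simp add: k' k[symmetric] n)
              show "ok l s (a @ c) l" "ok l s d l"
                using oka okcd by (auto simp: ok_append)
              have "(a @ c @ [(n', LBox 2 x')]) @ [(n - 1, LBox 2 y')] @ ((n', LBox 2 z') # d) \<in> split s n"
                if "x' \<in> Q ((flip ^^ n') s)" "y' \<in> Q ((flip ^^ Suc n') s)" "z' \<in> Q ((flip ^^ n') s)" for x' y' z'
                by (rule splitI) (use that ab cd bricks_mono[of "Suc n'" n] in \<open>auto simp: n\<close>)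
              then show "{(a @ c) @ w' @ d |w'. w' \<in> {[(n', LBox 2 x'), (Suc n', LBox 2 y'), (n', LBox 2 z')] | x' y' z'.
                  x' \<in> Q ((flip ^^ n') s) \<and> y' \<in> Q ((flip ^^ Suc n') s) \<and> z' \<in> Q ((flip ^^ n') s)}} \<subseteq> split s n"
                by (auto simp: n)
            qed
            then show "red s l v' (split s n) l"
              using red_equ[OF equ_trans[OF e1 e2]] by simp
          qed
        qed
      qed
    qed
    ultimately have "red s l ([] @ w @ [g]) (split s n) l" by (rule red_trans)
    then show ?case by simp
  qed
qed


text \<open>After \<open>brick_split\<close> the closed string meets a single brick. Everything else
  slides out of the loop, and \<open>Q_cap\<close> replaces the capped brick by a scalar. For
  \<open>n = 0\<close> the loop is a bare circle, worth \<open>\<delta>\<close>.\<close>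

lemma partial_trace_red:
  assumes "w \<in> bricks s (Suc n)" "n \<le> 0 \<Longrightarrow> l = 0" "n \<le> l"
  shows "red s l ((n, LCup) # w @ [(n, LCap)]) (bricks s n) l"
proof (cases n)
  case 0
  then have w: "w = []" by (intro bricks_narrow[OF _ assms(1)]) simp
  have "eval 0 s [(0, LCup), (0, LCap)] = \<delta> *s eval 0 s []"
    using circle eval_eq_Z[of 0 s "[(0, LCup), (0, LCap)]" "[(0, Cup), (0, Cap)]" "\<lambda>_. 0"]
      eval_eq_Z[of 0 s "[]" "[]" "\<lambda>_. 0"] by (simp add: is_tangle_def)
  then have sp: "eval 0 s [(0, LCup), (0, LCap)] \<in> span {eval 0 s []}"
    by (simp add: span_scale span_base)
  have l: "l = 0" using assms 0 by simp
  have e: "equ s 0 [(0, LCup), (0, LCap)] [(0, LBox 0 (eval 0 s [(0, LCup), (0, LCap)]))] 0"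
    using equ_box[of 0 0 0 s "[(0, LCup), (0, LCap)]"] by simp
  have r: "red s 0 [(0, LBox 0 (eval 0 s [(0, LCup), (0, LCap)]))] {[(0, LBox 0 b)] | b. b \<in> {eval 0 s []}} 0"
    by (rule red_box) (use sp in auto)
  have e0: "equ s 0 [(0, LBox 0 (eval 0 s []))] [] 0"
    using equ_sym[OF equ_box[of 0 0 0 s "[]"]] by simp
  have "red s 0 [(0, LCup), (0, LCap)] (bricks s n) 0"
    by (rule red_equ[OF e red_trans[OF r]]) (auto intro!: red_equ[OF e0 red_self])
  then show ?thesis by (simp add: 0 w l)
next
  case (Suc k)
  have "red s (l + 2) w (split s n) (l + 2)"
    by (rule brick_split) (use assms Suc in auto)
  then have "red s l ([(n, LCup)] @ w @ [(n, LCap)]) {[(n, LCup)] @ w' @ [(n, LCap)] | w'. w' \<in> split s n} l"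
    by (rule red_ctx) (use assms in auto)
  moreover have "red s l v (bricks s n) l"
    if v: "v \<in> {[(n, LCup)] @ w' @ [(n, LCap)] | w'. w' \<in> split s n}" for v
  proof -
    from v obtain a b x where ab: "a \<in> bricks s n" "b \<in> bricks s n" and x: "x \<in> Q ((flip ^^ k) s)"
      and v: "v = [(n, LCup)] @ a @ [(k, LBox 2 x)] @ b @ [(n, LCap)]" by (auto simp: split_def Suc)
    have oka: "ok l s a l" "ok (l + 2) s a (l + 2)" and okb: "ok l s b l" "ok (l + 2) s b (l + 2)"
      using ab assms(3) by (auto intro: bricks_ok)
    have c1: "equ s l ((n, LCup) # a) (a @ [(n, LCup)]) (l + 2)"
      by (rule brick_commute) (use ab assms(3) in auto)
    have c2: "equ s (l + 2) ((n, LCap) # b) (b @ [(n, LCap)]) l"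
      by (rule brick_commute) (use ab assms(3) in auto)
    have okx: "ok (l + 2) s [(k, LBox 2 x)] (l + 2)" using x Q_P assms(3) by (auto simp: Suc)
    have "equ s l ([] @ ((n, LCup) # a) @ ([(k, LBox 2 x)] @ b @ [(n, LCap)]))
        ([] @ (a @ [(n, LCup)]) @ ([(k, LBox 2 x)] @ b @ [(n, LCap)])) l"
      by (rule equ_ctx[OF c1]) (use okx okb assms(3) in \<open>auto simp: ok_append\<close>)
    then have e1: "equ s l v (a @ [(n, LCup)] @ [(k, LBox 2 x)] @ b @ [(n, LCap)]) l"
      by (simp add: v)
    have "equ s l ((a @ [(n, LCup)] @ [(k, LBox 2 x)]) @ (b @ [(n, LCap)]) @ [])
        ((a @ [(n, LCup)] @ [(k, LBox 2 x)]) @ ((n, LCap) # b) @ []) l"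
      by (rule equ_ctx[OF equ_sym[OF c2]]) (use oka okx assms(3) in \<open>auto simp: ok_append\<close>)
    then have e2: "equ s l (a @ [(n, LCup)] @ [(k, LBox 2 x)] @ b @ [(n, LCap)])
        (a @ [(n, LCup), (k, LBox 2 x), (n, LCap)] @ b) l" by simp
    let ?t = "(flip ^^ k) s"
    let ?w = "[(1, LCup), (0, LBox 2 x), (1, LCap)]"
    have e3: "equ s l [(n, LCup), (k, LBox 2 x), (n, LCap)] [(k, LBox 1 (eval 1 ?t ?w))] l"
      using equ_box[of k 1 l s ?w] x Q_P assms(3) by (simp add: Suc)
    have r: "red s l [(k, LBox 1 (eval 1 ?t ?w))] {[(k, LBox 1 b)] | b. b \<in> {eval 1 ?t []}} l"
      by (rule red_box) (use x assms(3) Q_cap in \<open>auto simp: Suc\<close>)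
    have "equ s l [] [(k, LBox 1 (eval 1 ?t []))] l"
      using equ_box[of k 1 l s "[]"] assms(3) by (simp add: Suc)
    then have r': "red s l [(k, LBox 1 (eval 1 ?t []))] {[]} l"
      by (rule red_equ[OF equ_sym red_self]) auto
    have "red s l [(n, LCup), (k, LBox 2 x), (n, LCap)] {[]} l"
      by (rule red_equ[OF e3 red_trans[OF r]]) (use r' in auto)
    then have "red s l (a @ [(n, LCup), (k, LBox 2 x), (n, LCap)] @ b) {a @ w' @ b | w'. w' \<in> {[]}} l"
      by (rule red_ctx[OF _ oka(1) okb(1)])
    then have "red s l (a @ [(n, LCup), (k, LBox 2 x), (n, LCap)] @ b) (bricks s n) l"
      by (rule red_mono) (use ab in auto)
    then show ?thesis by (rule red_equ[OF equ_trans[OF e1 e2]])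
  qed
  ultimately have "red s l ([(n, LCup)] @ w @ [(n, LCap)]) (bricks s n) l"
    by (rule red_trans)
  then show ?thesis by simp
qed

text \<open>Closing one string of a word is made a partial trace in two steps, after adding a further string
  and the brick \<open>h\<close>.\<close>

lemma bend_equ:
  assumes "w \<in> bricks s (n + 2)"
  shows "equ s n ((n, LCup) # w @ [(n, LCap)])
    ([(n, LCup), (Suc n, LCup)] @ (w @ [h2 n s]) @ [(Suc n, LCap), (n, LCap)]) n"
proof -
  have okw: "ok l s w l" if "n + 2 \<le> l" for l using assms bricks_ok that by blast
  have w4: "ok (n + 4) s w (n + 4)" and w2: "ok (n + 2) s w (n + 2)" by (auto intro: okw)
  have c: "equ s (n + 4) ((n + 2, LCap) # w) (w @ [(n + 2, LCap)]) (n + 2)"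
    by (rule brick_commute) (use assms in auto)
  \<comment> \<open>A zigzag is opened on the right leg of the cup. Its cap travels up past
    \<open>w\<close> and past the old cap, and a second zigzag between the two caps creates the pair
    of cap and cup that is \<open>h\<close>.\<close>
  have 1: "equ s n ([(n, LCup)] @ [] @ (w @ [(n, LCap)]))
      ([(n, LCup)] @ [(Suc n, LCup), (Suc (Suc n), LCap)] @ (w @ [(n, LCap)])) n"
    by (rule equ_ctx[OF equ_sym[OF equ_zigzag_left]]) (use w2 in \<open>auto simp: ok_append\<close>)
  have 2: "equ s n ([(n, LCup), (Suc n, LCup)] @ ((n + 2, LCap) # w) @ [(n, LCap)])
      ([(n, LCup), (Suc n, LCup)] @ (w @ [(n + 2, LCap)]) @ [(n, LCap)]) n"
    by (rule equ_ctx[OF c]) auto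
  have x: "equ s (n + 4) [(n + 2, LCap), (n, LCap)] [(n, LCap), (n, LCap)] n"
    using equ_sym[OF equ_exchange[of n LCap n "n + 4" s LCap n]] by (simp add: numeral_eq_Suc)
  have 3: "equ s n ([(n, LCup), (Suc n, LCup)] @ w @ [(n + 2, LCap), (n, LCap)])
      ([(n, LCup), (Suc n, LCup)] @ w @ [(n, LCap), (n, LCap)]) n"
    using equ_ctx[OF x, of n "[(n, LCup), (Suc n, LCup)] @ w" "[]" n] w4
    by (simp add: ok_append numeral_eq_Suc)
  have z: "equ s (n + 2) [] [(n, LCup), (Suc n, LCap)] (n + 2)"
    by (rule equ_sym[OF equ_zigzag_left]) auto
  have 4: "equ s n (([(n, LCup), (Suc n, LCup)] @ w @ [(n, LCap)]) @ [] @ [(n, LCap)])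
      (([(n, LCup), (Suc n, LCup)] @ w @ [(n, LCap)]) @ [(n, LCup), (Suc n, LCap)] @ [(n, LCap)]) n"
    by (rule equ_ctx[OF z]) (use w4 in \<open>auto simp: ok_append numeral_eq_Suc\<close>)
  have h: "equ s (n + 4) [(n, LCap), (n, LCup)] [h2 n s] (n + 4)"
    by (rule equ_h2) simp
  have 5: "equ s n (([(n, LCup), (Suc n, LCup)] @ w) @ [(n, LCap), (n, LCup)] @ [(Suc n, LCap), (n, LCap)])
      (([(n, LCup), (Suc n, LCup)] @ w) @ [h2 n s] @ [(Suc n, LCap), (n, LCap)]) n"
    by (rule equ_ctx[OF h]) (use w4 in \<open>auto simp: ok_append numeral_eq_Suc\<close>)
  from 1 2 3 4 5 show ?thesis
    by (simp add: numeral_2_eq_2) (meson equ_trans)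
qed

text \<open>In contrast to \<open>partial_trace_red\<close>, both legs of the arc may carry bricks.
  The two nested loops of \<open>bend_equ\<close> are closed from the inside, each as a partial
  trace.\<close>

lemma closing_red:
  assumes w: "w \<in> bricks s (n + 2)"
  shows "red s n ((n, LCup) # w @ [(n, LCap)]) (bricks s n) n"
proof -
  have "red s (n + 2) ((Suc n, LCup) # (w @ [h2 n s]) @ [(Suc n, LCap)]) (bricks s (Suc n)) (n + 2)"
    by (rule partial_trace_red) (use w in auto)
  then have "red s n ([(n, LCup)] @ ((Suc n, LCup) # (w @ [h2 n s]) @ [(Suc n, LCap)]) @ [(n, LCap)])
      {[(n, LCup)] @ w' @ [(n, LCap)] | w'. w' \<in> bricks s (Suc n)} n"
    by (rule red_ctx) auto
  then have "red s n ([(n, LCup)] @ ((Suc n, LCup) # (w @ [h2 n s]) @ [(Suc n, LCap)]) @ [(n, LCap)])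
      (bricks s n) n"
    by (rule red_trans) (auto intro!: partial_trace_red)
  then show ?thesis
    by (intro red_equ[OF bend_equ[OF w]]) simp
qed

end

section \<open>Plat form of words\<close>

definition rcups :: "nat \<Rightarrow> nat \<Rightarrow> 'v word" where
  "rcups m p = map (\<lambda>i. (m + 2 * i, LCup)) [0..<p]"

definition rcaps :: "nat \<Rightarrow> nat \<Rightarrow> 'v word" where
  "rcaps n q = map (\<lambda>i. (n + 2 * i, LCap)) (rev [0..<q])"

lemma rcups_simps [simp]: "rcups m 0 = []" "rcups m (Suc p) = rcups m p @ [(m + 2 * p, LCup)]"
  by (simp_all add: rcups_def)

lemma rcaps_simps: "rcaps n 0 = []" "rcaps n (Suc q) = (n + 2 * q, LCap) # rcaps n q"
  by (simp_all add: rcaps_def)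

lemma rcaps_snoc: "rcaps n q @ [(n - 2, LCap)] = rcaps (n - 2) (Suc q)" if "2 \<le> n"
  using that by (induction q) (auto simp: rcaps_simps)

lemma rcaps_shift: "shiftw n (rcaps 0 q) = rcaps n q"
  by (induction q) (auto simp: rcaps_simps)

context shaded_planar_algebra
begin

lemma rcups_ok: "ok m s (rcups m p) (m + 2 * p)"
  by (induction p) (auto simp: ok_append)

lemma rcaps_ok: "ok (n + 2 * q) s (rcaps n q) n"
  by (induction q) (auto simp: rcaps_simps)

lemma rcaps_commute:
  assumes "ok n s u n'"
  shows "equ s (n + 2 * q) (rcaps n q @ u) (u @ rcaps n' q) n'"
  using equ_commute[OF assms, of "2 * q" "rcaps 0 q" 0] rcaps_ok[of 0 q] by (simp add: rcaps_shift)

end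

context brick_algebra
begin

text \<open>A zigzag inserted above the cap yields cap, cup, cap: the first two form the brick
  \<open>h\<close>, and the remaining cap sits one string further to the right.\<close>

lemma cap_slide:
  "k \<le> j \<Longrightarrow> j + 2 \<le> n \<Longrightarrow> \<exists>u\<in>bricks s n. equ s n [(k, LCap)] (u @ [(j, LCap)]) (n - 2)"
proof (induction j rule: nat_induct_at_least)
  case base
  then show ?case by (intro bexI[of _ "[]"]) (auto intro: equ_refl)
next
  case (Suc j)
  then obtain u where u: "u \<in> bricks s n" "equ s n [(k, LCap)] (u @ [(j, LCap)]) (n - 2)" by auto
  have oku: "ok n s u n" using u by (auto intro: bricks_ok)
  have z: "equ s (n - 2) [] [(j, LCup), (Suc j, LCap)] (n - 2)"
    by (rule equ_sym[OF equ_zigzag_left]) (use Suc.prems in auto)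
  have 1: "equ s n ((u @ [(j, LCap)]) @ [] @ []) ((u @ [(j, LCap)]) @ [(j, LCup), (Suc j, LCap)] @ []) (n - 2)"
    by (rule equ_ctx[OF z]) (use oku Suc.prems in \<open>auto simp: ok_append\<close>)
  have h: "equ s n [(j, LCap), (j, LCup)] [h2 j s] n"
    by (rule equ_h2) (use Suc.prems in simp)
  have 2: "equ s n (u @ [(j, LCap), (j, LCup)] @ [(Suc j, LCap)]) (u @ [h2 j s] @ [(Suc j, LCap)]) (n - 2)"
    by (rule equ_ctx[OF h oku]) (use Suc.prems in auto)
  have "equ s n [(k, LCap)] ((u @ [h2 j s]) @ [(Suc j, LCap)]) (n - 2)"
    using equ_trans[OF u(2), of "u @ [h2 j s] @ [(Suc j, LCap)]"] equ_trans[OF 1[simplified]] 2 by simp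
  then show ?case using u Suc.prems by (intro bexI[of _ "u @ [h2 j s]"]) auto
qed

lemma cup_slide:
  "k \<le> j \<Longrightarrow> j \<le> n \<Longrightarrow> \<exists>u\<in>bricks s (n + 2). equ s n [(k, LCup)] ((j, LCup) # u) (n + 2)"
proof (induction j rule: nat_induct_at_least)
  case base
  then show ?case by (intro bexI[of _ "[]"]) (auto intro: equ_refl)
next
  case (Suc j)
  then obtain u where u: "u \<in> bricks s (n + 2)" "equ s n [(k, LCup)] ((j, LCup) # u) (n + 2)" by auto
  have oku: "ok (n + 2) s u (n + 2)" using u by (auto intro: bricks_ok)
  have z: "equ s n [] [(Suc j, LCup), (j, LCap)] n"
    by (rule equ_sym[OF equ_zigzag_right]) (use Suc.prems in auto)
  have 1: "equ s n ([] @ [] @ ((j, LCup) # u)) ([] @ [(Suc j, LCup), (j, LCap)] @ ((j, LCup) # u)) (n + 2)"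
    by (rule equ_ctx[OF z]) (use oku Suc.prems in auto)
  have h: "equ s (n + 2) [(j, LCap), (j, LCup)] [h2 j s] (n + 2)"
    by (rule equ_h2) (use Suc.prems in simp)
  have 2: "equ s n ([(Suc j, LCup)] @ [(j, LCap), (j, LCup)] @ u) ([(Suc j, LCup)] @ [h2 j s] @ u) (n + 2)"
    by (rule equ_ctx[OF h _ oku]) (use Suc.prems in auto)
  have "equ s n [(k, LCup)] ((Suc j, LCup) # (h2 j s # u)) (n + 2)"
    using equ_trans[OF u(2), of "(Suc j, LCup) # h2 j s # u"] equ_trans[OF 1[simplified]] 2 by simp
  then show ?case using u Suc.prems by (intro bexI[of _ "h2 j s # u"]) auto
qed

definition letters :: "shading \<Rightarrow> 'a word set" where
  "letters s = {w. \<forall>(k, x)\<in>set w. x = LCup \<or> x = LCap \<or> (\<exists>v\<in>Q ((flip ^^ k) s). x = LBox 2 v)}"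

text \<open>Letters are added on top. A brick slides down through the caps; a cap is first moved to
  the far right; a cup travels down through the caps and the bricks to the row of cups. The bricks
  \<open>h\<close> produced on the way join \<open>u\<close>.\<close>

lemma normal_form:
  "w \<in> letters s \<Longrightarrow> ok m s w n \<Longrightarrow> \<exists>p q. \<exists>u\<in>bricks s (m + 2 * p). m + 2 * p = n + 2 * q \<and>
    equ s m w (rcups m p @ u @ rcaps n q) n"
proof (induction w arbitrary: n rule: rev_induct)
  case Nil
  then show ?case
    by (intro exI[of _ 0] bexI[of _ "[]"]) (auto simp: rcaps_simps intro: equ_refl)
next
  case (snoc g w)
  then obtain l where l: "ok m s w l" "ok l s [g] n" by (auto simp: ok_append)
  have "w \<in> letters s" using snoc.prems by (auto simp: letters_def)
  from snoc.IH[OF this l(1)] obtain p q u where u: "u \<in> bricks s (m + 2 * p)"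
    and pq: "m + 2 * p = l + 2 * q" and e: "equ s m w (rcups m p @ u @ rcaps l q) l" by blast
  have oku: "ok (m + 2 * p) s u (l + 2 * q)" using u pq by (auto intro: bricks_ok)
  have ext: "equ s m (w @ r) (rcups m p @ u @ rcaps l q @ r) l'" if "ok l s r l'" for r l'
    using equ_ctx[OF e, of m "[]" r l'] that by simp
  have brk: "equ s m (rcups m p @ u @ rcaps l q @ v) (rcups m p @ (u @ v) @ rcaps l q) l"
    "u @ v \<in> bricks s (m + 2 * p)" if "v \<in> bricks s l" for v
  proof -
    have "ok l s v l" using that by (auto intro: bricks_ok)
    from equ_ctx[OF rcaps_commute[OF this, of q], of m "rcups m p @ u" "[]" l]
    show "equ s m (rcups m p @ u @ rcaps l q @ v) (rcups m p @ (u @ v) @ rcaps l q) l"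
      using rcups_ok[of m s p] oku by (auto simp: ok_append)
    show "u @ v \<in> bricks s (m + 2 * p)"
      using u that bricks_mono[of l "m + 2 * p" v s] pq by simp
  qed
  from snoc.prems(1) obtain k x where g: "g = (k, x)"
    and x: "x = LCup \<or> x = LCap \<or> (\<exists>v\<in>Q ((flip ^^ k) s). x = LBox 2 v)"
    by (cases g) (auto simp: letters_def)
  from x consider "x = LCup" | "x = LCap" | v where "v \<in> Q ((flip ^^ k) s)" "x = LBox 2 v" by auto
  then show ?case
  proof cases
    case 1
    then have kn: "k \<le> l" "n = l + 2" using l by (auto simp: g)
    obtain v where v: "v \<in> bricks s (l + 2)" "equ s l [(k, LCup)] ((l, LCup) # v) (l + 2)"
      using cup_slide[OF kn(1) order_refl] by blast
    have okv: "ok (l + 2) s v (l + 2)" using v by (auto intro: bricks_ok)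
    let ?M = "m + 2 * p"
    \<comment> \<open>Below the row of caps there are \<open>?M\<close> strings, so the cup, now at
      position \<open>l\<close>, has to be slid to the right a second time before it can pass
      \<open>u\<close>.\<close>
    obtain v' where v': "v' \<in> bricks s (?M + 2)" "equ s ?M [(l, LCup)] ((?M, LCup) # v') (?M + 2)"
      using cup_slide[of l ?M ?M s] pq by auto
    have okv': "ok (?M + 2) s v' (?M + 2)" using v' by (auto intro: bricks_ok)
    have e1: "equ s m (w @ [g]) (rcups m p @ u @ rcaps l q @ [(k, LCup)]) n"
      using ext[OF l(2)] 1 by (simp add: g)
    have "equ s m ((rcups m p @ u @ rcaps l q) @ [(k, LCup)] @ []) ((rcups m p @ u @ rcaps l q) @ ((l, LCup) # v) @ []) n"
      by (rule equ_ctx[OF v(2)]) (use equ_okD(2)[OF e] kn in simp_all)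
    then have e2: "equ s m (rcups m p @ u @ rcaps l q @ [(k, LCup)]) (rcups m p @ u @ rcaps l q @ ((l, LCup) # v)) n"
      by simp
    have "ok l s ((l, LCup) # v) (l + 2)" using okv by simp
    from equ_ctx[OF rcaps_commute[OF this, of q], of m "rcups m p @ u" "[]" n]
    have e3: "equ s m (rcups m p @ u @ rcaps l q @ ((l, LCup) # v)) (rcups m p @ u @ ((l, LCup) # v) @ rcaps n q) n"
      using rcups_ok[of m s p] oku kn by (auto simp: ok_append)
    have okr: "ok (?M + 2) s (v @ rcaps n q) n"
      using bricks_ok[OF v(1), of "?M + 2"] rcaps_ok[of n q s] pq kn
      by (auto simp: ok_append add.commute add.left_commute)
    have "equ s m ((rcups m p @ u) @ [(l, LCup)] @ (v @ rcaps n q)) ((rcups m p @ u) @ ((?M, LCup) # v') @ (v @ rcaps n q)) n"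
      by (rule equ_ctx[OF v'(2) _ okr]) (use rcups_ok[of m s p] oku pq in \<open>auto simp: ok_append\<close>)
    then have e4: "equ s m (rcups m p @ u @ ((l, LCup) # v) @ rcaps n q) (rcups m p @ (u @ [(?M, LCup)]) @ v' @ v @ rcaps n q) n"
      by simp
    have c: "equ s ?M ((?M, LCup) # u) (u @ [(?M, LCup)]) (?M + 2)"
      by (rule brick_commute) (use u in auto)
    have e5: "equ s m (rcups m p @ (u @ [(?M, LCup)]) @ v' @ v @ rcaps n q) (rcups m p @ ((?M, LCup) # u) @ v' @ v @ rcaps n q) n"
      by (rule equ_ctx[OF equ_sym[OF c] rcups_ok]) (use okr okv' in \<open>auto simp: ok_append\<close>)
    have "equ s m (w @ [g]) (rcups m (Suc p) @ (u @ v' @ v) @ rcaps n q) n"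
      using equ_trans[OF e1 equ_trans[OF e2 equ_trans[OF e3 equ_trans[OF e4 e5]]]] by simp
    moreover have "u @ v' @ v \<in> bricks s (m + 2 * Suc p)"
      using u v v' bricks_mono[of ?M "m + 2 * Suc p" u] bricks_mono[of "l + 2" "m + 2 * Suc p" v] pq
      by simp
    moreover have "m + 2 * Suc p = n + 2 * q" using pq kn by simp
    ultimately show ?thesis by blast
  next
    case 2
    then have kn: "k + 2 \<le> l" "n = l - 2" using l by (auto simp: g)
    obtain v where v: "v \<in> bricks s l" "equ s l [(k, LCap)] (v @ [(n, LCap)]) n"
    proof -
      have "k \<le> n" "n + 2 \<le> l" using kn by auto
      then show ?thesis using that cap_slide[of k n l s] kn by blast
    qed
    have e1: "equ s m (w @ [g]) (rcups m p @ u @ rcaps l q @ [(k, LCap)]) n"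
      using ext[OF l(2)] 2 by (simp add: g)
    have "equ s m ((rcups m p @ u @ rcaps l q) @ [(k, LCap)] @ []) ((rcups m p @ u @ rcaps l q) @ (v @ [(n, LCap)]) @ []) n"
      by (rule equ_ctx[OF v(2)]) (use equ_okD(2)[OF e] kn in simp_all)
    then have e2: "equ s m (rcups m p @ u @ rcaps l q @ [(k, LCap)]) ((rcups m p @ u @ rcaps l q @ v) @ [(n, LCap)]) n"
      by simp
    have e3: "equ s m ((rcups m p @ u @ rcaps l q @ v) @ [(n, LCap)]) ((rcups m p @ (u @ v) @ rcaps l q) @ [(n, LCap)]) n"
      using equ_ctx[OF brk(1)[OF v(1)], of m "[]" "[(n, LCap)]" n] kn by simp
    have "equ s m (w @ [g]) (rcups m p @ (u @ v) @ rcaps n (Suc q)) n"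
      using equ_trans[OF e1 equ_trans[OF e2 e3]] kn by (simp add: rcaps_snoc)
    moreover have "m + 2 * p = n + 2 * Suc q" using pq kn by simp
    ultimately show ?thesis using brk(2)[OF v(1)] by blast
  next
    case 3
    then have n: "n = l" "k + 2 \<le> l" using l by (auto simp: g)
    have b: "[g] \<in> bricks s l" using 3 n by (simp add: g)
    have "equ s m (w @ [g]) (rcups m p @ (u @ [g]) @ rcaps l q) l"
      using equ_trans[OF ext brk(1)[OF b]] l n by simp
    then show ?thesis using brk(2)[OF b] pq n by blast
  qed
qed

text \<open>The rightmost cup and the rightmost cap form an arc as in \<open>closing_red\<close>;
  removing one such pair at a time leaves only bricks.\<close>

lemma plat_red:
  "u \<in> bricks s (m + 2 * p) \<Longrightarrow> red s m (rcups m p @ u @ rcaps m p) (bricks s m) m"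
proof (induction p arbitrary: u)
  case 0
  then show ?case by (auto simp: rcaps_simps intro!: red_self bricks_ok)
next
  case (Suc p)
  let ?M = "m + 2 * p"
  have "red s m (rcups m p @ ((?M, LCup) # u @ [(?M, LCap)]) @ rcaps m p)
      {rcups m p @ u' @ rcaps m p | u'. u' \<in> bricks s ?M} m"
    by (rule red_ctx[OF closing_red rcups_ok rcaps_ok]) (use Suc.prems in simp)
  then have "red s m (rcups m p @ ((?M, LCup) # u @ [(?M, LCap)]) @ rcaps m p) (bricks s m) m"
    by (rule red_trans) (use Suc.IH in auto)
  then show ?case by (simp add: rcaps_simps)
qed

theorem letters_red:
  assumes "w \<in> letters s" "ok m s w m"
  shows "red s m w (bricks s m) m"
  using normal_form[OF assms] by (auto intro: red_equ plat_red)

text \<open>Splitting on three strings isolates one brick on the last two strings. What remains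
  below and above it lives on two strings and collapses to single bricks.\<close>

theorem eval_3_span:
  assumes "w \<in> letters s" "ok 3 s w 3"
  shows "eval 3 s w \<in> span {eval 3 s [(0, LBox 2 x), (1, LBox 2 y), (0, LBox 2 z)] | x y z.
    x \<in> Q s \<and> y \<in> Q (flip s) \<and> z \<in> Q s}"
proof -
  define S :: "'a word set" where "S = {[(0, LBox 2 x), (1, LBox 2 y), (0, LBox 2 z)] | x y z.
    x \<in> Q s \<and> y \<in> Q (flip s) \<and> z \<in> Q s}"
  have two: "red s 3 a {[(0, LBox 2 x)] | x. x \<in> Q s} 3" if "a \<in> bricks s 2" for a
  proof (rule red_mono)
    show "red s 3 a (split s 1) 3" by (rule brick_split) (use that in \<open>auto simp: numeral_2_eq_2\<close>)
    have "a = []" if "a \<in> bricks s 1" for a by (rule bricks_narrow[OF _ that]) simp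
    then have "a @ [(0, LBox 2 x)] @ b = [(0, LBox 2 x)]"
      if "a \<in> bricks s 1" "b \<in> bricks s 1" for a b x using that by (metis append_Nil append_Nil2)
    then show "split s 1 \<subseteq> {[(0, LBox 2 x)] | x. x \<in> Q s}"
      by (auto simp: split_def simp del: append.simps)
  qed
  have "red s 3 w S 3"
  proof (rule red_trans[OF letters_red[OF assms]])
    fix w' assume "w' \<in> bricks s 3"
    then have "red s 3 w' (split s 2) 3"
      by (intro brick_split) (auto simp: numeral_3_eq_3 numeral_2_eq_2)
    then show "red s 3 w' S 3"
    proof (rule red_trans)
      fix v assume "v \<in> split s 2"
      then obtain a b y where ab: "a \<in> bricks s 2" "b \<in> bricks s 2" and y: "y \<in> Q (flip s)"
        and v: "v = a @ [(1, LBox 2 y)] @ b" by (auto simp: split_def)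
      have oky: "ok 3 s [(1, LBox 2 y)] 3" using y Q_P by auto
      have okb: "ok 3 s b 3" using ab by (auto intro: bricks_ok)
      have r1: "red s 3 ([] @ a @ ([(1, LBox 2 y)] @ b))
          {[] @ a' @ ([(1, LBox 2 y)] @ b) | a'. a' \<in> {[(0, LBox 2 x)] | x. x \<in> Q s}} 3"
        by (rule red_ctx[OF two[OF ab(1)]]) (use oky okb in \<open>auto simp: ok_append\<close>)
      have "red s 3 ([] @ a @ ([(1, LBox 2 y)] @ b)) S 3"
      proof (rule red_trans[OF r1])
        fix v' assume "v' \<in> {[] @ a' @ ([(1, LBox 2 y)] @ b) | a'. a' \<in> {[(0, LBox 2 x)] | x. x \<in> Q s}}"
        then obtain x where x: "x \<in> Q s" and v': "v' = [(0, LBox 2 x), (1, LBox 2 y)] @ b @ []" by auto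
        have "red s 3 v' {[(0, LBox 2 x), (1, LBox 2 y)] @ b' @ [] | b'. b' \<in> {[(0, LBox 2 x)] | x. x \<in> Q s}} 3"
          unfolding v' by (rule red_ctx[OF two[OF ab(2)]]) (use x oky Q_P in auto)
        then show "red s 3 v' S 3" by (rule red_mono) (use x y in \<open>auto simp: S_def\<close>)
      qed
      then show "red s 3 v S 3" by (simp add: v)
    qed
  qed
  from red_eval[OF this] show ?thesis
    by (rule subsetD[OF span_mono, rotated]) (auto simp: S_def)
qed

end

context shaded_planar_algebra
begin

section \<open>Evaluation of words\<close>

lemma box_mult_eval:
  "x \<in> P m s \<Longrightarrow> y \<in> P m s \<Longrightarrow> box_mult Z m s x y = eval m s [(0, LBox m x), (0, LBox m y)]"
  unfolding box_mult_def by (subst Z_eq_eval) (auto simp: is_tangle_def)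

lemma box_id_eval: "box_id Z m s = eval m s []"
  unfolding box_id_def by (subst Z_eq_eval) (auto simp: is_tangle_def)

lemma box_h_eval: "box_h Z s = eval 2 s [(0, LCap), (0, LCup)]"
  unfolding box_h_def by (subst Z_eq_eval) (auto simp: is_tangle_def)

lemma add_right_eval: "x \<in> P m s \<Longrightarrow> add_right Z m s x = eval (m + 1) s [(0, LBox m x)]"
  unfolding add_right_def by (subst Z_eq_eval) (auto simp: is_tangle_def)

lemma add_left_eval: "x \<in> P m (flip s) \<Longrightarrow> add_left Z m s x = eval (m + 1) s [(1, LBox m x)]"
  unfolding add_left_def by (subst Z_eq_eval) (auto simp: is_tangle_def)

lemma click_eval: "x \<in> P 2 s \<Longrightarrow> click Z s x = eval 2 (flip s) [(2, LCup), (1, LBox 2 x), (0, LCap)]"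
  unfolding click_def by (subst Z_eq_eval) (auto simp: is_tangle_def)

lemma uncappable_eval:
  assumes "x \<in> P 2 s"
  shows "uncappable Z s x \<longleftrightarrow>
    eval 1 s [(1, LCup), (0, LBox 2 x), (0, LCap)] = 0 \<and>
    eval 1 s [(0, LCup), (0, LBox 2 x), (1, LCap)] = 0 \<and>
    eval 1 s [(1, LCup), (0, LBox 2 x), (1, LCap)] = 0 \<and>
    eval 1 (flip s) [(0, LCup), (1, LBox 2 x), (0, LCap)] = 0"
  unfolding uncappable_def using assms by (subst (1 2 3 4) Z_eq_eval) (auto simp: is_tangle_def)

lemma right_closure_eval:
  assumes "x \<in> P m s"
  shows "right_closure Z m s x = eval 0 s (map (\<lambda>j. (j, LCup)) [0..<m] @ [(0, LBox m x)] @
    map (\<lambda>j. (j, LCap)) (rev [0..<m]))"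
proof -
  have c: "ok 0 s (map (\<lambda>j. (j, LCup)) [0..<p]) (2 * p)" for p
    by (induction p) (auto simp: ok_append)
  have d: "ok (2 * p) s (map (\<lambda>j. (j, LCap)) (rev [0..<p])) 0" for p
    by (induction p) auto
  have f: "fill (\<lambda>_. x) (cups 0 m @ [(0, Box 0 m)] @ caps 0 m) =
      map (\<lambda>j. (j, LCup)) [0..<m] @ [(0, LBox m x)] @ map (\<lambda>j. (j, LCap)) (rev [0..<m])"
    by (simp add: cups_def caps_def fill_def)
  have ok: "ok 0 s (map (\<lambda>j. (j, LCup)) [0..<m] @ [(0, LBox m x)] @ map (\<lambda>j. (j, LCap)) (rev [0..<m])) 0"
    using c[of m] d[of m] assms by (auto simp: ok_append)
  have t: "is_tangle 0 (cups 0 m @ [(0, Box 0 m)] @ caps 0 m)"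
    using ok unfolding f[symmetric] ok_fill by (auto simp: is_tangle_def)
  show ?thesis unfolding right_closure_def by (rule eval_eq_Z[symmetric, OF ok t f])
qed

lemma eval_0_nonzero: "eval 0 s [] \<noteq> 0"
proof
  assume "eval 0 s [] = 0"
  then have "P 0 s = {0}" using P_0[of s] box_id_eval[of 0 s] by (simp add: box_id_def)
  then show False using dim_P_0[of s] dim_le_card[of "{0}" "{}"] by simp
qed

lemma P_0_scalar: "x \<in> P 0 s \<Longrightarrow> \<exists>c. x = c *s eval 0 s []"
  using P_0[of s] box_id_eval[of 0 s] by (auto simp: box_id_def span_singleton)

lemma eval_box_at:
  assumes "ok m s U l" "ok l s V m" "k + n \<le> l" "ok n ((flip ^^ k) s) S n"
  shows "eval m s (U @ (k, LBox n (eval n ((flip ^^ k) s) S)) # V) = eval m s (U @ shiftw k S @ V)"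
  using eval_compose[OF assms] by simp

lemma eval_scalar_at:
  assumes "ok m s U l" "ok l s V m" "k + n \<le> l" "ok n ((flip ^^ k) s) S n" "ok n ((flip ^^ k) s) S' n"
    and "eval n ((flip ^^ k) s) S = c *s eval n ((flip ^^ k) s) S'"
  shows "eval m s (U @ shiftw k S @ V) = c *s eval m s (U @ shiftw k S' @ V)"
proof -
  let ?t = "(flip ^^ k) s"
  have 0: "0 \<in> P n ?t" using subspace_0 subspace_P by blast
  have S': "eval n ?t S' \<in> P n ?t" using assms by simp
  have lin: "eval m s (U @ [(k, LBox n (c *s y + z))] @ V) =
      c *s eval m s (U @ [(k, LBox n y)] @ V) + eval m s (U @ [(k, LBox n z)] @ V)"
    if "y \<in> P n ?t" "z \<in> P n ?t" for y z c
    by (rule eval_linear) (use assms that in \<open>auto simp: ok_append\<close>)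
  have z: "eval m s (U @ [(k, LBox n 0)] @ V) = 0"
    using lin[OF 0 0, of 1] by simp
  have "eval m s (U @ shiftw k S @ V) = eval m s (U @ [(k, LBox n (c *s eval n ?t S'))] @ V)"
    using eval_compose[OF assms(1-4)] assms(6) by simp
  also have "\<dots> = c *s eval m s (U @ [(k, LBox n (eval n ?t S'))] @ V)"
    using lin[OF S' 0, of c] z by simp
  also have "\<dots> = c *s eval m s (U @ shiftw k S' @ V)"
    using eval_compose[OF assms(1-3,5)] by simp
  finally show ?thesis .
qed

lemma eval_zero_at:
  assumes "ok m s U l" "ok l s V m" "k + n \<le> l" "ok n ((flip ^^ k) s) S n"
    and "eval n ((flip ^^ k) s) S = 0"
  shows "eval m s (U @ shiftw k S @ V) = 0"
  using eval_scalar_at[OF assms(1-4,4), of 0] assms(5) by simp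

lemma circle_eval: "eval 0 s [(0, LCup), (0, LCap)] = \<delta> *s eval 0 s []"
  using circle eval_eq_Z[of 0 s "[(0, LCup), (0, LCap)]" "[(0, Cup), (0, Cap)]" "\<lambda>_. 0"]
    eval_eq_Z[of 0 s "[]" "[]" "\<lambda>_. 0"] by (simp add: is_tangle_def)

lemma eval_circle:
  assumes "ok m s U l" "ok l s V m" "k \<le> l"
  shows "eval m s (U @ (k, LCup) # (k, LCap) # V) = \<delta> *s eval m s (U @ V)"
  using eval_scalar_at[OF assms(1,2), of k 0 "[(0, LCup), (0, LCap)]" "[]" \<delta>] assms(3) circle_eval
  by simp

lemma eval_ex:
  assumes "ok m s (U @ (k, x) # (l, y) # V) m" "k + tgt x \<le> l"
  shows "eval m s (U @ (k, x) # (l, y) # V) = eval m s (U @ (l - tgt x + src x, y) # (k, x) # V)"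
proof -
  obtain n n' where n: "ok m s U n" "ok n s [(k, x), (l, y)] n'" "ok n' s V m"
    using assms(1) ok_append[of m s U "[(k, x), (l, y)] @ V" m] ok_append[of _ s "[(k, x), (l, y)]" V m]
    by auto
  have "ok n s [(l - tgt x + src x, y), (k, x)] n'"
    using equ_okD(2)[OF equ_exchange[OF assms(2) n(2)]] .
  then show ?thesis
    using equ_exchange[OF assms(2) n(2)] n unfolding equ_def by auto
qed

lemma eval_ex':
  assumes "ok m s (U @ (k, x) # (l, y) # V) m" "k + tgt x \<le> l" "l' = l - tgt x + src x"
  shows "eval m s (U @ (k, x) # (l, y) # V) = eval m s (U @ (l', y) # (k, x) # V)"
  using eval_ex[OF assms(1,2)] assms(3) by simp

lemma eval_zl:
  assumes "ok m s U l" "ok l s V m" "k < l" "j = Suc k"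
  shows "eval m s (U @ (k, LCup) # (j, LCap) # V) = eval m s (U @ V)"
proof -
  have "ok m s (U @ V) m" "ok m s (U @ [(k, LCup), (Suc k, LCap)] @ V) m"
    using assms by (auto simp: ok_append intro!: exI[of _ l])
  then show ?thesis using eval_zigzag(1)[of m s U V k] assms(4) by simp
qed

lemma eval_zr:
  assumes "ok m s U l" "ok l s V m" "k < l" "j = Suc k"
  shows "eval m s (U @ (j, LCup) # (k, LCap) # V) = eval m s (U @ V)"
proof -
  have "ok m s (U @ V) m" "ok m s (U @ [(Suc k, LCup), (k, LCap)] @ V) m"
    using assms by (auto simp: ok_append intro!: exI[of _ l])
  then show ?thesis using eval_zigzag(2)[of m s U V k] assms(4) by simp
qed

lemma word_mult:
  assumes "ok n s u n" "ok n s v n"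
  shows "box_mult Z n s (eval n s u) (eval n s v) = eval n s (u @ v)"
proof -
  have "eval n s ([] @ (0, LBox n (eval n s u)) # [(0, LBox n (eval n s v))]) =
      eval n s ([] @ shiftw 0 u @ [(0, LBox n (eval n s v))])"
    using eval_box_at[of n s "[]" n "[(0, LBox n (eval n s v))]" 0 n u] assms by simp
  also have "\<dots> = eval n s (u @ shiftw 0 v @ [])"
    using eval_box_at[of n s u n "[]" 0 n v] assms by simp
  finally show ?thesis using assms by (simp add: box_mult_eval)
qed

lemma word_box':
  assumes "ok m s U l" "ok l s V m" "k + n \<le> l" "ok n t S n" "(flip ^^ k) s = t" "x = eval n t S"
    and "S' = shiftw k S"
  shows "eval m s (U @ (k, LBox n x) # V) = eval m s (U @ S' @ V)"
  using eval_box_at[OF assms(1-3), of S] assms(4-7) by simp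

lemma scalar_at:
  assumes "eval n t S = c *s eval n t T" "ok m s U l" "ok l s V m" "k + n \<le> l" "ok n t S n" "ok n t T n"
    and "(flip ^^ k) s = t" "S' = shiftw k S" "T' = shiftw k T"
  shows "eval m s (U @ S' @ V) = c *s eval m s (U @ T' @ V)"
  using eval_scalar_at[OF assms(2-4), of S T c] assms(1,5-9) by simp

lemma zero_at:
  assumes "eval n t S = 0" "ok m s U l" "ok l s V m" "k + n \<le> l" "ok n t S n"
    and "(flip ^^ k) s = t" "S' = shiftw k S"
  shows "eval m s (U @ S' @ V) = 0"
  using eval_zero_at[OF assms(2-4), of S] assms(1,5-7) by simp

lemma flip_pow_numeral [simp]: "(flip ^^ 2) s = s" "(flip ^^ 3) s = flip s"
  by (simp_all add: numeral_2_eq_2 numeral_3_eq_3)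

text \<open>Uncappability speaks of a box closed up in \<open>P 1\<close>, with its lower right leg
  bent up. A zigzag opened on that leg produces this closed box inside any word.
  \<open>bottom_zero\<close> is the mirror image.\<close>

lemma top_zero:
  assumes z: "eval 1 ((flip ^^ k) s) [(1, LCup), (0, LBox 2 x), (0, LCap)] = 0" and x: "x \<in> P 2 ((flip ^^ k) s)"
    and U: "ok m s U l" and V: "ok (l - 2) s V m" and k: "k + 2 \<le> l"
  shows "eval m s (U @ (k, LBox 2 x) # (k, LCap) # V) = 0"
proof -
  have "eval m s (U @ (k, LBox 2 x) # (k, LCap) # V) =
      eval m s (U @ (k + 1, LCup) # (k + 2, LCap) # (k, LBox 2 x) # (k, LCap) # V)"
    by (rule eval_zl[symmetric, of _ _ _ l]) (use U V k x in simp_all)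
  also have "\<dots> = eval m s ((U @ [(k + 1, LCup)]) @ (k + 2, LCap) # (k, LBox 2 x) # (k, LCap) # V)"
    by simp
  also have "\<dots> = eval m s ((U @ [(k + 1, LCup)]) @ (k, LBox 2 x) # (k + 2, LCap) # (k, LCap) # V)"
    by (rule eval_ex'[symmetric]) (use U V k x in \<open>auto simp: ok_append\<close>)
  also have "\<dots> = eval m s ((U @ [(k + 1, LCup), (k, LBox 2 x)]) @ (k + 2, LCap) # (k, LCap) # V)"
    by simp
  also have "\<dots> = eval m s ((U @ [(k + 1, LCup), (k, LBox 2 x)]) @ (k, LCap) # (k, LCap) # V)"
    by (rule eval_ex'[symmetric]) (use U V k x in \<open>auto simp: ok_append\<close>)
  also have "\<dots> = eval m s (U @ [(k + 1, LCup), (k, LBox 2 x), (k, LCap)] @ (k, LCap) # V)"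
    by simp
  also have "\<dots> = 0"
    by (rule zero_at[OF z U]) (use V k x in simp_all)
  finally show ?thesis .
qed

lemma bottom_zero:
  assumes z: "eval 1 ((flip ^^ k) s) [(0, LCup), (0, LBox 2 x), (1, LCap)] = 0" and x: "x \<in> P 2 ((flip ^^ k) s)"
    and U: "ok m s U l" and V: "ok (l + 2) s V m" and k: "k \<le> l"
  shows "eval m s (U @ (k, LCup) # (k, LBox 2 x) # V) = 0"
proof -
  have "eval m s ((U @ [(k, LCup), (k, LBox 2 x)]) @ V) =
      eval m s ((U @ [(k, LCup), (k, LBox 2 x)]) @ (k + 2, LCup) # (k + 1, LCap) # V)"
    by (rule eval_zr[symmetric, of _ _ _ "l + 2"]) (use U V k x in \<open>auto simp: ok_append\<close>)
  also have "\<dots> = eval m s ((U @ [(k, LCup)]) @ (k, LBox 2 x) # (k + 2, LCup) # (k + 1, LCap) # V)"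
    by simp
  also have "\<dots> = eval m s ((U @ [(k, LCup)]) @ (k + 2, LCup) # (k, LBox 2 x) # (k + 1, LCap) # V)"
    by (rule eval_ex') (use U V k x in \<open>auto simp: ok_append\<close>)
  also have "\<dots> = eval m s (U @ (k, LCup) # (k + 2, LCup) # (k, LBox 2 x) # (k + 1, LCap) # V)"
    by simp
  also have "\<dots> = eval m s (U @ (k, LCup) # (k, LCup) # (k, LBox 2 x) # (k + 1, LCap) # V)"
    by (rule eval_ex') (use U V k x in \<open>auto simp: ok_append\<close>)
  also have "\<dots> = eval m s ((U @ [(k, LCup)]) @ [(k, LCup), (k, LBox 2 x), (k + 1, LCap)] @ V)"
    by simp
  also have "\<dots> = 0"
    by (rule zero_at[OF z, of _ _ _ "l + 2"]) (use U V k x in \<open>auto simp: ok_append\<close>)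
  finally show ?thesis by simp
qed

text \<open>Multilinearity of \<open>Z\<close> is available only for fillings from \<open>P\<close>,
  so linearity is stated relative to a set.\<close>

definition linear_on :: "'v set \<Rightarrow> ('v \<Rightarrow> 'v) \<Rightarrow> bool" where
  "linear_on V f \<longleftrightarrow> (\<forall>x\<in>V. \<forall>y\<in>V. \<forall>c. f (c *s x + y) = c *s f x + f y)"

lemma linear_on_eval:
  assumes "ok m s U l" "ok l s V m" "k + n \<le> l"
  shows "linear_on (P n ((flip ^^ k) s)) (\<lambda>x. eval m s (U @ (k, LBox n x) # V))"
  unfolding linear_on_def using eval_linear[of m s U k n _ V] assms by (auto simp: ok_append)

lemma linear_on_0: "linear_on V f \<Longrightarrow> 0 \<in> V \<Longrightarrow> f 0 = 0"
  unfolding linear_on_def by (metis add_cancel_left_left scale_one add_0)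

lemma linear_on_sum:
  assumes "linear_on V f" "subspace V" "\<And>i. i \<in> I \<Longrightarrow> x i \<in> V"
  shows "f (\<Sum>i\<in>I. c i *s x i) = (\<Sum>i\<in>I. c i *s f (x i))"
  using assms(3)
proof (induction I rule: infinite_finite_induct)
  case (insert i I)
  then have "x i \<in> V" "(\<Sum>i\<in>I. c i *s x i) \<in> V"
    using assms(2) by (auto intro!: subspace_sum subspace_scale)
  then show ?case using insert assms(1) by (simp add: linear_on_def)
qed (use assms linear_on_0 subspace_0 in auto)

lemma linear_on_span:
  assumes "linear_on V f" "subspace V" "X \<subseteq> V" "x \<in> span X" "\<And>b. b \<in> X \<Longrightarrow> f b \<in> span Y"
  shows "f x \<in> span Y"
proof -
  have "x \<in> V \<and> f x \<in> span Y"
    using assms(4)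
  proof (induction rule: span_induct_alt)
    case base
    then show ?case using assms linear_on_0 subspace_0 span_zero by metis
  next
    case (step c y z)
    then have "y \<in> V" using assms(3) by auto
    moreover have "f (c *s y + z) = c *s f y + f z"
      using \<open>y \<in> V\<close> step assms(1) by (auto simp: linear_on_def)
    ultimately show ?case
      using step assms(2,5) by (auto intro!: span_add span_scale subspace_add subspace_scale)
  qed
  then show ?thesis by simp
qed

section \<open>Relations for \<open>h\<close>, the one-click rotation, and closures\<close>

lemma h_square: "eval 2 s [(0, LCap), (0, LCup), (0, LCap), (0, LCup)] = \<delta> *s eval 2 s [(0, LCap), (0, LCup)]"
  by (rule eval_circle[of 2 s "[(0, LCap)]" 0 "[(0, LCup)]" 0, unfolded append.simps]) simp_all

lemma h1_h2_h1: "eval 3 s [(0, LCap), (0, LCup), (1, LCap), (1, LCup), (0, LCap), (0, LCup)] =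
    eval 3 s [(0, LCap), (0, LCup)]"
  by (rule trans[OF eval_zl[of 3 s "[(0, LCap)]" 1 "[(1, LCup), (0, LCap), (0, LCup)]" 0 1, unfolded append.simps]
    eval_zr[of 3 s "[(0, LCap)]" 1 "[(0, LCup)]" 0 1, unfolded append.simps]]) simp_all

lemma h2_h1_h2: "eval 3 s [(1, LCap), (1, LCup), (0, LCap), (0, LCup), (1, LCap), (1, LCup)] =
    eval 3 s [(1, LCap), (1, LCup)]"
  by (rule trans[OF eval_zr[of 3 s "[(1, LCap)]" 1 "[(0, LCup), (1, LCap), (1, LCup)]" 0 1, unfolded append.simps]
    eval_zl[of 3 s "[(1, LCap)]" 1 "[(1, LCup)]" 0 1, unfolded append.simps]]) simp_all

lemma click_P [simp]: "x \<in> P 2 s \<Longrightarrow> click Z s x \<in> P 2 (flip s)"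
  by (simp add: click_eval)

lemma click_word:
  assumes "ok m s U l" "ok l s V m" "k + 2 \<le> l" "x \<in> P 2 t" "(flip ^^ k) s = flip t"
    and "S' = [(k + 2, LCup), (k + 1, LBox 2 x), (k, LCap)]"
  shows "eval m s (U @ (k, LBox 2 (click Z t x)) # V) = eval m s (U @ S' @ V)"
  by (rule word_box'[OF assms(1-3) _ assms(5) click_eval[OF assms(4)]]) (use assms(4,6) in simp_all)

lemma click_right_straighten:
  assumes x: "x \<in> P 2 (flip s)"
  shows "eval 1 s [(1, LCup), (2, LCup), (1, LBox 2 x), (0, LCap), (1, LCap)] = eval 1 s [(1, LCup), (1, LBox 2 x), (0, LCap)]"
proof -
  have "eval 1 s [(1, LCup), (2, LCup), (1, LBox 2 x), (0, LCap), (1, LCap)] = eval 1 s [(1, LCup), (2, LCup), (1, LBox 2 x), (3, LCap), (0, LCap)]"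
    by (rule eval_ex'[of 1 s "[(1, LCup), (2, LCup), (1, LBox 2 x)]" 0 LCap 1 LCap "[]" 3, unfolded append.simps]) (use x in simp_all)
  also have "\<dots> = eval 1 s [(1, LCup), (2, LCup), (3, LCap), (1, LBox 2 x), (0, LCap)]"
    by (rule eval_ex'[of 1 s "[(1, LCup), (2, LCup)]" 1 "LBox 2 x" 3 LCap "[(0, LCap)]" 3, unfolded append.simps]) (use x in simp_all)
  also have "\<dots> = eval 1 s [(1, LCup), (1, LBox 2 x), (0, LCap)]"
    by (rule eval_zl[of 1 s "[(1, LCup)]" 3 "[(1, LBox 2 x), (0, LCap)]" 2 3, unfolded append.simps]) (use x in simp_all)
  finally show ?thesis .
qed

lemma trace_3_exchange:
  assumes x: "x \<in> P 2 s" "z \<in> P 2 s" "y \<in> P 2 (flip s)"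
  shows "eval 0 s [(0, LCup), (1, LCup), (2, LCup), (0, LBox 2 x), (1, LBox 2 y), (0, LBox 2 z), (2, LCap), (1, LCap), (0, LCap)] = eval 0 s [(0, LCup), (1, LCup), (0, LBox 2 x), (2, LCup), (1, LBox 2 y), (2, LCap), (0, LBox 2 z), (1, LCap), (0, LCap)]"
proof -
  have "eval 0 s [(0, LCup), (1, LCup), (2, LCup), (0, LBox 2 x), (1, LBox 2 y), (0, LBox 2 z), (2, LCap), (1, LCap), (0, LCap)] = eval 0 s [(0, LCup), (1, LCup), (0, LBox 2 x), (2, LCup), (1, LBox 2 y), (0, LBox 2 z), (2, LCap), (1, LCap), (0, LCap)]"
    by (rule eval_ex'[of 0 s "[(0, LCup), (1, LCup)]" 0 "LBox 2 x" 2 LCup "[(1, LBox 2 y), (0, LBox 2 z), (2, LCap), (1, LCap), (0, LCap)]" 2, unfolded append.simps, symmetric]) (use x in simp_all)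
  also have "\<dots> = eval 0 s [(0, LCup), (1, LCup), (0, LBox 2 x), (2, LCup), (1, LBox 2 y), (2, LCap), (0, LBox 2 z), (1, LCap), (0, LCap)]"
    by (rule eval_ex'[of 0 s "[(0, LCup), (1, LCup), (0, LBox 2 x), (2, LCup), (1, LBox 2 y)]" 0 "LBox 2 z" 2 LCap "[(1, LCap), (0, LCap)]" 2, unfolded append.simps]) (use x in simp_all)
  finally show ?thesis .
qed

lemma pull_out_box:
  assumes x: "x \<in> P 2 s"
  shows "eval 2 s [(1, LCup), (0, LBox 2 x), (2, LCap)] = eval 2 s [(0, LBox 2 x)]"
proof -
  have "eval 2 s [(1, LCup), (0, LBox 2 x), (2, LCap)] = eval 2 s [(1, LCup), (2, LCap), (0, LBox 2 x)]"
    by (rule eval_ex'[of 2 s "[(1, LCup)]" 0 "LBox 2 x" 2 LCap "[]" 2, unfolded append.simps]) (use x in simp_all)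
  also have "\<dots> = eval 2 s [(0, LBox 2 x)]"
    by (rule eval_zl[of 2 s "[]" 2 "[(0, LBox 2 x)]" 1 2, unfolded append.simps]) (use x in simp_all)
  finally show ?thesis .
qed

text \<open>The upper arc of \<open>h\<close> straightens the left bend of \<open>click\<close>, so
  that \<open>x\<close> comes to stand on the first two strings.\<close>

lemma h1_click:
  assumes x: "x \<in> P 2 s"
  shows "eval 3 s [(0, LCap), (0, LCup), (1, LBox 2 (click Z s x))] =
    eval 3 s [(0, LCap), (0, LCup), (1, LCap), (1, LCup), (0, LBox 2 x)]"
proof -
  have "eval 3 s [(0, LCap), (0, LCup), (1, LBox 2 (click Z s x))] =
      eval 3 s [(0, LCap), (0, LCup), (3, LCup), (2, LBox 2 x), (1, LCap)]"
    by (rule click_word[where U = "[(0, LCap), (0, LCup)]" and V = "[]" and l = 3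
      and S' = "[(3, LCup), (2, LBox 2 x), (1, LCap)]", unfolded append.simps]) (use x in simp_all)
  also have "\<dots> = eval 3 s [(0, LCap), (1, LCup), (0, LCup), (2, LBox 2 x), (1, LCap)]"
    by (rule eval_ex'[of 3 s "[(0, LCap)]" 0 LCup 3 LCup "[(2, LBox 2 x), (1, LCap)]" 1, unfolded append.simps]) (use x in simp_all)
  also have "\<dots> = eval 3 s [(0, LCap), (1, LCup), (0, LBox 2 x), (0, LCup), (1, LCap)]"
    by (rule eval_ex'[of 3 s "[(0, LCap), (1, LCup)]" 0 LCup 2 "LBox 2 x" "[(1, LCap)]" 0, unfolded append.simps]) (use x in simp_all)
  also have "\<dots> = eval 3 s [(0, LCap), (1, LCup), (0, LBox 2 x)]"
    by (rule eval_zl[of 3 s "[(0, LCap), (1, LCup), (0, LBox 2 x)]" 3 "[]" 0 1, unfolded append.simps]) (use x in simp_all)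
  also have "eval 3 s [(0, LCap), (1, LCup), (0, LBox 2 x)] =
      eval 3 s [(0, LCap), (0, LCup), (1, LCap), (1, LCup), (0, LBox 2 x)]"
    by (rule eval_zl[of 3 s "[(0, LCap)]" 1 "[(1, LCup), (0, LBox 2 x)]" 0 1, unfolded append.simps, symmetric]) (use x in simp_all)
  finally show ?thesis .
qed

lemma click_click_word:
  assumes x: "x \<in> P 2 s"
  shows "click Z (flip s) (click Z s x) = eval 2 s [(2, LCup), (3, LCup), (2, LBox 2 x), (1, LCap), (0, LCap)]"
proof -
  have "click Z (flip s) (click Z s x) = eval 2 s [(2, LCup), (1, LBox 2 (click Z s x)), (0, LCap)]"
    using click_eval[OF click_P[OF x]] by simp
  also have "\<dots> = eval 2 s [(2, LCup), (3, LCup), (2, LBox 2 x), (1, LCap), (0, LCap)]"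
    by (rule click_word[where U = "[(2, LCup)]" and V = "[(0, LCap)]" and l = 4
      and S' = "[(3, LCup), (2, LBox 2 x), (1, LCap)]", unfolded append.simps]) (use x in simp_all)
  finally show ?thesis .
qed

text \<open>On this side the arc turns the box the other way, and \<open>x\<close> appears rotated
  by 180 degrees; hence the hypothesis that two clicks fix \<open>x\<close>.\<close>

lemma click_h1:
  assumes x: "x \<in> P 2 s" and xx: "click Z (flip s) (click Z s x) = x"
  shows "eval 3 s [(1, LBox 2 (click Z s x)), (0, LCap), (0, LCup)] =
    eval 3 s [(0, LBox 2 x), (1, LCap), (1, LCup), (0, LCap), (0, LCup)]"
proof -
  have e: "x = eval 2 s [(2, LCup), (3, LCup), (2, LBox 2 x), (1, LCap), (0, LCap)]"
    using click_click_word[OF x] xx by simp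
  have "eval 3 s [(0, LBox 2 x), (1, LCap), (1, LCup), (0, LCap), (0, LCup)] =
      eval 3 s [(0, LBox 2 x), (1, LCap), (0, LCup)]"
    by (rule eval_zr[of 3 s "[(0, LBox 2 x), (1, LCap)]" 1 "[(0, LCup)]" 0 1, unfolded append.simps]) (use x in simp_all)
  also have "\<dots> = eval 3 s [(2, LCup), (3, LCup), (2, LBox 2 x), (1, LCap), (0, LCap), (1, LCap), (0, LCup)]"
    by (rule word_box'[OF _ _ _ _ _ e, where U = "[]" and V = "[(1, LCap), (0, LCup)]" and k = 0 and l = 3
      and S' = "[(2, LCup), (3, LCup), (2, LBox 2 x), (1, LCap), (0, LCap)]", unfolded append.simps]) (use x in simp_all)
  also have "\<dots> = eval 3 s [(2, LCup), (3, LCup), (2, LBox 2 x), (1, LCap), (3, LCap), (0, LCap), (0, LCup)]"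
    by (rule eval_ex'[of 3 s "[(2, LCup), (3, LCup), (2, LBox 2 x), (1, LCap)]" 0 LCap 1 LCap "[(0, LCup)]" 3, unfolded append.simps]) (use x in simp_all)
  also have "\<dots> = eval 3 s [(2, LCup), (3, LCup), (2, LBox 2 x), (5, LCap), (1, LCap), (0, LCap), (0, LCup)]"
    by (rule eval_ex'[of 3 s "[(2, LCup), (3, LCup), (2, LBox 2 x)]" 1 LCap 3 LCap "[(0, LCap), (0, LCup)]" 5, unfolded append.simps]) (use x in simp_all)
  also have "\<dots> = eval 3 s [(2, LCup), (3, LCup), (5, LCap), (2, LBox 2 x), (1, LCap), (0, LCap), (0, LCup)]"
    by (rule eval_ex'[of 3 s "[(2, LCup), (3, LCup)]" 2 "LBox 2 x" 5 LCap "[(1, LCap), (0, LCap), (0, LCup)]" 5, unfolded append.simps]) (use x in simp_all)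
  also have "\<dots> = eval 3 s [(2, LCup), (3, LCap), (3, LCup), (2, LBox 2 x), (1, LCap), (0, LCap), (0, LCup)]"
    by (rule eval_ex'[of 3 s "[(2, LCup)]" 3 LCup 5 LCap "[(2, LBox 2 x), (1, LCap), (0, LCap), (0, LCup)]" 3, unfolded append.simps]) (use x in simp_all)
  also have "\<dots> = eval 3 s [(3, LCup), (2, LBox 2 x), (1, LCap), (0, LCap), (0, LCup)]"
    by (rule eval_zl[of 3 s "[]" 3 "[(3, LCup), (2, LBox 2 x), (1, LCap), (0, LCap), (0, LCup)]" 2 3, unfolded append.simps]) (use x in simp_all)
  also have "eval 3 s [(3, LCup), (2, LBox 2 x), (1, LCap), (0, LCap), (0, LCup)] =
      eval 3 s [(1, LBox 2 (click Z s x)), (0, LCap), (0, LCup)]"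
    by (rule click_word[where U = "[]" and V = "[(0, LCap), (0, LCup)]" and l = 3 and k = 1
      and S' = "[(3, LCup), (2, LBox 2 x), (1, LCap)]", unfolded append.simps, symmetric]) (use x in simp_all)
  finally show ?thesis by simp
qed

text \<open>A click permutes the four boundary points cyclically: the top, bottom and right points
  of the rotated box are the right, left and bottom points of \<open>x\<close>. This is behind the
  present lemma and the next two.\<close>

lemma click_top:
  assumes x: "x \<in> P 2 s" and z: "eval 1 s [(1, LCup), (0, LBox 2 x), (1, LCap)] = 0"
  shows "eval 2 (flip s) [(0, LBox 2 (click Z s x)), (0, LCap), (0, LCup)] = 0"
proof -
  have "eval 2 (flip s) [(0, LBox 2 (click Z s x)), (0, LCap), (0, LCup)] =
      eval 2 (flip s) [(2, LCup), (1, LBox 2 x), (0, LCap), (0, LCap), (0, LCup)]"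
    by (rule click_word[where U = "[]" and V = "[(0, LCap), (0, LCup)]" and l = 2 and k = 0
      and S' = "[(2, LCup), (1, LBox 2 x), (0, LCap)]", unfolded append.simps]) (use x in simp_all)
  also have "\<dots> = eval 2 (flip s) [(2, LCup), (1, LBox 2 x), (2, LCap), (0, LCap), (0, LCup)]"
    by (rule eval_ex'[of 2 "flip s" "[(2, LCup), (1, LBox 2 x)]" 0 LCap 0 LCap "[(0, LCup)]" 2, unfolded append.simps])
      (use x in simp_all)
  also have "\<dots> = 0"
    by (rule zero_at[OF z, where U = "[]" and V = "[(0, LCap), (0, LCup)]" and k = 1 and l = 2
      and S' = "[(2, LCup), (1, LBox 2 x), (2, LCap)]", unfolded append.simps]) (use x in simp_all)
  finally show ?thesis .
qed

lemma click_bottom: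
  assumes x: "x \<in> P 2 s" and z: "eval 1 (flip s) [(0, LCup), (1, LBox 2 x), (0, LCap)] = 0"
  shows "eval 2 (flip s) [(0, LCap), (0, LCup), (0, LBox 2 (click Z s x))] = 0"
proof -
  have "eval 2 (flip s) [(0, LCap), (0, LCup), (0, LBox 2 (click Z s x))] =
      eval 2 (flip s) [(0, LCap), (0, LCup), (2, LCup), (1, LBox 2 x), (0, LCap)]"
    by (rule click_word[where U = "[(0, LCap), (0, LCup)]" and V = "[]" and l = 2 and k = 0
      and S' = "[(2, LCup), (1, LBox 2 x), (0, LCap)]", unfolded append.simps]) (use x in simp_all)
  also have "\<dots> = eval 2 (flip s) [(0, LCap), (0, LCup), (0, LCup), (1, LBox 2 x), (0, LCap)]"
    by (rule eval_ex'[of 2 "flip s" "[(0, LCap)]" 0 LCup 2 LCup "[(1, LBox 2 x), (0, LCap)]" 0, unfolded append.simps])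
      (use x in simp_all)
  also have "\<dots> = 0"
    using zero_at[OF z, of 2 "flip s" "[(0, LCap), (0, LCup)]" 2 "[]" 0 "[(0, LCup), (1, LBox 2 x), (0, LCap)]"] x
    by simp
  finally show ?thesis .
qed

lemma click_right:
  assumes x: "x \<in> P 2 s" and z: "eval 1 s [(0, LCup), (0, LBox 2 x), (1, LCap)] = 0"
  shows "eval 1 (flip s) [(1, LCup), (0, LBox 2 (click Z s x)), (1, LCap)] = 0"
proof -
  have "eval 1 (flip s) [(1, LCup), (0, LBox 2 (click Z s x)), (1, LCap)] =
      eval 1 (flip s) [(1, LCup), (2, LCup), (1, LBox 2 x), (0, LCap), (1, LCap)]"
    by (rule click_word[where U = "[(1, LCup)]" and V = "[(1, LCap)]" and l = 3 and k = 0
      and S' = "[(2, LCup), (1, LBox 2 x), (0, LCap)]", unfolded append.simps]) (use x in simp_all)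
  also note click_right_straighten[of x "flip s"]
  also have "eval 1 (flip s) [(1, LCup), (1, LBox 2 x), (0, LCap)] = 0"
    by (rule bottom_zero[of 1 "flip s" x 1 "[]" 1 "[(0, LCap)]", unfolded append.simps]) (use x z in simp_all)
  finally show ?thesis using x by simp
qed

text \<open>Only \<open>y\<close> meets the third string, whose loop contributes \<open>l\<close>;
  the second loop then contributes \<open>m\<close>, and the last one is a circle.\<close>

lemma trace_3:
  assumes x: "x \<in> P 2 s" "z \<in> P 2 s" "y \<in> P 2 (flip s)"
    and y: "eval 1 (flip s) [(1, LCup), (0, LBox 2 y), (1, LCap)] = l *s eval 1 (flip s) []"
    and xz: "eval 1 s [(1, LCup), (0, LBox 2 x), (0, LBox 2 z), (1, LCap)] = m *s eval 1 s []"
  shows "eval 0 s [(0, LCup), (1, LCup), (2, LCup), (0, LBox 2 x), (1, LBox 2 y), (0, LBox 2 z),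
      (2, LCap), (1, LCap), (0, LCap)] = (l * m * \<delta>) *s eval 0 s []"
proof -
  note trace_3_exchange[OF x]
  also have "eval 0 s [(0, LCup), (1, LCup), (0, LBox 2 x), (2, LCup), (1, LBox 2 y), (2, LCap), (0, LBox 2 z), (1, LCap), (0, LCap)] =
      l *s eval 0 s [(0, LCup), (1, LCup), (0, LBox 2 x), (0, LBox 2 z), (1, LCap), (0, LCap)]"
    by (rule scalar_at[OF y, of 0 s "[(0, LCup), (1, LCup), (0, LBox 2 x)]" 4 "[(0, LBox 2 z), (1, LCap), (0, LCap)]" 1
      "[(2, LCup), (1, LBox 2 y), (2, LCap)]" "[]", unfolded append.simps]) (use x in simp_all)
  also have "eval 0 s [(0, LCup), (1, LCup), (0, LBox 2 x), (0, LBox 2 z), (1, LCap), (0, LCap)] =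
      m *s eval 0 s [(0, LCup), (0, LCap)]"
    by (rule scalar_at[OF xz, of 0 s "[(0, LCup)]" 2 "[(0, LCap)]" 0
      "[(1, LCup), (0, LBox 2 x), (0, LBox 2 z), (1, LCap)]" "[]", unfolded append.simps]) (use x in simp_all)
  also have "eval 0 s [(0, LCup), (0, LCap)] = \<delta> *s eval 0 s []"
    by (rule circle_eval)
  finally show ?thesis by (simp add: mult.assoc)
qed

lemma rot_rot_straighten:
  assumes x: "x \<in> P 1 s"
  shows "eval 1 s [(0, LCup), (2, LCup), (2, LBox 1 x), (1, LCap), (1, LCap)] = eval 1 s [(0, LBox 1 x)]"
proof -
  have "eval 1 s [(0, LCup), (2, LCup), (2, LBox 1 x), (1, LCap), (1, LCap)] = eval 1 s [(0, LCup), (2, LCup), (2, LBox 1 x), (3, LCap), (1, LCap)]"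
    by (rule eval_ex'[of 1 s "[(0, LCup), (2, LCup), (2, LBox 1 x)]" 1 LCap 1 LCap "[]" 3, unfolded append.simps]) (use x in simp_all)
  also have "\<dots> = eval 1 s [(0, LCup), (2, LCup), (3, LCap), (2, LBox 1 x), (1, LCap)]"
    by (rule eval_ex'[of 1 s "[(0, LCup), (2, LCup)]" 2 "LBox 1 x" 3 LCap "[(1, LCap)]" 3, unfolded append.simps]) (use x in simp_all)
  also have "\<dots> = eval 1 s [(0, LCup), (2, LBox 1 x), (1, LCap)]"
    by (rule eval_zl[of 1 s "[(0, LCup)]" 3 "[(2, LBox 1 x), (1, LCap)]" 2 3, unfolded append.simps]) (use x in simp_all)
  also have "\<dots> = eval 1 s [(0, LBox 1 x), (0, LCup), (1, LCap)]"
    by (rule eval_ex'[of 1 s "[]" 0 LCup 2 "LBox 1 x" "[(1, LCap)]" 0, unfolded append.simps]) (use x in simp_all)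
  also have "\<dots> = eval 1 s [(0, LBox 1 x)]"
    by (rule eval_zl[of 1 s "[(0, LBox 1 x)]" 1 "[]" 0 1, unfolded append.simps]) (use x in simp_all)
  finally show ?thesis .
qed

definition coef :: "shading \<Rightarrow> 'v \<Rightarrow> complex" where
  "coef s x = (SOME c. x = c *s eval 0 s [])"

lemma coef: "x \<in> P 0 s \<Longrightarrow> x = coef s x *s eval 0 s []"
  unfolding coef_def using P_0_scalar by (rule someI_ex)

lemma coef_unique: "c *s eval 0 s [] = d *s eval 0 s [] \<Longrightarrow> c = d"
  using eval_0_nonzero by (metis scale_cancel_right)

lemma right_closure_word:
  assumes "ok m s w m"
  shows "right_closure Z m s (eval m s w) =
    eval 0 s (map (\<lambda>j. (j, LCup)) [0..<m] @ w @ map (\<lambda>j. (j, LCap)) (rev [0..<m]))"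
proof -
  have c: "ok 0 s (map (\<lambda>j. (j, LCup)) [0..<p]) (2 * p)" for p
    by (induction p) (auto simp: ok_append)
  have d: "ok (2 * p) s (map (\<lambda>j. (j, LCap)) (rev [0..<p])) 0" for p
    by (induction p) auto
  show ?thesis
    using right_closure_eval[OF eval_in_P[OF assms]] eval_box_at[OF c d, of 0 m m w] assms by simp
qed

lemma tr_zero: "right_closure Z m s x = 0 \<Longrightarrow> tr m s x = 0"
  unfolding tr_def box_id_eval using coef_unique[of _ s 0] by (auto intro!: the_equality)

lemma mult_word: "x \<in> P m s \<Longrightarrow> y \<in> P m s \<Longrightarrow> right_closure Z m s (box_mult Z m s x y) =
    eval 0 s (map (\<lambda>j. (j, LCup)) [0..<m] @ [(0, LBox m x), (0, LBox m y)] @ map (\<lambda>j. (j, LCap)) (rev [0..<m]))"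
  by (simp add: box_mult_eval right_closure_word)

lemma nondegenerate_right:
  assumes "nondegenerate" "x \<in> P m s" "\<And>y. y \<in> P m s \<Longrightarrow> right_closure Z m s (box_mult Z m s x y) = 0"
  shows "x = 0"
  using assms tr_zero unfolding nondegenerate_def by blast

lemma nondegenerate_left:
  assumes "nondegenerate" "y \<in> P m s" "\<And>x. x \<in> P m s \<Longrightarrow> right_closure Z m s (box_mult Z m s x y) = 0"
  shows "y = 0"
  using assms tr_zero unfolding nondegenerate_def by blast

section \<open>The space of 1-boxes\<close>

definition pairing :: "shading \<Rightarrow> 'v \<Rightarrow> 'v \<Rightarrow> complex" where
  "pairing s x y = coef s (eval 0 s [(0, LCup), (0, LBox 1 x), (0, LBox 1 y), (0, LCap)])"

lemma pairing: "x \<in> P 1 s \<Longrightarrow> y \<in> P 1 s \<Longrightarrow>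
    eval 0 s [(0, LCup), (0, LBox 1 x), (0, LBox 1 y), (0, LCap)] = pairing s x y *s eval 0 s []"
  unfolding pairing_def by (rule coef) simp

text \<open>Families instead of sets: a repetition counts as a dependence, and with index types
  built from products, sums and options the number of vectors is the cardinality of a type.\<close>

definition indep :: "('i::finite \<Rightarrow> 'v) \<Rightarrow> bool" where
  "indep f \<longleftrightarrow> (\<forall>c. (\<Sum>i\<in>UNIV. c i *s f i) = 0 \<longrightarrow> (\<forall>i. c i = 0))"

lemma indepD: "indep f \<Longrightarrow> (\<Sum>i\<in>UNIV. c i *s f i) = 0 \<Longrightarrow> c i = 0"
  by (auto simp: indep_def)

text \<open>The combination of the \<open>w k\<close> with coefficients \<open>c\<close> lies in the
  radical of the trace form, so it vanishes by non-degeneracy.\<close>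

lemma pairing_sep_right:
  fixes w :: "'k::finite \<Rightarrow> 'v"
  assumes "nondegenerate" "indep w" "\<And>k. w k \<in> P 1 s"
    and c: "\<And>y. y \<in> P 1 s \<Longrightarrow> (\<Sum>k\<in>UNIV. c k * pairing s (w k) y) = 0"
  shows "c k = 0"
proof -
  let ?x = "\<Sum>k\<in>UNIV. c k *s w k"
  have x: "?x \<in> P 1 s" using assms(3) subspace_P by (auto intro!: subspace_sum subspace_scale)
  have "right_closure Z 1 s (box_mult Z 1 s ?x y) = 0" if y: "y \<in> P 1 s" for y
  proof -
    have lin: "linear_on (P 1 s) (\<lambda>x. eval 0 s [(0, LCup), (0, LBox 1 x), (0, LBox 1 y), (0, LCap)])"
      using linear_on_eval[of 0 s "[(0, LCup)]" 2 "[(0, LBox 1 y), (0, LCap)]" 0 1] y by simp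
    have "right_closure Z 1 s (box_mult Z 1 s ?x y) =
        eval 0 s [(0, LCup), (0, LBox 1 ?x), (0, LBox 1 y), (0, LCap)]"
      using mult_word[OF x y] by simp
    also have "\<dots> = (\<Sum>k\<in>UNIV. c k *s (pairing s (w k) y *s eval 0 s []))"
      using linear_on_sum[OF lin subspace_P, of UNIV w c] assms(3) pairing y by simp
    also have "\<dots> = (\<Sum>k\<in>UNIV. c k * pairing s (w k) y) *s eval 0 s []"
      by (simp add: scale_sum_left)
    finally show ?thesis using c[OF y] by simp
  qed
  then have "?x = 0" by (intro nondegenerate_right[OF assms(1) x]) auto
  then show ?thesis by (rule indepD[OF assms(2)])
qed

lemma pairing_sep_left:
  fixes w :: "'k::finite \<Rightarrow> 'v"
  assumes "nondegenerate" "indep w" "\<And>k. w k \<in> P 1 s"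
    and c: "\<And>y. y \<in> P 1 s \<Longrightarrow> (\<Sum>k\<in>UNIV. c k * pairing s y (w k)) = 0"
  shows "c k = 0"
proof -
  let ?x = "\<Sum>k\<in>UNIV. c k *s w k"
  have x: "?x \<in> P 1 s" using assms(3) subspace_P by (auto intro!: subspace_sum subspace_scale)
  have "right_closure Z 1 s (box_mult Z 1 s y ?x) = 0" if y: "y \<in> P 1 s" for y
  proof -
    have lin: "linear_on (P 1 s) (\<lambda>x. eval 0 s [(0, LCup), (0, LBox 1 y), (0, LBox 1 x), (0, LCap)])"
      using linear_on_eval[of 0 s "[(0, LCup), (0, LBox 1 y)]" 2 "[(0, LCap)]" 0 1] y by simp
    have "right_closure Z 1 s (box_mult Z 1 s y ?x) =
        eval 0 s [(0, LCup), (0, LBox 1 y), (0, LBox 1 ?x), (0, LCap)]"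
      using mult_word[OF y x] by simp
    also have "\<dots> = (\<Sum>k\<in>UNIV. c k *s (pairing s y (w k) *s eval 0 s []))"
      using linear_on_sum[OF lin subspace_P, of UNIV w c] assms(3) pairing y by simp
    also have "\<dots> = (\<Sum>k\<in>UNIV. c k * pairing s y (w k)) *s eval 0 s []"
      by (simp add: scale_sum_left)
    finally show ?thesis using c[OF y] by simp
  qed
  then have "?x = 0" by (intro nondegenerate_left[OF assms(1) x]) auto
  then show ?thesis by (rule indepD[OF assms(2)])
qed

text \<open>\<open>C y\<close> caps off the second tensor factor and turns \<open>g (i, k)\<close>
  into a multiple of \<open>f i\<close>. Independence of \<open>f\<close> isolates each
  \<open>i\<close>, then \<open>sep\<close> isolates each \<open>k\<close>. The term
  \<open>z\<close> stands for further vectors invisible to all caps, which allows families of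
  different kinds to be combined.\<close>

lemma tensor_core:
  fixes f :: "'i::finite \<Rightarrow> 'v" and g :: "'i \<times> 'k::finite \<Rightarrow> 'v"
  assumes lin: "\<And>y. y \<in> Y \<Longrightarrow> linear_on V (C y)" and V: "subspace V" "\<And>p. g p \<in> V"
    and C: "\<And>y i k. y \<in> Y \<Longrightarrow> C y (g (i, k)) = t k y *s f i" and f: "indep f"
    and sep: "\<And>c k. (\<And>y. y \<in> Y \<Longrightarrow> (\<Sum>k\<in>UNIV. c k * t k y) = 0) \<Longrightarrow> c k = 0"
    and z: "z \<in> V" "\<And>y. y \<in> Y \<Longrightarrow> C y z = 0" and eq: "(\<Sum>p\<in>UNIV. c p *s g p) + z = 0"
  shows "c (i, k) = 0"
proof -
  have "(\<Sum>k\<in>UNIV. c (i, k) * t k y) = 0" if y: "y \<in> Y" for y i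
  proof -
    have S: "(\<Sum>p\<in>UNIV. c p *s g p) \<in> V" using V by (auto intro!: subspace_sum subspace_scale)
    have "0 = C y (1 *s (\<Sum>p\<in>UNIV. c p *s g p) + z)"
      using eq linear_on_0[OF lin[OF y]] V(1) subspace_0 by simp
    also have "\<dots> = C y (\<Sum>p\<in>UNIV. c p *s g p)"
      using lin[OF y] S z y unfolding linear_on_def by (metis add.right_neutral scale_one)
    also have "\<dots> = (\<Sum>p\<in>UNIV. c p *s C y (g p))"
      by (rule linear_on_sum[OF lin[OF y] V(1)]) (use V in auto)
    also have "\<dots> = (\<Sum>i\<in>UNIV. \<Sum>k\<in>UNIV. c (i, k) *s C y (g (i, k)))"
      by (simp add: sum.cartesian_product)
    also have "\<dots> = (\<Sum>i\<in>UNIV. (\<Sum>k\<in>UNIV. c (i, k) * t k y) *s f i)"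
      using C[OF y] by (simp add: scale_sum_left)
    finally have "(\<Sum>i\<in>UNIV. (\<Sum>k\<in>UNIV. c (i, k) * t k y) *s f i) = 0" by simp
    then show ?thesis by (rule indepD[OF f])
  qed
  then show ?thesis by (rule sep)
qed

lemma indep_case_sum:
  fixes g :: "'i::finite \<Rightarrow> 'v" and h :: "'j::finite \<Rightarrow> 'v"
  assumes "\<And>c d. (\<Sum>i\<in>UNIV. c i *s g i) + (\<Sum>j\<in>UNIV. d j *s h j) = 0 \<Longrightarrow> (\<forall>i. c i = 0)" and "indep h"
  shows "indep (case_sum g h)"
  unfolding indep_def
proof (intro allI impI)
  fix c p assume "(\<Sum>p\<in>UNIV. c p *s case_sum g h p) = 0"
  then have eq: "(\<Sum>i\<in>UNIV. c (Inl i) *s g i) + (\<Sum>j\<in>UNIV. c (Inr j) *s h j) = 0"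
    by (subst (asm) UNIV_Plus_UNIV[symmetric], subst (asm) sum.Plus) auto
  then have 1: "c (Inl i) = 0" for i
    using assms(1)[of "\<lambda>i. c (Inl i)" "\<lambda>j. c (Inr j)"] by blast
  then have "(\<Sum>j\<in>UNIV. c (Inr j) *s h j) = 0" using eq by simp
  then have "c (Inr j) = 0" for j by (rule indepD[OF assms(2)])
  then show "c p = 0" using 1 by (cases p) auto
qed

lemma indep_card:
  fixes f :: "'i::finite \<Rightarrow> 'v"
  assumes "indep f" "range f \<subseteq> V" "dim V > 0"
  shows "card (UNIV :: 'i set) \<le> dim V"
proof -
  obtain B where B: "B \<subseteq> V" "independent B" "V \<subseteq> span B" "card B = dim V"
    using basis_exists by blast
  have fB: "finite B" using B(4) assms(3) card_ge_0_finite by metis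
  have inj: "inj f"
  proof (rule injI, rule ccontr)
    fix i j assume ij: "f i = f j" "i \<noteq> j"
    let ?c = "\<lambda>k. if k = i then 1 else if k = j then - 1 else (0::complex)"
    have "(\<Sum>k\<in>UNIV. ?c k *s f k) = (\<Sum>k\<in>{i, j}. ?c k *s f k)"
      by (rule sum.mono_neutral_right) auto
    also have "\<dots> = 0" using ij by simp
    finally show False using indepD[OF assms(1), of ?c i] by simp
  qed
  have "independent (range f)"
  proof (subst independent_explicit_finite_subsets, intro allI impI ballI)
    fix A u v assume A: "A \<subseteq> range f" "finite A" "(\<Sum>v\<in>A. u v *s v) = 0" "v \<in> A"
    let ?c = "\<lambda>i. if f i \<in> A then u (f i) else 0"
    have "(\<Sum>i\<in>UNIV. ?c i *s f i) = (\<Sum>v\<in>range f. (if v \<in> A then u v else 0) *s v)"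
      using sum.reindex[OF inj, of "\<lambda>v. (if v \<in> A then u v else 0) *s v"] by simp
    also have "\<dots> = (\<Sum>v\<in>A. u v *s v)"
      using A by (intro sum.mono_neutral_cong_right) auto
    finally have "?c i = 0" for i using A(3) indepD[OF assms(1), of ?c i] by simp
    then show "u v = 0" using A(1,4) by (metis imageE subsetD)
  qed
  then have "card (range f) \<le> card B"
    using independent_span_bound[OF fB] assms(2) B(3) by blast
  then show ?thesis using B(4) card_image[OF inj] by simp
qed

lemma cap3_tensor:
  assumes x: "x \<in> P 2 s" "w \<in> P 1 s" "y \<in> P 1 s"
  shows "eval 2 s [(2, LCup), (0, LBox 3 (eval 3 s [(0, LBox 2 x), (2, LBox 1 w)])), (2, LBox 1 y), (2, LCap)] =
    pairing s w y *s x"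
proof -
  have "eval 2 s [(2, LCup), (0, LBox 3 (eval 3 s [(0, LBox 2 x), (2, LBox 1 w)])), (2, LBox 1 y), (2, LCap)] =
      eval 2 s [(2, LCup), (0, LBox 2 x), (2, LBox 1 w), (2, LBox 1 y), (2, LCap)]"
    by (rule word_box'[OF _ _ _ _ _ refl, where U = "[(2, LCup)]" and V = "[(2, LBox 1 y), (2, LCap)]" and l = 4
      and S' = "[(0, LBox 2 x), (2, LBox 1 w)]", unfolded append.simps]) (use x in simp_all)
  also have "\<dots> = eval 2 s [(0, LBox 2 x), (2, LCup), (2, LBox 1 w), (2, LBox 1 y), (2, LCap)]"
    by (rule eval_ex'[of 2 s "[]" 0 "LBox 2 x" 2 LCup "[(2, LBox 1 w), (2, LBox 1 y), (2, LCap)]" 2, unfolded append.simps, symmetric]) (use x in simp_all)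
  also have "eval 2 s [(0, LBox 2 x), (2, LCup), (2, LBox 1 w), (2, LBox 1 y), (2, LCap)] =
      pairing s w y *s eval 2 s [(0, LBox 2 x)]"
    by (rule scalar_at[OF pairing[OF x(2,3)], where U = "[(0, LBox 2 x)]" and V = "[]" and l = 2 and k = 2
      and S' = "[(2, LCup), (2, LBox 1 w), (2, LBox 1 y), (2, LCap)]" and T' = "[]", unfolded append.simps])
      (use x in simp_all)
  finally show ?thesis using eval_single[OF x(1)] by simp
qed

lemma cap3_kill:
  assumes x: "w \<in> P 1 s" "x \<in> P 2 (flip s)" "y \<in> P 1 s"
    and z: "eval 1 (flip s) [(1, LCup), (0, LBox 2 x), (1, LBox 1 y), (1, LCap)] = 0"
  shows "eval 2 s [(2, LCup), (0, LBox 3 (eval 3 s [(0, LBox 1 w), (1, LBox 2 x)])), (2, LBox 1 y), (2, LCap)] = 0"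
proof -
  have "eval 2 s [(2, LCup), (0, LBox 3 (eval 3 s [(0, LBox 1 w), (1, LBox 2 x)])), (2, LBox 1 y), (2, LCap)] =
      eval 2 s [(2, LCup), (0, LBox 1 w), (1, LBox 2 x), (2, LBox 1 y), (2, LCap)]"
    by (rule word_box'[OF _ _ _ _ _ refl, where U = "[(2, LCup)]" and V = "[(2, LBox 1 y), (2, LCap)]" and l = 4
      and S' = "[(0, LBox 1 w), (1, LBox 2 x)]", unfolded append.simps]) (use x in simp_all)
  also have "\<dots> = eval 2 s [(0, LBox 1 w), (2, LCup), (1, LBox 2 x), (2, LBox 1 y), (2, LCap)]"
    by (rule eval_ex'[of 2 s "[]" 0 "LBox 1 w" 2 LCup "[(1, LBox 2 x), (2, LBox 1 y), (2, LCap)]" 2, unfolded append.simps, symmetric]) (use x in simp_all)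
  also have "eval 2 s [(0, LBox 1 w), (2, LCup), (1, LBox 2 x), (2, LBox 1 y), (2, LCap)] = 0"
    using zero_at[OF z, of 2 s "[(0, LBox 1 w)]" 2 "[]" 1
      "[(2, LCup), (1, LBox 2 x), (2, LBox 1 y), (2, LCap)]"] x by simp
  finally show ?thesis .
qed

lemma cap2_tensor:
  assumes x: "u \<in> P 1 s" "v \<in> P 1 (flip s)" "y \<in> P 1 (flip s)"
  shows "eval 1 s [(1, LCup), (0, LBox 2 (eval 2 s [(0, LBox 1 u), (1, LBox 1 v)])), (1, LBox 1 y), (1, LCap)] =
    pairing (flip s) v y *s u"
proof -
  have "eval 1 s [(1, LCup), (0, LBox 2 (eval 2 s [(0, LBox 1 u), (1, LBox 1 v)])), (1, LBox 1 y), (1, LCap)] =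
      eval 1 s [(1, LCup), (0, LBox 1 u), (1, LBox 1 v), (1, LBox 1 y), (1, LCap)]"
    by (rule word_box'[OF _ _ _ _ _ refl, where U = "[(1, LCup)]" and V = "[(1, LBox 1 y), (1, LCap)]" and l = 3
      and S' = "[(0, LBox 1 u), (1, LBox 1 v)]", unfolded append.simps]) (use x in simp_all)
  also have "\<dots> = eval 1 s [(0, LBox 1 u), (1, LCup), (1, LBox 1 v), (1, LBox 1 y), (1, LCap)]"
    by (rule eval_ex'[of 1 s "[]" 0 "LBox 1 u" 1 LCup "[(1, LBox 1 v), (1, LBox 1 y), (1, LCap)]" 1, unfolded append.simps, symmetric]) (use x in simp_all)
  also have "eval 1 s [(0, LBox 1 u), (1, LCup), (1, LBox 1 v), (1, LBox 1 y), (1, LCap)] =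
      pairing (flip s) v y *s eval 1 s [(0, LBox 1 u)]"
    by (rule scalar_at[OF pairing[OF x(2,3)], where U = "[(0, LBox 1 u)]" and V = "[]" and l = 1 and k = 1
      and S' = "[(1, LCup), (1, LBox 1 v), (1, LBox 1 y), (1, LCap)]" and T' = "[]", unfolded append.simps])
      (use x in simp_all)
  finally show ?thesis using eval_single[OF x(1)] by simp
qed

definition bubble :: "shading \<Rightarrow> 'v \<Rightarrow> 'v \<Rightarrow> 'v \<Rightarrow> complex" where
  "bubble s x y k = coef s (eval 0 s [(0, LCup), (0, LBox 1 y), (0, LBox 2 k), (0, LBox 1 x), (0, LCap)])"

lemma bubble: "x \<in> P 1 s \<Longrightarrow> y \<in> P 1 s \<Longrightarrow> k \<in> P 2 s \<Longrightarrow>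
    eval 0 s [(0, LCup), (0, LBox 1 y), (0, LBox 2 k), (0, LBox 1 x), (0, LCap)] = bubble s x y k *s eval 0 s []"
  unfolding bubble_def by (rule coef) simp

lemma bubble_tensor:
  assumes x: "w \<in> P 1 s" "y \<in> P 1 (flip s)" "k \<in> P 2 (flip s)" "x \<in> P 1 (flip s)"
  shows "eval 1 s [(1, LCup), (1, LBox 1 y), (0, LBox 3 (eval 3 s [(0, LBox 1 w), (1, LBox 2 k)])), (1, LBox 1 x), (1, LCap)] =
    bubble (flip s) x y k *s w"
proof -
  have "eval 1 s [(1, LCup), (1, LBox 1 y), (0, LBox 3 (eval 3 s [(0, LBox 1 w), (1, LBox 2 k)])), (1, LBox 1 x), (1, LCap)] =
      eval 1 s [(1, LCup), (1, LBox 1 y), (0, LBox 1 w), (1, LBox 2 k), (1, LBox 1 x), (1, LCap)]"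
    by (rule word_box'[OF _ _ _ _ _ refl, where U = "[(1, LCup), (1, LBox 1 y)]" and V = "[(1, LBox 1 x), (1, LCap)]"
      and l = 3 and S' = "[(0, LBox 1 w), (1, LBox 2 k)]", unfolded append.simps]) (use x in simp_all)
  also have "\<dots> = eval 1 s [(1, LCup), (0, LBox 1 w), (1, LBox 1 y), (1, LBox 2 k), (1, LBox 1 x), (1, LCap)]"
    by (rule eval_ex'[of 1 s "[(1, LCup)]" 0 "LBox 1 w" 1 "LBox 1 y" "[(1, LBox 2 k), (1, LBox 1 x), (1, LCap)]" 1, unfolded append.simps, symmetric]) (use x in simp_all)
  also have "\<dots> = eval 1 s [(0, LBox 1 w), (1, LCup), (1, LBox 1 y), (1, LBox 2 k), (1, LBox 1 x), (1, LCap)]"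
    by (rule eval_ex'[of 1 s "[]" 0 "LBox 1 w" 1 LCup "[(1, LBox 1 y), (1, LBox 2 k), (1, LBox 1 x), (1, LCap)]" 1, unfolded append.simps, symmetric]) (use x in simp_all)
  also have "eval 1 s [(0, LBox 1 w), (1, LCup), (1, LBox 1 y), (1, LBox 2 k), (1, LBox 1 x), (1, LCap)] =
      bubble (flip s) x y k *s eval 1 s [(0, LBox 1 w)]"
    by (rule scalar_at[OF bubble[OF x(4,2,3)], where U = "[(0, LBox 1 w)]" and V = "[]" and l = 1 and k = 1
      and S' = "[(1, LCup), (1, LBox 1 y), (1, LBox 2 k), (1, LBox 1 x), (1, LCap)]" and T' = "[]", unfolded append.simps])
      (use x in simp_all)
  finally show ?thesis using eval_single[OF x(1)] by simp
qed

text \<open>The 2-box \<open>h\<close> carrying \<open>a\<close> on its upper arc and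
  \<open>b\<close> on its lower arc.\<close>

definition split2 :: "shading \<Rightarrow> 'v \<Rightarrow> 'v \<Rightarrow> 'v" where
  "split2 s a b = eval 2 s [(0, LBox 1 b), (0, LCap), (0, LCup), (0, LBox 1 a)]"

lemma split2_P [simp]: "a \<in> P 1 s \<Longrightarrow> b \<in> P 1 s \<Longrightarrow> split2 s a b \<in> P 2 s"
  by (simp add: split2_def)

text \<open>The cap joins the two arcs, and the loop through \<open>y\<close> becomes a 1-box
  between \<open>b\<close> and \<open>a\<close>. If \<open>P 1\<close> is commutative, the result
  depends on \<open>a\<close> and \<open>b\<close> only through their product; this is the source of
  the elements in \<open>kappa\<close>.\<close>

lemma cap2_split:
  assumes x: "a \<in> P 1 s" "b \<in> P 1 s" "y \<in> P 1 (flip s)"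
    and h: "h = eval 1 s [(1, LCup), (0, LCap), (0, LCup), (1, LBox 1 y), (1, LCap)]"
  shows "eval 1 s [(1, LCup), (0, LBox 2 (split2 s a b)), (1, LBox 1 y), (1, LCap)] =
    eval 1 s [(0, LBox 1 b), (0, LBox 1 h), (0, LBox 1 a)]"
proof -
  have hP: "h \<in> P 1 s" using x h by simp
  have "eval 1 s [(1, LCup), (0, LBox 2 (split2 s a b)), (1, LBox 1 y), (1, LCap)] =
      eval 1 s [(1, LCup), (0, LBox 1 b), (0, LCap), (0, LCup), (0, LBox 1 a), (1, LBox 1 y), (1, LCap)]"
    by (rule word_box'[OF _ _ _ _ _ split2_def, where U = "[(1, LCup)]" and V = "[(1, LBox 1 y), (1, LCap)]" and l = 3
      and S' = "[(0, LBox 1 b), (0, LCap), (0, LCup), (0, LBox 1 a)]", unfolded append.simps]) (use x in simp_all)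
  also have "\<dots> = eval 1 s [(0, LBox 1 b), (1, LCup), (0, LCap), (0, LCup), (0, LBox 1 a), (1, LBox 1 y), (1, LCap)]"
    by (rule eval_ex'[of 1 s "[]" 0 "LBox 1 b" 1 LCup "[(0, LCap), (0, LCup), (0, LBox 1 a), (1, LBox 1 y), (1, LCap)]" 1, unfolded append.simps, symmetric]) (use x in simp_all)
  also have "\<dots> = eval 1 s [(0, LBox 1 b), (1, LCup), (0, LCap), (0, LCup), (1, LBox 1 y), (0, LBox 1 a), (1, LCap)]"
    by (rule eval_ex'[of 1 s "[(0, LBox 1 b), (1, LCup), (0, LCap), (0, LCup)]" 0 "LBox 1 a" 1 "LBox 1 y" "[(1, LCap)]" 1, unfolded append.simps]) (use x in simp_all)
  also have "\<dots> = eval 1 s [(0, LBox 1 b), (1, LCup), (0, LCap), (0, LCup), (1, LBox 1 y), (1, LCap), (0, LBox 1 a)]"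
    by (rule eval_ex'[of 1 s "[(0, LBox 1 b), (1, LCup), (0, LCap), (0, LCup), (1, LBox 1 y)]" 0 "LBox 1 a" 1 LCap "[]" 1, unfolded append.simps]) (use x in simp_all)
  also have "eval 1 s [(0, LBox 1 b), (1, LCup), (0, LCap), (0, LCup), (1, LBox 1 y), (1, LCap), (0, LBox 1 a)] =
      eval 1 s [(0, LBox 1 b), (0, LBox 1 h), (0, LBox 1 a)]"
    by (rule word_box'[OF _ _ _ _ _ h, where U = "[(0, LBox 1 b)]" and V = "[(0, LBox 1 a)]" and l = 1
      and S' = "[(1, LCup), (0, LCap), (0, LCup), (1, LBox 1 y), (1, LCap)]", unfolded append.simps, symmetric])
      (use x in simp_all)
  finally show ?thesis .
qed

text \<open>With 1-boxes attached below and above, \<open>split2\<close> falls apart at the gap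
  between its arcs and the value factors. Thus \<open>bubble\<close> can separate elements that
  right caps do not see.\<close>

lemma bubble_split:
  assumes x: "a \<in> P 1 s" "b \<in> P 1 s" "x \<in> P 1 s" "y \<in> P 1 s"
  shows "bubble s x y (split2 s a b) = pairing s y b * pairing s a x"
proof -
  have "bubble s x y (split2 s a b) *s eval 0 s [] =
      eval 0 s [(0, LCup), (0, LBox 1 y), (0, LBox 2 (split2 s a b)), (0, LBox 1 x), (0, LCap)]"
    using bubble x by simp
  also have "\<dots> = eval 0 s [(0, LCup), (0, LBox 1 y), (0, LBox 1 b), (0, LCap), (0, LCup), (0, LBox 1 a), (0, LBox 1 x), (0, LCap)]"
    by (rule word_box'[OF _ _ _ _ _ split2_def, where U = "[(0, LCup), (0, LBox 1 y)]" and V = "[(0, LBox 1 x), (0, LCap)]"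
      and l = 2 and S' = "[(0, LBox 1 b), (0, LCap), (0, LCup), (0, LBox 1 a)]", unfolded append.simps]) (use x in simp_all)
  also have "\<dots> = pairing s y b *s eval 0 s [(0, LCup), (0, LBox 1 a), (0, LBox 1 x), (0, LCap)]"
    by (rule scalar_at[OF pairing[OF x(4,2)], where U = "[]" and V = "[(0, LCup), (0, LBox 1 a), (0, LBox 1 x), (0, LCap)]"
      and l = 0 and k = 0 and S' = "[(0, LCup), (0, LBox 1 y), (0, LBox 1 b), (0, LCap)]" and T' = "[]", unfolded append.simps])
      (use x in simp_all)
  also have "\<dots> = (pairing s y b * pairing s a x) *s eval 0 s []"
    using pairing x by simp
  finally show ?thesis by (rule coef_unique)
qed

lemma indep_option:
  fixes f :: "'i::finite \<Rightarrow> 'v"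
  assumes "indep f" "x \<notin> span (range f)"
  shows "indep (case_option x f)"
  unfolding indep_def
proof (intro allI impI)
  fix c p assume "(\<Sum>p\<in>UNIV. c p *s case_option x f p) = 0"
  then have eq: "c None *s x + (\<Sum>i\<in>UNIV. c (Some i) *s f i) = 0"
    by (simp add: UNIV_option_conv sum.reindex)
  have S: "(\<Sum>i\<in>UNIV. c (Some i) *s f i) \<in> span (range f)"
    by (intro span_sum span_scale span_base) auto
  have n: "c None = 0"
  proof (rule ccontr)
    assume c: "c None \<noteq> 0"
    have "c None *s x = - (\<Sum>i\<in>UNIV. c (Some i) *s f i)" using eq by (simp add: eq_neg_iff_add_eq_0)
    then have "c None *s x \<in> span (range f)" using S by (metis span_neg)
    then have "(1 / c None) *s (c None *s x) \<in> span (range f)" by (rule span_scale)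
    then show False using assms(2) c by simp
  qed
  then have "c (Some i) = 0" for i using eq indepD[OF assms(1), of "\<lambda>i. c (Some i)"] by simp
  then show "c p = 0" using n by (cases p) auto
qed

lemma indep_unit: "x \<noteq> 0 \<Longrightarrow> indep (\<lambda>_::unit. x)"
  by (auto simp: indep_def UNIV_unit)

lemma indep_linear:
  fixes w :: "'k::finite \<Rightarrow> 'v"
  assumes "indep w" "\<And>k. w k \<in> V" "subspace V" "linear_on V f" "\<And>x. x \<in> V \<Longrightarrow> f x = 0 \<Longrightarrow> x = 0"
  shows "indep (\<lambda>k. f (w k))"
  unfolding indep_def
proof (intro allI impI)
  fix c k assume "(\<Sum>k\<in>UNIV. c k *s f (w k)) = 0"
  then have "f (\<Sum>k\<in>UNIV. c k *s w k) = 0"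
    using linear_on_sum[OF assms(4,3), of UNIV w c] assms(2) by simp
  then have "(\<Sum>k\<in>UNIV. c k *s w k) = 0"
    using assms(2,3,5) by (simp add: subspace_sum subspace_scale)
  then show "c k = 0" by (rule indepD[OF assms(1)])
qed

text \<open>Half a turn of a 1-box. \<open>rot_inverse\<close> makes it injective, so independent
  families pass from one shading to the other.\<close>

definition rot :: "shading \<Rightarrow> 'v \<Rightarrow> 'v" where
  "rot s x = eval 1 (flip s) [(1, LCup), (1, LBox 1 x), (0, LCap)]"

lemma rot_P [simp]: "x \<in> P 1 s \<Longrightarrow> rot s x \<in> P 1 (flip s)"
  by (simp add: rot_def)

lemma rot_linear: "linear_on (P 1 s) (rot s)"
  unfolding rot_def using linear_on_eval[of 1 "flip s" "[(1, LCup)]" 3 "[(0, LCap)]" 1 1] by simp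

lemma rot_inverse:
  assumes x: "x \<in> P 1 s"
  shows "eval 1 s [(0, LCup), (1, LBox 1 (rot s x)), (1, LCap)] = x"
proof -
  have "eval 1 s [(0, LCup), (1, LBox 1 (rot s x)), (1, LCap)] =
      eval 1 s [(0, LCup), (2, LCup), (2, LBox 1 x), (1, LCap), (1, LCap)]"
    by (rule word_box'[OF _ _ _ _ _ rot_def, where U = "[(0, LCup)]" and V = "[(1, LCap)]" and l = 3 and k = 1
      and S' = "[(2, LCup), (2, LBox 1 x), (1, LCap)]", unfolded append.simps]) (use x in simp_all)
  then show ?thesis using rot_rot_straighten[OF x] eval_single[OF x] by simp
qed

lemma rot_indep:
  fixes w :: "'k::finite \<Rightarrow> 'v"
  assumes "indep w" "\<And>k. w k \<in> P 1 s"
  shows "indep (\<lambda>k. rot s (w k))"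
proof (rule indep_linear[OF assms subspace_P rot_linear])
  fix x assume x: "x \<in> P 1 s" "rot s x = 0"
  have "linear_on (P 1 (flip s)) (\<lambda>x. eval 1 s [(0, LCup), (1, LBox 1 x), (1, LCap)])"
    using linear_on_eval[of 1 s "[(0, LCup)]" 3 "[(1, LCap)]" 1 1] by simp
  from linear_on_0[OF this] show "x = 0"
    using rot_inverse[OF x(1)] x(2) subspace_0[OF subspace_P] by simp
qed

lemma tensor_2_indep:
  fixes u :: "'i::finite \<Rightarrow> 'v" and v :: "'k::finite \<Rightarrow> 'v"
  assumes nd: nondegenerate and u: "indep u" "\<And>i. u i \<in> P 1 s" and v: "indep v" "\<And>k. v k \<in> P 1 (flip s)"
    and z: "z \<in> P 2 s" "\<And>y. y \<in> P 1 (flip s) \<Longrightarrow> eval 1 s [(1, LCup), (0, LBox 2 z), (1, LBox 1 y), (1, LCap)] = 0"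
    and eq: "(\<Sum>p\<in>UNIV. c p *s (case p of (i, k) \<Rightarrow> eval 2 s [(0, LBox 1 (u i)), (1, LBox 1 (v k))])) + z = 0"
  shows "c p = 0"
proof -
  let ?C = "\<lambda>y x. eval 1 s [(1, LCup), (0, LBox 2 x), (1, LBox 1 y), (1, LCap)]"
  obtain i k where p: "p = (i, k)" by (cases p)
  have "c (i, k) = 0"
  proof (rule tensor_core[where Y = "P 1 (flip s)" and C = ?C and V = "P 2 s" and f = u
      and t = "\<lambda>k y. pairing (flip s) (v k) y", OF _ subspace_P _ _ u(1) _ z(1) _ eq])
    show "linear_on (P 2 s) (?C y)" if "y \<in> P 1 (flip s)" for y
      using linear_on_eval[of 1 s "[(1, LCup)]" 3 "[(1, LBox 1 y), (1, LCap)]" 0 2] that by simp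
    show "?C y (case (i, k) of (i, k) \<Rightarrow> eval 2 s [(0, LBox 1 (u i)), (1, LBox 1 (v k))]) =
        pairing (flip s) (v k) y *s u i" if "y \<in> P 1 (flip s)" for y i k
      using cap2_tensor[OF u(2) v(2) that] by simp
  qed (use z(2) u v pairing_sep_right[OF nd v] in auto)
  then show ?thesis by (simp add: p)
qed

lemma tensor_3_indep:
  fixes f :: "'i::finite \<Rightarrow> 'v" and w :: "'k::finite \<Rightarrow> 'v"
  assumes nd: nondegenerate and f: "indep f" "\<And>i. f i \<in> P 2 s" and w: "indep w" "\<And>k. w k \<in> P 1 s"
    and z: "z \<in> P 3 s" "\<And>y. y \<in> P 1 s \<Longrightarrow> eval 2 s [(2, LCup), (0, LBox 3 z), (2, LBox 1 y), (2, LCap)] = 0"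
    and eq: "(\<Sum>p\<in>UNIV. c p *s (case p of (i, k) \<Rightarrow> eval 3 s [(0, LBox 2 (f i)), (2, LBox 1 (w k))])) + z = 0"
  shows "c p = 0"
proof -
  let ?C = "\<lambda>y x. eval 2 s [(2, LCup), (0, LBox 3 x), (2, LBox 1 y), (2, LCap)]"
  obtain i k where p: "p = (i, k)" by (cases p)
  have "c (i, k) = 0"
  proof (rule tensor_core[where Y = "P 1 s" and C = ?C and V = "P 3 s" and f = f
      and t = "\<lambda>k y. pairing s (w k) y", OF _ subspace_P _ _ f(1) _ z(1) _ eq])
    show "linear_on (P 3 s) (?C y)" if "y \<in> P 1 s" for y
      using linear_on_eval[of 2 s "[(2, LCup)]" 4 "[(2, LBox 1 y), (2, LCap)]" 0 3] that by simp
    show "?C y (case (i, k) of (i, k) \<Rightarrow> eval 3 s [(0, LBox 2 (f i)), (2, LBox 1 (w k))]) =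
        pairing s (w k) y *s f i" if "y \<in> P 1 s" for y i k
      using cap3_tensor[OF f(2) w(2) that] by simp
  qed (use z(2) f w pairing_sep_right[OF nd w] in auto)
  then show ?thesis by (simp add: p)
qed

text \<open>As \<open>P 1\<close> is commutative, the differences of two ways of splitting a power of \<open>u\<close>
  along the arcs of \<open>h\<close> are killed by every right cap.\<close>

lemma kappa:
  assumes nd: nondegenerate and u: "u \<in> P 1 s" "indep (case_option u (\<lambda>_::unit. eval 1 s []))"
    and P1: "P 1 s \<subseteq> span {eval 1 s [], u}"
  shows "\<exists>k0 k1. k0 \<in> P 2 s \<and> k1 \<in> P 2 s \<and>
    (\<forall>y\<in>P 1 (flip s). eval 1 s [(1, LCup), (0, LBox 2 k0), (1, LBox 1 y), (1, LCap)] = 0) \<and>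
    (\<forall>y\<in>P 1 (flip s). eval 1 s [(1, LCup), (0, LBox 2 k1), (1, LBox 1 y), (1, LCap)] = 0) \<and>
    (\<forall>c d. (\<forall>x\<in>P 1 s. \<forall>y\<in>P 1 s. c * bubble s x y k0 + d * bubble s x y k1 = 0) \<longrightarrow> c = 0 \<and> d = 0)"
proof -
  let ?e = "eval 1 s []" and ?m = "\<lambda>a b. eval 1 s [(0, LBox 1 a), (0, LBox 1 b)]"
  have eP: "?e \<in> P 1 s" by simp
  have el: "eval 1 s [(0, LBox 1 ?e), (0, LBox 1 a)] = a" if "a \<in> P 1 s" for a
    using word_box'[of 1 s "[]" 1 "[(0, LBox 1 a)]" 0 1 s "[]" ?e "[]"] that eval_single[OF that] by simp
  have er: "eval 1 s [(0, LBox 1 a), (0, LBox 1 ?e)] = a" if "a \<in> P 1 s" for a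
    using word_box'[of 1 s "[(0, LBox 1 a)]" 1 "[]" 0 1 s "[]" ?e "[]"] that eval_single[OF that] by simp
  have linl: "linear_on (P 1 s) (\<lambda>a. ?m a b)" if "b \<in> P 1 s" for b
    using linear_on_eval[of 1 s "[]" 1 "[(0, LBox 1 b)]" 0 1] that by simp
  have linr: "linear_on (P 1 s) (\<lambda>b. ?m a b)" if "a \<in> P 1 s" for a
    using linear_on_eval[of 1 s "[(0, LBox 1 a)]" 1 "[]" 0 1] that by simp
  have dec: "\<exists>p q. a = p *s ?e + (q *s u + 0)" if a: "a \<in> P 1 s" for a
  proof -
    have "a \<in> span {?e, u}" using P1 a by auto
    then obtain p where "a - p *s ?e \<in> span {u}" by (auto simp: span_insert)
    then obtain q where "a - p *s ?e = q *s u" by (auto simp: span_singleton)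
    then have "a = p *s ?e + (q *s u + 0)" by (simp add: algebra_simps)
    then show ?thesis by blast
  qed
  have P0: "0 \<in> P 1 s" using subspace_0[OF subspace_P] .
  have lin: "f (p *s ?e + (q *s u + 0)) = p *s f ?e + q *s f u" if "linear_on (P 1 s) f" for f p q
  proof -
    have "q *s u + 0 \<in> P 1 s" using u(1) subspace_P by (simp add: subspace_scale)
    then have "f (p *s ?e + (q *s u + 0)) = p *s f ?e + f (q *s u + 0)"
      using that eP unfolding linear_on_def by blast
    moreover have "f (q *s u + 0) = q *s f u + f 0"
      using that u(1) P0 unfolding linear_on_def by blast
    ultimately show ?thesis using linear_on_0[OF that P0] by simp
  qed
  \<comment> \<open>\<open>P 1 s\<close> is spanned by the string and \<open>u\<close>, hence
    commutative.\<close>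
  have comm_u: "?m u b = ?m b u" if b: "b \<in> P 1 s" for b
  proof -
    obtain p q where "b = p *s ?e + (q *s u + 0)" using dec[OF b] by blast
    then show ?thesis
      using lin[OF linr[OF u(1)], of p q] lin[OF linl[OF u(1)], of p q] el[OF u(1)] er[OF u(1)] by simp
  qed
  have comm: "?m a b = ?m b a" if ab: "a \<in> P 1 s" "b \<in> P 1 s" for a b
  proof -
    obtain p q where "a = p *s ?e + (q *s u + 0)" using dec[OF ab(1)] by blast
    then show ?thesis
      using lin[OF linl[OF ab(2)], of p q] lin[OF linr[OF ab(2)], of p q] el[OF ab(2)] er[OF ab(2)]
        comm_u[OF ab(2)] by simp
  qed
  have assoc: "eval 1 s [(0, LBox 1 a), (0, LBox 1 b), (0, LBox 1 c)] = ?m (?m a b) c"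
    "eval 1 s [(0, LBox 1 a), (0, LBox 1 b), (0, LBox 1 c)] = ?m a (?m b c)"
    if abc: "a \<in> P 1 s" "b \<in> P 1 s" "c \<in> P 1 s" for a b c
    using word_box'[of 1 s "[]" 1 "[(0, LBox 1 c)]" 0 1 s "[(0, LBox 1 a), (0, LBox 1 b)]" "?m a b"
        "[(0, LBox 1 a), (0, LBox 1 b)]"]
      word_box'[of 1 s "[(0, LBox 1 a)]" 1 "[]" 0 1 s "[(0, LBox 1 b), (0, LBox 1 c)]" "?m b c"
        "[(0, LBox 1 b), (0, LBox 1 c)]"] abc by simp_all
  let ?uu = "?m u u"
  have uuP: "?uu \<in> P 1 s" using u(1) by simp
  define k0 where "k0 = (- 1) *s split2 s u ?e + split2 s ?e u"
  define k1 where "k1 = (- 1) *s split2 s ?uu ?e + split2 s u u"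
  have kP: "k0 \<in> P 2 s" "k1 \<in> P 2 s"
    unfolding k0_def k1_def
    by (intro subspace_add[OF subspace_P] subspace_scale[OF subspace_P] split2_P u(1) eP uuP)+
  have cap: "eval 1 s [(1, LCup), (0, LBox 2 ((- 1) *s split2 s a b + split2 s a' b')), (1, LBox 1 y), (1, LCap)] =
      - eval 1 s [(0, LBox 1 b), (0, LBox 1 h), (0, LBox 1 a)] + eval 1 s [(0, LBox 1 b'), (0, LBox 1 h), (0, LBox 1 a')]"
    if "a \<in> P 1 s" "b \<in> P 1 s" "a' \<in> P 1 s" "b' \<in> P 1 s" "y \<in> P 1 (flip s)"
      "h = eval 1 s [(1, LCup), (0, LCap), (0, LCup), (1, LBox 1 y), (1, LCap)]" for a b a' b' y h
  proof -
    have l: "linear_on (P 2 s) (\<lambda>x. eval 1 s [(1, LCup), (0, LBox 2 x), (1, LBox 1 y), (1, LCap)])"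
      using linear_on_eval[of 1 s "[(1, LCup)]" 3 "[(1, LBox 1 y), (1, LCap)]" 0 2] that by simp
    have sP: "split2 s a b \<in> P 2 s" "split2 s a' b' \<in> P 2 s" using that by simp_all
    show ?thesis
      using l[unfolded linear_on_def, rule_format, OF sP, of "- 1"] cap2_split[OF that(1,2,5,6)]
        cap2_split[OF that(3,4,5,6)] by simp
  qed
  have z0: "eval 1 s [(1, LCup), (0, LBox 2 k0), (1, LBox 1 y), (1, LCap)] = 0" if y: "y \<in> P 1 (flip s)" for y
  proof -
    define h where "h = eval 1 s [(1, LCup), (0, LCap), (0, LCup), (1, LBox 1 y), (1, LCap)]"
    have hP: "h \<in> P 1 s" using y by (simp add: h_def)
    have "?m ?e (?m h u) = ?m h u" by (rule el) (use hP u(1) in simp)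
    moreover have "?m (?m u h) ?e = ?m u h" by (rule er) (use hP u(1) in simp)
    ultimately show ?thesis
      unfolding k0_def using cap[OF u(1) eP eP u(1) y h_def] assoc(2)[OF eP hP u(1)] assoc(1)[OF u(1) hP eP]
        comm[OF hP u(1)] by simp
  qed
  have z1: "eval 1 s [(1, LCup), (0, LBox 2 k1), (1, LBox 1 y), (1, LCap)] = 0" if y: "y \<in> P 1 (flip s)" for y
  proof -
    define h where "h = eval 1 s [(1, LCup), (0, LCap), (0, LCup), (1, LBox 1 y), (1, LCap)]"
    have hP: "h \<in> P 1 s" using y by (simp add: h_def)
    have "?m ?e (?m h ?uu) = ?m h ?uu" by (rule el) (use hP uuP in simp)
    moreover have "?m h ?uu = ?m (?m h u) u" using assoc[OF hP u(1) u(1)] by simp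
    moreover have "?m (?m h u) u = ?m (?m u h) u" using comm[OF hP u(1)] by simp
    ultimately show ?thesis
      unfolding k1_def using cap[OF uuP eP u(1) u(1) y h_def] assoc(2)[OF eP hP uuP] assoc(1)[OF u(1) hP u(1)]
      by simp
  qed
  have bub: "bubble s x y ((- 1) *s split2 s a b + split2 s a' b') =
      - (pairing s y b * pairing s a x) + pairing s y b' * pairing s a' x"
    if "a \<in> P 1 s" "b \<in> P 1 s" "a' \<in> P 1 s" "b' \<in> P 1 s" "x \<in> P 1 s" "y \<in> P 1 s" for a b a' b' x y
  proof (rule coef_unique[of _ s])
    have l: "linear_on (P 2 s) (\<lambda>k. eval 0 s [(0, LCup), (0, LBox 1 y), (0, LBox 2 k), (0, LBox 1 x), (0, LCap)])"
      using linear_on_eval[of 0 s "[(0, LCup), (0, LBox 1 y)]" 2 "[(0, LBox 1 x), (0, LCap)]" 0 2] that by simp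
    have sP: "split2 s a b \<in> P 2 s" "split2 s a' b' \<in> P 2 s" using that by simp_all
    then have "(- 1) *s split2 s a b + split2 s a' b' \<in> P 2 s"
      using subspace_P by (intro subspace_add subspace_scale) auto
    then show "bubble s x y ((- 1) *s split2 s a b + split2 s a' b') *s eval 0 s [] =
        (- (pairing s y b * pairing s a x) + pairing s y b' * pairing s a' x) *s eval 0 s []"
      using bubble[OF that(5,6)] l[unfolded linear_on_def, rule_format, OF sP, of "- 1"]
        bubble_split[OF that(1,2,5,6)] bubble_split[OF that(3,4,5,6)] sP
      by (simp add: scale_left_distrib scale_left_diff_distrib)
  qed
  have ind: "c = 0 \<and> d = 0"
    if *: "\<And>x y. x \<in> P 1 s \<Longrightarrow> y \<in> P 1 s \<Longrightarrow> c * bubble s x y k0 + d * bubble s x y k1 = 0" for c d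
  proof -
    let ?w = "case_option u (\<lambda>_::unit. ?e)"
    have wP: "?w k \<in> P 1 s" for k using u(1) by (cases k) auto
    have UO: "(\<Sum>k\<in>UNIV. f k) = f None + f (Some ())" for f :: "unit option \<Rightarrow> complex"
      by (simp add: UNIV_option_conv UNIV_unit)
    \<comment> \<open>Separation in \<open>y\<close> against the family of \<open>u\<close> and the
      string comes first; the coefficient of \<open>u\<close> is this equation in \<open>x\<close>.
      A second separation, in \<open>x\<close>, then gives \<open>c\<close> and
      \<open>d\<close>.\<close>
    have 1: "c * pairing s ?e x + d * pairing s u x = 0" if x: "x \<in> P 1 s" for x
    proof -
      let ?c = "\<lambda>k. case k of None \<Rightarrow> c * pairing s ?e x + d * pairing s u x
        | Some _ \<Rightarrow> - (c * pairing s u x + d * pairing s ?uu x)"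
      have "(\<Sum>k\<in>UNIV. ?c k * pairing s y (?w k)) = 0" if y: "y \<in> P 1 s" for y
      proof -
        have b: "bubble s x y k0 = - (pairing s y ?e * pairing s u x) + pairing s y u * pairing s ?e x"
          "bubble s x y k1 = - (pairing s y ?e * pairing s ?uu x) + pairing s y u * pairing s u x"
          unfolding k0_def k1_def using bub[OF u(1) eP eP u(1) x y] bub[OF uuP eP u(1) u(1) x y] by blast+
        show ?thesis using *[OF x y] unfolding b UO option.case by (simp add: algebra_simps)
      qed
      from pairing_sep_left[OF nd u(2) wP this, of None] show ?thesis by simp
    qed
    let ?c = "\<lambda>k. case k of None \<Rightarrow> d | Some _ \<Rightarrow> c"
    have "(\<Sum>k\<in>UNIV. ?c k * pairing s (?w k) x) = 0" if "x \<in> P 1 s" for x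
      using 1[OF that] by (simp add: UO algebra_simps)
    from pairing_sep_right[OF nd u(2) wP this, of None] pairing_sep_right[OF nd u(2) wP this, of "Some ()"]
    show ?thesis by simp
  qed
  show ?thesis using kP z0 z1 ind by (intro exI[of _ k0] exI[of _ k1]) blast
qed

lemma one_nonzero:
  assumes "\<delta> \<noteq> 0" shows "eval 1 s [] \<noteq> 0"
proof
  assume "eval 1 s [] = 0"
  then have "eval 0 s ([(0, LCup)] @ [] @ [(0, LCap)]) = 0"
    using zero_at[of 1 s "[]" 0 s "[(0, LCup)]" 2 "[(0, LCap)]" 0 "[]"] by simp
  then show False using circle_eval[of s] eval_0_nonzero[of s] assms by simp
qed

text \<open>Otherwise there are 27 independent tensor products in \<open>P 3 s\<close>.\<close>

lemma no_three:
  fixes f :: "unit option option \<Rightarrow> 'v"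
  assumes nd: nondegenerate and dim: "dim (P 3 s) = 15"
  shows "\<not> (indep f \<and> (\<forall>i. f i \<in> P 1 s))"
proof
  assume f: "indep f \<and> (\<forall>i. f i \<in> P 1 s)"
  let ?v = "\<lambda>k. rot s (f k)"
  have v: "indep ?v" "\<And>k. ?v k \<in> P 1 (flip s)" using rot_indep f rot_P by blast+
  let ?g = "\<lambda>p. case p of (i, k) \<Rightarrow> eval 2 s [(0, LBox 1 (f i)), (1, LBox 1 (?v k))]"
  have z2: "eval 1 s [(1, LCup), (0, LBox 2 0), (1, LBox 1 y), (1, LCap)] = 0" if "y \<in> P 1 (flip s)" for y
    using linear_on_0[OF linear_on_eval[of 1 s "[(1, LCup)]" 3 "[(1, LBox 1 y), (1, LCap)]" 0 2]] that
      subspace_0[OF subspace_P] by simp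
  have z3: "eval 2 s [(2, LCup), (0, LBox 3 0), (2, LBox 1 y), (2, LCap)] = 0" if "y \<in> P 1 s" for y
    using linear_on_0[OF linear_on_eval[of 2 s "[(2, LCup)]" 4 "[(2, LBox 1 y), (2, LCap)]" 0 3]] that
      subspace_0[OF subspace_P] by simp
  have g: "indep ?g" unfolding indep_def
  proof (intro allI impI)
    fix c p assume "(\<Sum>p\<in>UNIV. c p *s ?g p) = 0"
    then show "c p = 0"
      using tensor_2_indep[OF nd, of f s ?v 0 c p] f v z2 subspace_0[OF subspace_P] by simp
  qed
  have gP: "?g p \<in> P 2 s" for p using f v by (cases p) simp
  let ?h = "\<lambda>p. case p of (i, k) \<Rightarrow> eval 3 s [(0, LBox 2 (?g i)), (2, LBox 1 (f k))]"
  have h: "indep ?h" unfolding indep_def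
  proof (intro allI impI)
    fix c p assume "(\<Sum>p\<in>UNIV. c p *s ?h p) = 0"
    then show "c p = 0"
      using tensor_3_indep[OF nd g gP, of f 0 c p] f z3 subspace_0[OF subspace_P] by simp
  qed
  have "?h p \<in> P 3 s" for p using f gP by (cases p) simp
  then have "card (UNIV :: ((unit option option \<times> unit option option) \<times> unit option option) set) \<le> 15"
    using indep_card[OF h, of "P 3 s"] dim by (metis image_subsetI zero_less_numeral)
  then show False
    by (simp add: card_cartesian_product UNIV_option_conv UNIV_unit flip: UNIV_Times_UNIV)
qed

text \<open>Any 1-box outside the scalars completes a basis, because a third independent one would
  contradict \<open>no_three\<close>.\<close>

lemma second_element:
  assumes "\<delta> \<noteq> 0" "\<not> P 1 s \<subseteq> span {eval 1 s []}" and nd: nondegenerate and dim: "\<And>s. dim (P 3 s) = 15"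
  obtains u where "u \<in> P 1 s" "indep (case_option u (\<lambda>_::unit. eval 1 s []))" "P 1 s \<subseteq> span {eval 1 s [], u}"
proof -
  obtain u where u: "u \<in> P 1 s" "u \<notin> span {eval 1 s []}" using assms(2) by auto
  let ?f = "case_option u (\<lambda>_::unit. eval 1 s [])"
  have f: "indep ?f"
    by (rule indep_option[OF indep_unit[OF one_nonzero]]) (use u(2) assms(1) in auto)
  have r: "range ?f = {eval 1 s [], u}" by (auto simp: UNIV_option_conv UNIV_unit)
  have "P 1 s \<subseteq> span {eval 1 s [], u}"
  proof (rule ccontr)
    assume "\<not> P 1 s \<subseteq> span {eval 1 s [], u}"
    then obtain w where w: "w \<in> P 1 s" "w \<notin> span {eval 1 s [], u}" by auto
    have "indep (case_option w ?f)" by (rule indep_option[OF f]) (use w r in simp)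
    moreover have "case_option w ?f i \<in> P 1 s" for i using w u by (auto split: option.splits)
    ultimately show False using no_three[OF nd dim] by blast
  qed
  then show ?thesis using that u f by blast
qed

text \<open>If \<open>dim P 1 = 2\<close>, then \<open>P 3\<close> contains 8 tensor products and twice 4 products with the
  elements of lemma \<open>kappa\<close>: 16 independent elements.\<close>

theorem P_1_scalar:
  assumes d: "\<delta> \<noteq> 0" and nd: nondegenerate and dim: "\<And>s. dim (P 3 s) = 15"
  shows "P 1 s \<subseteq> span {eval 1 s []}"
proof (rule ccontr)
  assume s: "\<not> P 1 s \<subseteq> span {eval 1 s []}"
  obtain u where u: "u \<in> P 1 s" "indep (case_option u (\<lambda>_::unit. eval 1 s []))"
    "P 1 s \<subseteq> span {eval 1 s [], u}" using second_element[OF d s nd dim] .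
  \<comment> \<open>\<open>rot\<close> carries two independent 1-boxes to the opposite shading,
    where they cannot both be multiples of the string.\<close>
  have s': "\<not> P 1 (flip s) \<subseteq> span {eval 1 (flip s) []}"
  proof
    assume *: "P 1 (flip s) \<subseteq> span {eval 1 (flip s) []}"
    let ?f = "\<lambda>k. rot s (case_option u (\<lambda>_::unit. eval 1 s []) k)"
    have i: "indep ?f" by (rule rot_indep[OF u(2)]) (use u in \<open>auto split: option.splits\<close>)
    have P: "?f k \<in> P 1 (flip s)" for k using u(1) by (intro rot_P) (auto split: option.splits)
    obtain p q where p: "?f None = p *s eval 1 (flip s) []" and q: "?f (Some ()) = q *s eval 1 (flip s) []"
      using * P[of None] P[of "Some ()"] unfolding span_singleton by blast
    have pq: "(\<Sum>k\<in>UNIV. (case k of None \<Rightarrow> q | Some _ \<Rightarrow> - p) *s ?f k) = 0"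
      using p q by (simp add: UNIV_option_conv UNIV_unit mult.commute)
    have "p = 0" using indepD[OF i pq, of "Some ()"] by simp
    then have "?f None = 0" using p by simp
    then have "(\<Sum>k\<in>UNIV. (case k of None \<Rightarrow> 1 | Some _ \<Rightarrow> 0) *s ?f k) = 0"
      by (simp add: UNIV_option_conv UNIV_unit)
    from indepD[OF i this, of None] show False by simp
  qed
  obtain u' where u': "u' \<in> P 1 (flip s)" "indep (case_option u' (\<lambda>_::unit. eval 1 (flip s) []))"
    "P 1 (flip s) \<subseteq> span {eval 1 (flip s) [], u'}" using second_element[OF d s' nd dim] .
  let ?w = "case_option u (\<lambda>_::unit. eval 1 s [])" and ?v = "case_option u' (\<lambda>_::unit. eval 1 (flip s) [])"
  have wP: "?w k \<in> P 1 s" for k using u by (auto split: option.splits)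
  have vP: "?v k \<in> P 1 (flip s)" for k using u' by (auto split: option.splits)
  obtain k0 k1 where kkP: "k0 \<in> P 2 s" "k1 \<in> P 2 s"
    and kz: "\<forall>y\<in>P 1 (flip s). eval 1 s [(1, LCup), (0, LBox 2 k0), (1, LBox 1 y), (1, LCap)] = 0"
      "\<forall>y\<in>P 1 (flip s). eval 1 s [(1, LCup), (0, LBox 2 k1), (1, LBox 1 y), (1, LCap)] = 0"
    and ki: "\<forall>c d. (\<forall>x\<in>P 1 s. \<forall>y\<in>P 1 s. c * bubble s x y k0 + d * bubble s x y k1 = 0) \<longrightarrow> c = 0 \<and> d = 0"
    using kappa[OF nd u] unfolding flip_flip by (elim exE conjE) (rule that)
  obtain l0 l1 where llP: "l0 \<in> P 2 (flip s)" "l1 \<in> P 2 (flip s)"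
    and lz: "\<forall>y\<in>P 1 (s). eval 1 (flip s) [(1, LCup), (0, LBox 2 l0), (1, LBox 1 y), (1, LCap)] = 0"
      "\<forall>y\<in>P 1 (s). eval 1 (flip s) [(1, LCup), (0, LBox 2 l1), (1, LBox 1 y), (1, LCap)] = 0"
    and li: "\<forall>c d. (\<forall>x\<in>P 1 (flip s). \<forall>y\<in>P 1 (flip s). c * bubble (flip s) x y l0 + d * bubble (flip s) x y l1 = 0) \<longrightarrow> c = 0 \<and> d = 0"
    using kappa[OF nd u'] unfolding flip_flip by (elim exE conjE) (rule that)
  let ?k = "\<lambda>b. if b then k1 else k0" and ?l = "\<lambda>b. if b then l1 else l0"
  have kP: "?k b \<in> P 2 s" and lP: "?l b \<in> P 2 (flip s)" for b using kkP llP by auto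
  have sub: "subspace (P m t)" for m t by (rule subspace_P)
  have bub_lin: "bubble t x y (\<Sum>b\<in>UNIV. c b *s f b) = (\<Sum>b\<in>UNIV. c b * bubble t x y (f b))"
    if "x \<in> P 1 t" "y \<in> P 1 t" "\<And>b. f b \<in> P 2 t" for t x y c and f :: "bool \<Rightarrow> 'v"
  proof (rule coef_unique[of _ t])
    have "linear_on (P 2 t) (\<lambda>k. eval 0 t [(0, LCup), (0, LBox 1 y), (0, LBox 2 k), (0, LBox 1 x), (0, LCap)])"
      using linear_on_eval[of 0 t "[(0, LCup), (0, LBox 1 y)]" 2 "[(0, LBox 1 x), (0, LCap)]" 0 2] that by simp
    from linear_on_sum[OF this sub, of UNIV f c]
    have "bubble t x y (\<Sum>b\<in>UNIV. c b *s f b) *s eval 0 t [] = (\<Sum>b\<in>UNIV. c b *s (bubble t x y (f b) *s eval 0 t []))"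
      using bubble[OF that(1,2)] that(3) sub by (simp add: subspace_sum subspace_scale)
    then show "bubble t x y (\<Sum>b\<in>UNIV. c b *s f b) *s eval 0 t [] = (\<Sum>b\<in>UNIV. c b * bubble t x y (f b)) *s eval 0 t []"
      by (simp add: scale_sum_left)
  qed
  have ik: "c b = 0" if ck: "(\<Sum>b\<in>UNIV. c b *s ?k b) = 0" for c b
  proof -
    have "c False * bubble s x y k0 + c True * bubble s x y k1 = 0" if xy: "x \<in> P 1 s" "y \<in> P 1 s" for x y
    proof -
      have "bubble s x y 0 = 0"
        using bub_lin[OF xy, of "\<lambda>_. 0" "\<lambda>_. 0"] subspace_0[OF sub] by simp
      then show ?thesis using bub_lin[OF xy, of ?k c, OF kP] unfolding ck
        by (simp add: UNIV_bool add.commute)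
    qed
    then have "\<forall>x\<in>P 1 s. \<forall>y\<in>P 1 s. c False * bubble s x y k0 + c True * bubble s x y k1 = 0"
      by (intro ballI)
    from ki[THEN spec, THEN spec, THEN mp, OF this] show ?thesis by (cases b) simp_all
  qed
  have ikk: "indep ?k" unfolding indep_def using ik by blast
  \<comment> \<open>Six 2-boxes are formed: four tensor products together with \<open>k0\<close> and
    \<open>k1\<close>. With a 1-box on the third string they give twelve 3-boxes.\<close>
  let ?g = "\<lambda>p. case p of (i, k) \<Rightarrow> eval 2 s [(0, LBox 1 (?w i)), (1, LBox 1 (?v k))]"
  let ?f = "case_sum ?g ?k"
  have f: "indep ?f"
  proof (rule indep_case_sum[OF _ ikk], intro allI)
    fix c d p assume eq: "(\<Sum>i\<in>UNIV. c i *s ?g i) + (\<Sum>j\<in>UNIV. d j *s ?k j) = 0"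
    show "c p = 0"
    proof (rule tensor_2_indep[OF nd u(2) wP u'(2) vP _ _ eq])
      show "(\<Sum>j\<in>UNIV. d j *s ?k j) \<in> P 2 s"
        using kP sub by (intro subspace_sum subspace_scale) auto
      fix y assume y: "y \<in> P 1 (flip s)"
      have "linear_on (P 2 s) (\<lambda>x. eval 1 s [(1, LCup), (0, LBox 2 x), (1, LBox 1 y), (1, LCap)])"
        using linear_on_eval[of 1 s "[(1, LCup)]" 3 "[(1, LBox 1 y), (1, LCap)]" 0 2] y by simp
      from linear_on_sum[OF this sub, of UNIV ?k d, OF kP] bspec[OF kz(1) y] bspec[OF kz(2) y]
      show "eval 1 s [(1, LCup), (0, LBox 2 (\<Sum>j\<in>UNIV. d j *s ?k j)), (1, LBox 1 y), (1, LCap)] = 0"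
        by (simp add: UNIV_bool)
    qed
  qed
  have gP: "?g p \<in> P 2 s" for p
    using wP vP by (cases p) (simp add: eval_in_P)
  have fP: "?f i \<in> P 2 s" for i
    using kP gP by (cases i) (simp_all only: sum.case)
  \<comment> \<open>Four 3-boxes with \<open>l0\<close> or \<open>l1\<close> on the last two
    strings. Every cap on the third string kills them, so they may enter as \<open>z\<close> in
    \<open>tensor_3_indep\<close>; their own independence is detected by
    \<open>bubble\<close>.\<close>
  let ?z = "\<lambda>p. case p of (j, b) \<Rightarrow> eval 3 s [(0, LBox 1 (?w j)), (1, LBox 2 (?l b))]"
  have zP: "?z p \<in> P 3 s" for p using wP lP by (cases p) simp
  have iz: "indep ?z" unfolding indep_def
  proof (intro allI impI)
    have prod_sum: "(\<Sum>p\<in>UNIV. h p) = (\<Sum>j\<in>UNIV. \<Sum>b\<in>UNIV. h (j, b))"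
      for h :: "unit option \<times> bool \<Rightarrow> 'v" by (simp add: sum.cartesian_product)
    fix c and p :: "unit option \<times> bool"
    assume eq: "(\<Sum>p\<in>UNIV. c p *s ?z p) = 0"
    obtain j b where p: "p = (j, b)" by (cases p)
    have "c (j, False) * bubble (flip s) x y l0 + c (j, True) * bubble (flip s) x y l1 = 0"
      if xy: "x \<in> P 1 (flip s)" "y \<in> P 1 (flip s)" for x y
    proof -
      let ?C = "\<lambda>z. eval 1 s [(1, LCup), (1, LBox 1 y), (0, LBox 3 z), (1, LBox 1 x), (1, LCap)]"
      have lin: "linear_on (P 3 s) ?C"
        using linear_on_eval[of 1 s "[(1, LCup), (1, LBox 1 y)]" 3 "[(1, LBox 1 x), (1, LCap)]" 0 3] xy by simp
      have "0 = ?C (\<Sum>p\<in>UNIV. c p *s ?z p)"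
        unfolding eq using linear_on_0[OF lin] subspace_0[OF sub] by simp
      also have "\<dots> = (\<Sum>p\<in>UNIV. c p *s ?C (?z p))"
        by (rule linear_on_sum[OF lin sub]) (rule zP)
      also have "\<dots> = (\<Sum>j\<in>UNIV. \<Sum>b\<in>UNIV. c (j, b) *s ?C (?z (j, b)))"
        by (rule prod_sum)
      also have "\<dots> = (\<Sum>j\<in>UNIV. (\<Sum>b\<in>UNIV. c (j, b) * bubble (flip s) x y (?l b)) *s ?w j)"
        unfolding prod.case bubble_tensor[OF wP xy(2) lP xy(1)] by (simp add: scale_sum_left)
      finally have "(\<Sum>j\<in>UNIV. (\<Sum>b\<in>UNIV. c (j, b) * bubble (flip s) x y (?l b)) *s ?w j) = 0" by simp
      from indepD[OF u(2) this, of j] show ?thesis by (simp add: UNIV_bool add.commute)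
    qed
    then have "\<forall>x\<in>P 1 (flip s). \<forall>y\<in>P 1 (flip s).
        c (j, False) * bubble (flip s) x y l0 + c (j, True) * bubble (flip s) x y l1 = 0"
      by (intro ballI)
    from li[THEN spec, THEN spec, THEN mp, OF this] show "c p = 0" unfolding p by (cases b) simp_all
  qed
  let ?h = "\<lambda>p. case p of (i, k) \<Rightarrow> eval 3 s [(0, LBox 2 (?f i)), (2, LBox 1 (?w k))]"
  have hP: "?h p \<in> P 3 s" for p
  proof -
    obtain i k where p: "p = (i, k)" by (cases p)
    show ?thesis unfolding p prod.case using fP[of i] wP[of k] by simp
  qed
  have "indep (case_sum ?h ?z)"
  proof (rule indep_case_sum[OF _ iz], intro allI)
    fix c d p assume eq: "(\<Sum>i\<in>UNIV. c i *s ?h i) + (\<Sum>j\<in>UNIV. d j *s ?z j) = 0"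
    show "c p = 0"
    proof (rule tensor_3_indep[OF nd f fP u(2) wP _ _ eq])
      show "(\<Sum>j\<in>UNIV. d j *s ?z j) \<in> P 3 s"
        using zP sub by (intro subspace_sum subspace_scale) auto
      fix y assume y: "y \<in> P 1 s"
      have lin: "linear_on (P 3 s) (\<lambda>x. eval 2 s [(2, LCup), (0, LBox 3 x), (2, LBox 1 y), (2, LCap)])"
        using linear_on_eval[of 2 s "[(2, LCup)]" 4 "[(2, LBox 1 y), (2, LCap)]" 0 3] y by simp
      have "eval 2 s [(2, LCup), (0, LBox 3 (?z p)), (2, LBox 1 y), (2, LCap)] = 0" for p
        using cap3_kill[OF wP llP(1) y bspec[OF lz(1) y]] cap3_kill[OF wP llP(2) y bspec[OF lz(2) y]]
        by (cases p) auto
      then show "eval 2 s [(2, LCup), (0, LBox 3 (\<Sum>j\<in>UNIV. d j *s ?z j)), (2, LBox 1 y), (2, LCap)] = 0"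
        unfolding linear_on_sum[OF lin sub, of UNIV ?z d, OF zP] by simp
    qed
  qed
  moreover have "range (case_sum ?h ?z) \<subseteq> P 3 s"
  proof (rule image_subsetI)
    show "case_sum ?h ?z x \<in> P 3 s" for x using hP zP by (cases x) (simp_all only: sum.case)
  qed
  ultimately have "card (UNIV :: ((((unit option \<times> unit option) + bool) \<times> unit option) + (unit option \<times> bool)) set) \<le> 15"
    using indep_card[of "case_sum ?h ?z" "P 3 s"] dim by simp
  then show False
    by (simp add: card_cartesian_product UNIV_option_conv UNIV_unit card_Plus flip: UNIV_Times_UNIV UNIV_Plus_UNIV)
qed

section \<open>The space of 2-boxes\<close>

lemma click_id_straighten:
  shows "eval 2 s [(2, LCup), (0, LCap)] = eval 2 s [(0, LCap), (0, LCup)]"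
proof -
  have "eval 2 s [(2, LCup), (0, LCap)] = eval 2 s [(0, LCap), (0, LCup)]"
    by (rule eval_ex'[of 2 s "[]" 0 LCap 0 LCup "[]" 2, unfolded append.simps, symmetric]) simp_all
  then show ?thesis .
qed

lemma click_h_straighten:
  shows "eval 2 s [(2, LCup), (1, LCap), (1, LCup), (0, LCap)] = eval 2 s []"
proof -
  have "eval 2 s [(2, LCup), (1, LCap), (1, LCup), (0, LCap)] = eval 2 s [(1, LCup), (0, LCap)]"
    by (rule eval_zr[of 2 s "[]" 2 "[(1, LCup), (0, LCap)]" 1 2, unfolded append.simps]) simp_all
  also have "\<dots> = eval 2 s []"
    by (rule eval_zr[of 2 s "[]" 2 "[]" 0 1, unfolded append.simps]) simp_all
  finally show ?thesis .
qed

lemma click_linear: "linear_on (P 2 s) (click Z s)"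
proof -
  have "linear_on (P 2 s) (\<lambda>x. eval 2 (flip s) [(2, LCup), (1, LBox 2 x), (0, LCap)])"
    using linear_on_eval[of 2 "flip s" "[(2, LCup)]" 4 "[(0, LCap)]" 1 2] by simp
  then show ?thesis
    using click_eval[of _ s] subspace_P unfolding linear_on_def
    by (metis subspace_add subspace_scale)
qed

lemma click_id: "click Z s (eval 2 s []) = eval 2 (flip s) [(0, LCap), (0, LCup)]"
proof -
  have "click Z s (eval 2 s []) = eval 2 (flip s) [(2, LCup), (1, LBox 2 (eval 2 s [])), (0, LCap)]"
    by (rule click_eval) simp
  also have "\<dots> = eval 2 (flip s) [(2, LCup), (0, LCap)]"
    by (rule word_box'[OF _ _ _ _ _ refl, where U = "[(2, LCup)]" and V = "[(0, LCap)]" and l = 4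
      and S' = "[]", unfolded append.simps]) simp_all
  finally show ?thesis using click_id_straighten[of "flip s"] by simp
qed

lemma click_h: "click Z s (eval 2 s [(0, LCap), (0, LCup)]) = eval 2 (flip s) []"
proof -
  have "click Z s (eval 2 s [(0, LCap), (0, LCup)]) =
      eval 2 (flip s) [(2, LCup), (1, LBox 2 (eval 2 s [(0, LCap), (0, LCup)])), (0, LCap)]"
    by (rule click_eval) simp
  also have "\<dots> = eval 2 (flip s) [(2, LCup), (1, LCap), (1, LCup), (0, LCap)]"
    by (rule word_box'[OF _ _ _ _ _ refl, where U = "[(2, LCup)]" and V = "[(0, LCap)]" and l = 4
      and S' = "[(1, LCap), (1, LCup)]", unfolded append.simps]) simp_all
  finally show ?thesis using click_h_straighten[of "flip s"] by simp
qed

lemma h_nonzero: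
  assumes "\<delta> \<noteq> 0" shows "eval 2 s [(0, LCap), (0, LCup)] \<noteq> 0"
proof
  assume "eval 2 s [(0, LCap), (0, LCup)] = 0"
  then have "eval 0 s ([(0, LCup)] @ [(0, LCap), (0, LCup)] @ [(0, LCap)]) = 0"
    using zero_at[of 2 s "[(0, LCap), (0, LCup)]" 0 s "[(0, LCup)]" 2 "[(0, LCap)]" 0 "[(0, LCap), (0, LCup)]"]
    by simp
  moreover have "eval 0 s ([(0, LCup)] @ [(0, LCap), (0, LCup)] @ [(0, LCap)]) =
      \<delta> *s eval 0 s [(0, LCup), (0, LCap)]"
    using eval_circle[of 0 s "[]" 0 "[(0, LCup), (0, LCap)]" 0] by simp
  ultimately show False using circle_eval[of s] eval_0_nonzero[of s] assms by simp
qed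

lemma id_mult: "x \<in> P 2 s \<Longrightarrow> eval 2 s [(0, LBox 2 (eval 2 s [])), (0, LBox 2 x)] = x"
  using word_box'[of 2 s "[]" 2 "[(0, LBox 2 x)]" 0 2 s "[]" "eval 2 s []" "[]"] eval_single[of x 2 s] by simp

lemma mult_id: "x \<in> P 2 s \<Longrightarrow> eval 2 s [(0, LBox 2 x), (0, LBox 2 (eval 2 s []))] = x"
  using word_box'[of 2 s "[(0, LBox 2 x)]" 2 "[]" 0 2 s "[]" "eval 2 s []" "[]"] eval_single[of x 2 s] by simp

lemma h_box: "x = eval 2 ((flip ^^ k) s) [(0, LCap), (0, LCup)] \<Longrightarrow> ok m s U l \<Longrightarrow> ok l s V m \<Longrightarrow> k + 2 \<le> l \<Longrightarrow>
    eval m s (U @ (k, LBox 2 x) # V) = eval m s (U @ (k, LCap) # (k, LCup) # V)"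
  using word_box'[of m s U l V k 2 "(flip ^^ k) s" "[(0, LCap), (0, LCup)]" x "[(k, LCap), (k, LCup)]"] by simp

lemma id_box: "x = eval 2 ((flip ^^ k) s) [] \<Longrightarrow> ok m s U l \<Longrightarrow> ok l s V m \<Longrightarrow> k + 2 \<le> l \<Longrightarrow>
    eval m s (U @ (k, LBox 2 x) # V) = eval m s (U @ V)"
  using word_box'[of m s U l V k 2 "(flip ^^ k) s" "[]" x "[]"] by simp

text \<open>The products \<open>f i h\<^sub>2 f j\<close> are independent: sandwiching a combination of them between
  \<open>h\<^sub>2\<close> yields partial traces, which form a non-degenerate pairing.\<close>

theorem P_2_card:
  fixes f :: "'i::finite \<Rightarrow> 'v"
  assumes d: "\<delta> \<noteq> 0" and nd: nondegenerate and P1: "P 1 s \<subseteq> span {eval 1 s []}"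
    and f: "indep f" "\<And>i. f i \<in> P 2 s" and dim: "dim (P 3 s) > 0"
  shows "card (UNIV :: 'i set) * card (UNIV :: 'i set) \<le> dim (P 3 s)"
proof -
  define mu where "mu = (\<lambda>y x. SOME c. eval 1 s [(1, LCup), (0, LBox 2 y), (0, LBox 2 x), (1, LCap)] = c *s eval 1 s [])"
  have mu: "eval 1 s [(1, LCup), (0, LBox 2 y), (0, LBox 2 x), (1, LCap)] = mu y x *s eval 1 s []"
    if "x \<in> P 2 s" "y \<in> P 2 s" for x y
  proof -
    have "eval 1 s [(1, LCup), (0, LBox 2 y), (0, LBox 2 x), (1, LCap)] \<in> span {eval 1 s []}"
      using P1 eval_in_P[of 1 s "[(1, LCup), (0, LBox 2 y), (0, LBox 2 x), (1, LCap)]"] that by auto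
    then have "\<exists>c. eval 1 s [(1, LCup), (0, LBox 2 y), (0, LBox 2 x), (1, LCap)] = c *s eval 1 s []"
      by (auto simp: span_singleton)
    then show ?thesis unfolding mu_def by (rule someI_ex)
  qed
  have cl: "right_closure Z 2 s (box_mult Z 2 s y x) = (mu y x * \<delta>) *s eval 0 s []"
    if xy: "x \<in> P 2 s" "y \<in> P 2 s" for x y
  proof -
    have "right_closure Z 2 s (box_mult Z 2 s y x) =
        eval 0 s [(0, LCup), (1, LCup), (0, LBox 2 y), (0, LBox 2 x), (1, LCap), (0, LCap)]"
      using mult_word[OF xy(2,1)] by (simp add: numeral_2_eq_2)
    also have "\<dots> = mu y x *s eval 0 s [(0, LCup), (0, LCap)]"
      by (rule scalar_at[OF mu[OF xy], of 0 s "[(0, LCup)]" 2 "[(0, LCap)]" 0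
        "[(1, LCup), (0, LBox 2 y), (0, LBox 2 x), (1, LCap)]" "[]", unfolded append.simps]) (use xy in simp_all)
    finally show ?thesis using circle_eval[of s] by simp
  qed
  \<comment> \<open>By \<open>cl\<close>, a vanishing \<open>mu\<close> forces a vanishing closure,
    so non-degeneracy on \<open>P 2 s\<close> applies.\<close>
  have sep: "c i = 0" if c: "\<And>y. y \<in> P 2 s \<Longrightarrow> (\<Sum>i\<in>UNIV. c i * mu y (f i)) = 0" for c i
  proof -
    let ?x = "\<Sum>i\<in>UNIV. c i *s f i"
    have x: "?x \<in> P 2 s" using f subspace_P by (auto intro!: subspace_sum subspace_scale)
    have "right_closure Z 2 s (box_mult Z 2 s y ?x) = 0" if y: "y \<in> P 2 s" for y
    proof -
      have lin: "linear_on (P 2 s) (\<lambda>x. eval 1 s [(1, LCup), (0, LBox 2 y), (0, LBox 2 x), (1, LCap)])"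
        using linear_on_eval[of 1 s "[(1, LCup), (0, LBox 2 y)]" 3 "[(1, LCap)]" 0 2] y by simp
      have "mu y ?x *s eval 1 s [] = (\<Sum>i\<in>UNIV. c i *s (mu y (f i) *s eval 1 s []))"
        using linear_on_sum[OF lin subspace_P, of UNIV f c, OF f(2)] mu[OF x y] mu[OF f(2) y] by simp
      also have "\<dots> = (\<Sum>i\<in>UNIV. c i * mu y (f i)) *s eval 1 s []" by (simp add: scale_sum_left)
      finally have "mu y ?x = 0" using c[OF y] one_nonzero[OF d, of s] by simp
      then show ?thesis using cl[OF x y] by simp
    qed
    then have "?x = 0" by (intro nondegenerate_left[OF nd x]) auto
    then show ?thesis by (rule indepD[OF f(1)])
  qed
  let ?e = "\<lambda>x z. eval 3 s [(0, LBox 2 x), (1, LCap), (1, LCup), (0, LBox 2 z)]"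
  let ?g = "\<lambda>p. case p of (j, i) \<Rightarrow> ?e (f i) (f j)"
  let ?C = "\<lambda>y z. eval 2 s [(1, LCup), (0, LBox 2 y), (0, LBox 3 z), (2, LCap)]"
  have gP: "?g p \<in> P 3 s" for p using f(2) by (cases p) simp
  have C: "?C y (?e x z) = mu y x *s z" if x: "x \<in> P 2 s" "y \<in> P 2 s" "z \<in> P 2 s" for x y z
  proof -
    have "?C y (?e x z) = eval 2 s [(1, LCup), (0, LBox 2 y), (0, LBox 2 x), (1, LCap), (1, LCup), (0, LBox 2 z), (2, LCap)]"
      by (rule word_box'[OF _ _ _ _ _ refl, where U = "[(1, LCup), (0, LBox 2 y)]" and V = "[(2, LCap)]" and l = 4
        and S' = "[(0, LBox 2 x), (1, LCap), (1, LCup), (0, LBox 2 z)]", unfolded append.simps]) (use x in simp_all)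
    also have "\<dots> = mu y x *s eval 2 s [(1, LCup), (0, LBox 2 z), (2, LCap)]"
      by (rule scalar_at[OF mu[OF x(1,2)], of 2 s "[]" 2 "[(1, LCup), (0, LBox 2 z), (2, LCap)]" 0
        "[(1, LCup), (0, LBox 2 y), (0, LBox 2 x), (1, LCap)]" "[]", unfolded append.simps]) (use x in simp_all)
    finally show ?thesis using pull_out_box[OF x(3)] eval_single[OF x(3)] by simp
  qed
  have "indep ?g" unfolding indep_def
  proof (intro allI impI)
    fix c and p :: "'i \<times> 'i" assume eq: "(\<Sum>p\<in>UNIV. c p *s ?g p) = 0"
    obtain i k where p: "p = (i, k)" by (cases p)
    have "c (i, k) = 0"
    proof (rule tensor_core[where Y = "P 2 s" and C = ?C and V = "P 3 s" and f = f and z = 0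
        and t = "\<lambda>k y. mu y (f k)" and g = ?g, OF _ subspace_P gP _ f(1)])
      show lin: "linear_on (P 3 s) (?C y)" if "y \<in> P 2 s" for y
        using linear_on_eval[of 2 s "[(1, LCup), (0, LBox 2 y)]" 4 "[(2, LCap)]" 0 3] that by simp
      show "?C y (?g (i, k)) = mu y (f k) *s f i" if "y \<in> P 2 s" for y i k
        using C[OF f(2) that f(2)] by simp
      show "c k = 0" if "\<And>y. y \<in> P 2 s \<Longrightarrow> (\<Sum>k\<in>UNIV. c k * mu y (f k)) = 0" for c k
        using sep[of c k] that by blast
      show "0 \<in> P 3 s" using subspace_0[OF subspace_P] .
      show "?C y 0 = 0" if "y \<in> P 2 s" for y
        by (rule linear_on_0[OF lin[OF that]]) (use subspace_0[OF subspace_P] in blast)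
      show "(\<Sum>p\<in>UNIV. c p *s ?g p) + 0 = 0" using eq by simp
    qed
    then show "c p = 0" by (simp add: p)
  qed
  from indep_card[OF this _ dim] gP
  have "card (UNIV :: ('i \<times> 'i) set) \<le> dim (P 3 s)" by (metis image_subsetI)
  then show ?thesis by (simp add: card_cartesian_product flip: UNIV_Times_UNIV)
qed

text \<open>A fourth independent 2-box would produce 16 independent 3-boxes by
  \<open>P_2_card\<close>. If \<open>id\<close> were a multiple of \<open>h\<close>, then
  \<open>h x = 0\<close> would force \<open>x = 0\<close>.\<close>

theorem P_2_span:
  assumes d: "\<delta> \<noteq> 0" and nd: nondegenerate and P1: "P 1 s \<subseteq> span {eval 1 s []}" and dim: "dim (P 3 s) = 15"
    and x: "x \<in> P 2 s" "x \<notin> span {eval 2 s [], eval 2 s [(0, LCap), (0, LCup)]}"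
    and hx: "eval 2 s [(0, LCap), (0, LCup), (0, LBox 2 x)] = 0"
  shows "P 2 s \<subseteq> span {eval 2 s [], eval 2 s [(0, LCap), (0, LCup)], x}"
    and "eval 2 s [] \<notin> span {eval 2 s [(0, LCap), (0, LCup)]}"
proof -
  let ?e = "eval 2 s []" and ?h = "eval 2 s [(0, LCap), (0, LCup)]"
  show e: "?e \<notin> span {?h}"
  proof
    assume "?e \<in> span {?h}"
    then obtain c where c: "?e = c *s ?h" by (auto simp: span_singleton)
    have "eval 2 s ([] @ [] @ [(0, LBox 2 x)]) = c *s eval 2 s ([] @ [(0, LCap), (0, LCup)] @ [(0, LBox 2 x)])"
      using scalar_at[OF c, of 2 s "[]" 2 "[(0, LBox 2 x)]" 0 "[]" "[(0, LCap), (0, LCup)]"] x(1) by simp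
    then have "x = 0" using eval_single[OF x(1)] hx by simp
    then show False using x(2) span_zero by simp
  qed
  let ?f2 = "case_option ?e (\<lambda>_::unit. ?h)"
  have f2: "indep ?f2"
    by (rule indep_option[OF indep_unit[OF h_nonzero[OF d]]]) (use e in simp)
  have r2: "range ?f2 = {?e, ?h}" by (auto simp: UNIV_option_conv UNIV_unit)
  let ?f3 = "case_option x ?f2"
  have f3: "indep ?f3" by (rule indep_option[OF f2]) (use x(2) r2 in simp)
  have r3: "range ?f3 = {?e, ?h, x}" using r2 by (auto simp: UNIV_option_conv UNIV_unit)
  show "P 2 s \<subseteq> span {?e, ?h, x}"
  proof (rule ccontr)
    assume "\<not> P 2 s \<subseteq> span {?e, ?h, x}"
    then obtain w where w: "w \<in> P 2 s" "w \<notin> span {?e, ?h, x}" by auto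
    let ?f4 = "case_option w ?f3"
    have f4: "indep ?f4" by (rule indep_option[OF f3]) (use w r3 in simp)
    have "?f4 i \<in> P 2 s" for i using w(1) x(1) by (auto split: option.splits)
    from P_2_card[OF d nd P1 f4 this] dim show False
      by (simp add: UNIV_option_conv UNIV_unit)
  qed
qed

lemma eval3_linear:
  assumes "x \<in> P 2 s" "y \<in> P 2 (flip s)" "z \<in> P 2 s"
  shows "linear_on (P 2 s) (\<lambda>x. eval 3 s [(0, LBox 2 x), (1, LBox 2 y), (0, LBox 2 z)])"
    "linear_on (P 2 (flip s)) (\<lambda>y. eval 3 s [(0, LBox 2 x), (1, LBox 2 y), (0, LBox 2 z)])"
    "linear_on (P 2 s) (\<lambda>z. eval 3 s [(0, LBox 2 x), (1, LBox 2 y), (0, LBox 2 z)])"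
  using linear_on_eval[of 3 s "[]" 3 "[(1, LBox 2 y), (0, LBox 2 z)]" 0 2]
    linear_on_eval[of 3 s "[(0, LBox 2 x)]" 3 "[(0, LBox 2 z)]" 1 2]
    linear_on_eval[of 3 s "[(0, LBox 2 x), (1, LBox 2 y)]" 3 "[]" 0 2] assms by simp_all

lemma eval3_span:
  assumes X: "X \<subseteq> P 2 s" "Y \<subseteq> P 2 (flip s)" and x: "x \<in> span X" "y \<in> span Y" "z \<in> span X"
    and S: "\<And>x y z. x \<in> X \<Longrightarrow> y \<in> Y \<Longrightarrow> z \<in> X \<Longrightarrow>
      eval 3 s [(0, LBox 2 x), (1, LBox 2 y), (0, LBox 2 z)] \<in> span S"
  shows "eval 3 s [(0, LBox 2 x), (1, LBox 2 y), (0, LBox 2 z)] \<in> span S"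
proof -
  have P: "x \<in> P 2 s" "y \<in> P 2 (flip s)" "z \<in> P 2 s"
    using x X span_minimal[OF _ subspace_P] by blast+
  have 1: "eval 3 s [(0, LBox 2 a), (1, LBox 2 b), (0, LBox 2 z)] \<in> span S" if "a \<in> X" "b \<in> Y" for a b
    by (rule linear_on_span[OF eval3_linear(3) subspace_P X(1) x(3)]) (use that X S P in auto)
  have 2: "eval 3 s [(0, LBox 2 a), (1, LBox 2 y), (0, LBox 2 z)] \<in> span S" if "a \<in> X" for a
    by (rule linear_on_span[OF eval3_linear(2) subspace_P X(2) x(2)]) (use that X 1 P in auto)
  show ?thesis
    by (rule linear_on_span[OF eval3_linear(1) subspace_P X(1) x(1)]) (use X 2 P in auto)
qed

end

section \<open>The Temperley-Lieb subalgebra\<close>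

definition tlw :: "bool \<Rightarrow> nat \<Rightarrow> 'v word" where
  "tlw b k = (if b then [(k, LCap), (k, LCup)] else [])"

lemma shiftw_tl: "shiftw i (tlw b 0) = tlw b i"
  by (simp add: tlw_def)

context shaded_planar_algebra
begin

lemma tl_ok: "k + 2 \<le> n \<Longrightarrow> ok n s (tlw b k) n"
  by (auto simp: tlw_def)

lemma tl_P [simp]: "eval 2 s (tlw b 0) \<in> P 2 s"
  by (intro eval_in_P tl_ok) simp

lemma tl_box:
  "ok m s U l \<Longrightarrow> ok l s V m \<Longrightarrow> k + 2 \<le> l \<Longrightarrow> (flip ^^ k) s = t \<Longrightarrow>
    eval m s (U @ (k, LBox 2 (eval 2 t (tlw b 0))) # V) = eval m s (U @ tlw b k @ V)"
  by (rule word_box'[OF _ _ _ tl_ok _ refl]) (auto simp: shiftw_tl)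

lemma tl_boxes:
  assumes "i + 2 \<le> n" "j + 2 \<le> n" "k + 2 \<le> n"
  shows "eval n s [(i, LBox 2 (eval 2 ((flip ^^ i) s) (tlw a 0))), (j, LBox 2 (eval 2 ((flip ^^ j) s) (tlw b 0))),
      (k, LBox 2 (eval 2 ((flip ^^ k) s) (tlw c 0)))] = eval n s (tlw a i @ tlw b j @ tlw c k)"
proof -
  have P: "eval 2 t (tlw a 0) \<in> P 2 t" for a t by simp
  have "eval n s ([] @ (i, LBox 2 (eval 2 ((flip ^^ i) s) (tlw a 0))) # [(j, LBox 2 (eval 2 ((flip ^^ j) s) (tlw b 0))),
      (k, LBox 2 (eval 2 ((flip ^^ k) s) (tlw c 0)))]) =
      eval n s ([] @ tlw a i @ [(j, LBox 2 (eval 2 ((flip ^^ j) s) (tlw b 0))),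
      (k, LBox 2 (eval 2 ((flip ^^ k) s) (tlw c 0)))])"
    by (rule tl_box) (use assms P in auto)
  also have "\<dots> = eval n s (tlw a i @ (j, LBox 2 (eval 2 ((flip ^^ j) s) (tlw b 0))) #
      [(k, LBox 2 (eval 2 ((flip ^^ k) s) (tlw c 0)))])"
    by simp
  also have "\<dots> = eval n s (tlw a i @ tlw b j @ [(k, LBox 2 (eval 2 ((flip ^^ k) s) (tlw c 0)))])"
    by (rule tl_box) (use assms P in \<open>auto intro: tl_ok\<close>)
  also have "\<dots> = eval n s ((tlw a i @ tlw b j) @ (k, LBox 2 (eval 2 ((flip ^^ k) s) (tlw c 0))) # [])"
    by simp
  also have "\<dots> = eval n s ((tlw a i @ tlw b j) @ tlw c k @ [])"
    by (rule tl_box) (use assms in \<open>auto simp: ok_append intro!: tl_ok exI[of _ n]\<close>)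
  finally show ?thesis by simp
qed

definition TL2 :: "shading \<Rightarrow> 'v set" where
  "TL2 s = range (\<lambda>b. eval 2 s (tlw b 0))"

text \<open>The five Temperley-Lieb diagrams on three strings.\<close>

definition TL3 :: "shading \<Rightarrow> 'v set" where
  "TL3 s = {eval 3 s [], eval 3 s [(0, LCap), (0, LCup)], eval 3 s [(1, LCap), (1, LCup)],
    eval 3 s [(0, LCap), (0, LCup), (1, LCap), (1, LCup)], eval 3 s [(1, LCap), (1, LCup), (0, LCap), (0, LCup)]}"

lemma TL2_eq: "TL2 s = {eval 2 s [], eval 2 s [(0, LCap), (0, LCup)]}"
  by (auto simp: TL2_def tlw_def)

lemma TL2_P: "TL2 s \<subseteq> P 2 s"
  by (auto simp: TL2_def)

lemma h1_square: "eval 3 s [(0, LCap), (0, LCup), (0, LCap), (0, LCup)] = \<delta> *s eval 3 s [(0, LCap), (0, LCup)]"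
  by (rule eval_circle[of 3 s "[(0, LCap)]" 1 "[(0, LCup)]" 0, unfolded append.simps]) simp_all

lemma h2_square: "eval 3 s [(1, LCap), (1, LCup), (1, LCap), (1, LCup)] = \<delta> *s eval 3 s [(1, LCap), (1, LCup)]"
  by (rule eval_circle[of 3 s "[(1, LCap)]" 1 "[(1, LCup)]" 1, unfolded append.simps]) simp_all

lemma TL3_words:
  "eval 3 s (tlw a 0 @ tlw b 1 @ tlw c 0) \<in> span (TL3 s)"
  "eval 3 s (tlw a 1 @ tlw b 0 @ tlw c 1) \<in> span (TL3 s)"
proof -
  have 1: "eval 3 s [(0, LCap), (0, LCup), (0, LCap), (0, LCup)] \<in> span (TL3 s)"
    unfolding h1_square by (intro span_scale span_base) (simp add: TL3_def)
  have 2: "eval 3 s [(1, LCap), (1, LCup), (1, LCap), (1, LCup)] \<in> span (TL3 s)"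
    unfolding h2_square by (intro span_scale span_base) (simp add: TL3_def)
  have 3: "eval 3 s [(0, LCap), (0, LCup), (1, LCap), (1, LCup), (0, LCap), (0, LCup)] \<in> span (TL3 s)"
    unfolding h1_h2_h1 by (intro span_base) (simp add: TL3_def)
  have 4: "eval 3 s [(1, LCap), (1, LCup), (0, LCap), (0, LCup), (1, LCap), (1, LCup)] \<in> span (TL3 s)"
    unfolding h2_h1_h2 by (intro span_base) (simp add: TL3_def)
  have 5: "x \<in> TL3 s \<Longrightarrow> x \<in> span (TL3 s)" for x by (rule span_base)
  show "eval 3 s (tlw a 0 @ tlw b 1 @ tlw c 0) \<in> span (TL3 s)"
    by (cases a; cases b; cases c; simp only: tlw_def if_True if_False append.simps;
        (rule 1 | rule 3 | (rule 5, simp add: TL3_def)))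
  show "eval 3 s (tlw a 1 @ tlw b 0 @ tlw c 1) \<in> span (TL3 s)"
    by (cases a; cases b; cases c; simp only: tlw_def if_True if_False append.simps;
        (rule 2 | rule 4 | (rule 5, simp add: TL3_def)))
qed

lemma TL2_mult:
  assumes "x \<in> span (TL2 t)" "y \<in> span (TL2 t)"
  shows "eval 2 t [(0, LBox 2 x), (0, LBox 2 y)] \<in> span (TL2 t)"
proof -
  have P: "x \<in> P 2 t" "y \<in> P 2 t"
    using assms TL2_P span_minimal[OF _ subspace_P] by blast+
  have base: "eval 2 t [(0, LBox 2 a), (0, LBox 2 b)] \<in> span (TL2 t)" if ab: "a \<in> TL2 t" "b \<in> TL2 t" for a b
  proof -
    have P': "a \<in> P 2 t" "b \<in> P 2 t" using ab TL2_P by auto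
    consider "a = eval 2 t []" | "b = eval 2 t []"
      | "a = eval 2 t [(0, LCap), (0, LCup)]" "b = eval 2 t [(0, LCap), (0, LCup)]"
      using ab by (auto simp: TL2_eq)
    then show ?thesis
    proof cases
      case 1
      then show ?thesis using id_mult[OF P'(2)] ab span_base by simp
    next
      case 2
      then show ?thesis using mult_id[OF P'(1)] ab span_base by simp
    next
      case 3
      have "eval 2 t [(0, LBox 2 a), (0, LBox 2 b)] = box_mult Z 2 t a b"
        using box_mult_eval[OF P'] by simp
      also have "\<dots> = \<delta> *s eval 2 t [(0, LCap), (0, LCup)]"
        unfolding 3 by (subst word_mult) (simp_all add: h_square)
      also have "\<dots> \<in> span (TL2 t)" by (intro span_scale span_base) (simp add: TL2_eq)
      finally show ?thesis .
    qed
  qed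
  have 1: "eval 2 t [(0, LBox 2 a), (0, LBox 2 y)] \<in> span (TL2 t)" if "a \<in> TL2 t" for a
    by (rule linear_on_span[OF _ subspace_P TL2_P assms(2)])
      (use linear_on_eval[of 2 t "[(0, LBox 2 a)]" 2 "[]" 0 2] base that TL2_P in auto)
  show ?thesis
    by (rule linear_on_span[OF _ subspace_P TL2_P assms(1)])
      (use linear_on_eval[of 2 t "[]" 2 "[(0, LBox 2 y)]" 0 2] 1 P in auto)
qed

lemma TL2_yang_baxter:
  assumes "x \<in> span (TL2 (flip t))" "y \<in> span (TL2 t)" "z \<in> span (TL2 (flip t))"
  shows "eval 3 t [(1, LBox 2 x), (0, LBox 2 y), (1, LBox 2 z)] \<in> span (TL3 t)"
proof -
  have P: "x \<in> P 2 (flip t)" "y \<in> P 2 t" "z \<in> P 2 (flip t)"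
    using assms TL2_P span_minimal[OF _ subspace_P] by blast+
  have TP: "a \<in> TL2 t \<Longrightarrow> a \<in> P 2 t" for a t using TL2_P by auto
  have base: "eval 3 t [(1, LBox 2 a), (0, LBox 2 b), (1, LBox 2 c)] \<in> span (TL3 t)"
    if abc: "a \<in> TL2 (flip t)" "b \<in> TL2 t" "c \<in> TL2 (flip t)" for a b c
  proof -
    obtain p q r where "a = eval 2 (flip t) (tlw p 0)" "b = eval 2 t (tlw q 0)" "c = eval 2 (flip t) (tlw r 0)"
      using abc by (auto simp: TL2_def)
    then show ?thesis using tl_boxes[of 1 3 0 1 t p q r] TL3_words(2) by simp
  qed
  have 1: "eval 3 t [(1, LBox 2 a), (0, LBox 2 b), (1, LBox 2 z)] \<in> span (TL3 t)"
    if "a \<in> TL2 (flip t)" "b \<in> TL2 t" for a b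
    by (rule linear_on_span[OF _ subspace_P TL2_P assms(3)])
      (use linear_on_eval[of 3 t "[(1, LBox 2 a), (0, LBox 2 b)]" 3 "[]" 1 2] base that TP in auto)
  have 2: "eval 3 t [(1, LBox 2 a), (0, LBox 2 y), (1, LBox 2 z)] \<in> span (TL3 t)" if "a \<in> TL2 (flip t)" for a
    by (rule linear_on_span[OF _ subspace_P TL2_P assms(2)])
      (use linear_on_eval[of 3 t "[(1, LBox 2 a)]" 3 "[(1, LBox 2 z)]" 0 2] 1 that TP P in auto)
  show ?thesis
    by (rule linear_on_span[OF _ subspace_P TL2_P assms(1)])
      (use linear_on_eval[of 3 t "[]" 3 "[(0, LBox 2 y), (1, LBox 2 z)]" 1 2] 2 P in auto)
qed

lemma TL3_sub: "TL3 t \<subseteq> {eval 3 t [(0, LBox 2 x'), (1, LBox 2 y'), (0, LBox 2 z')] | x' y' z'.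
        x' \<in> span (TL2 t) \<and> y' \<in> span (TL2 (flip t)) \<and> z' \<in> span (TL2 t)}"
proof -
  have "eval 3 t (tlw a 0 @ tlw b 1 @ tlw c 0) \<in> {eval 3 t [(0, LBox 2 x'), (1, LBox 2 y'), (0, LBox 2 z')] | x' y' z'.
        x' \<in> span (TL2 t) \<and> y' \<in> span (TL2 (flip t)) \<and> z' \<in> span (TL2 t)}" for a b c
    unfolding mem_Collect_eq using tl_boxes[of 0 3 1 0 t a b c]
    by (intro exI[of _ "eval 2 t (tlw a 0)"] exI[of _ "eval 2 (flip t) (tlw b 0)"]
        exI[of _ "eval 2 t (tlw c 0)"] conjI span_base) (simp_all add: TL2_def)
  from this[of False False False] this[of True False False] this[of False True False]
    this[of True True False] this[of False True True]
  show ?thesis unfolding TL3_def tlw_def by simp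
qed

lemma TL2_cap:
  assumes "x \<in> span (TL2 t)"
  shows "eval 1 t [(1, LCup), (0, LBox 2 x), (1, LCap)] \<in> span {eval 1 t []}"
proof (rule linear_on_span[OF _ subspace_P TL2_P assms])
  show "linear_on (P 2 t) (\<lambda>x. eval 1 t [(1, LCup), (0, LBox 2 x), (1, LCap)])"
    using linear_on_eval[of 1 t "[(1, LCup)]" 3 "[(1, LCap)]" 0 2] by simp
  fix b assume "b \<in> TL2 t"
  then consider "b = eval 2 t []" | "b = eval 2 t [(0, LCap), (0, LCup)]" by (auto simp: TL2_eq)
  then show "eval 1 t [(1, LCup), (0, LBox 2 b), (1, LCap)] \<in> span {eval 1 t []}"
  proof cases
    case 1
    have "eval 1 t [(1, LCup), (0, LBox 2 b), (1, LCap)] = eval 1 t [(1, LCup), (1, LCap)]"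
      by (rule id_box[where U = "[(1, LCup)]" and V = "[(1, LCap)]" and l = 3, unfolded append.simps])
        (use 1 in simp_all)
    also have "\<dots> = \<delta> *s eval 1 t []"
      by (rule eval_circle[of 1 t "[]" 1 "[]" 1, unfolded append.simps]) simp_all
    finally show ?thesis by (simp add: span_scale span_base)
  next
    case 2
    have "eval 1 t [(1, LCup), (0, LBox 2 b), (1, LCap)] = eval 1 t [(1, LCup), (0, LCap), (0, LCup), (1, LCap)]"
      by (rule h_box[where U = "[(1, LCup)]" and V = "[(1, LCap)]" and l = 3, unfolded append.simps])
        (use 2 in simp_all)
    also have "\<dots> = eval 1 t [(0, LCup), (1, LCap)]"
      by (rule eval_zr[of 1 t "[]" 1 "[(0, LCup), (1, LCap)]" 0 1, unfolded append.simps]) simp_all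
    also have "\<dots> = eval 1 t []"
      by (rule eval_zl[of 1 t "[]" 1 "[]" 0 1, unfolded append.simps]) simp_all
    finally show ?thesis by (simp add: span_base)
  qed
qed

lemma brick_algebra_TL: "brick_algebra scale P Z \<delta> (\<lambda>t. span (TL2 t))"
proof unfold_locales
  fix t show "span (TL2 t) \<subseteq> P 2 t" using TL2_P subspace_P by (rule span_minimal)
  show "eval 2 t [] \<in> span (TL2 t)" "eval 2 t [(0, LCap), (0, LCup)] \<in> span (TL2 t)"
    by (auto simp: TL2_eq intro!: span_base)
  fix x y assume xy: "x \<in> span (TL2 t)" 
  show "eval 1 t [(1, LCup), (0, LBox 2 x), (1, LCap)] \<in> span {eval 1 t []}" by (rule TL2_cap[OF xy])
  assume "y \<in> span (TL2 t)"
  with xy show "eval 2 t [(0, LBox 2 x), (0, LBox 2 y)] \<in> span (TL2 t)" by (rule TL2_mult)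
next
  fix x t y z assume "x \<in> span (TL2 (flip t))" "y \<in> span (TL2 t)" "z \<in> span (TL2 (flip t))"
  from TL2_yang_baxter[OF this]
  show "eval 3 t [(1, LBox 2 x), (0, LBox 2 y), (1, LBox 2 z)] \<in>
      span {eval 3 t [(0, LBox 2 x'), (1, LBox 2 y'), (0, LBox 2 z')] | x' y' z'.
        x' \<in> span (TL2 t) \<and> y' \<in> span (TL2 (flip t)) \<and> z' \<in> span (TL2 t)}"
    using span_mono[OF TL3_sub] by blast
qed

text \<open>Scalar 1-boxes provide \<open>Q_cap\<close>. The rest translates
  \<open>yang_baxter\<close> from operations on boxes into words.\<close>

lemma brick_algebra_P_2:
  assumes yb: yang_baxter and P1: "\<And>s. P 1 s \<subseteq> span {eval 1 s []}"
  shows "brick_algebra scale P Z \<delta> (P 2)"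
proof unfold_locales
  fix t x assume "x \<in> P 2 t"
  then have "eval 1 t [(1, LCup), (0, LBox 2 x), (1, LCap)] \<in> P 1 t" by simp
  then show "eval 1 t [(1, LCup), (0, LBox 2 x), (1, LCap)] \<in> span {eval 1 t []}" using P1 by blast
next
  fix x t y z assume xyz: "x \<in> P 2 (flip t)" "y \<in> P 2 t" "z \<in> P 2 (flip t)"
  have L: "box_mult Z 3 t (box_mult Z 3 t (add_left Z 2 t x) (add_right Z 2 t y)) (add_left Z 2 t z) =
      eval 3 t [(1, LBox 2 x), (0, LBox 2 y), (1, LBox 2 z)]"
    if "x \<in> P 2 (flip t)" "y \<in> P 2 t" "z \<in> P 2 (flip t)" for x y z
    using that by (simp add: add_left_eval add_right_eval word_mult)
  have R: "box_mult Z 3 t (box_mult Z 3 t (add_right Z 2 t x) (add_left Z 2 t y)) (add_right Z 2 t z) =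
      eval 3 t [(0, LBox 2 x), (1, LBox 2 y), (0, LBox 2 z)]"
    if "x \<in> P 2 t" "y \<in> P 2 (flip t)" "z \<in> P 2 t" for x y z
    using that by (simp add: add_left_eval add_right_eval word_mult)
  have S: "{box_mult Z 3 t (box_mult Z 3 t (add_right Z 2 t x') (add_left Z 2 t y')) (add_right Z 2 t z')
            | x' y' z'. x' \<in> P 2 t \<and> y' \<in> P 2 (flip t) \<and> z' \<in> P 2 t} =
      {eval 3 t [(0, LBox 2 x'), (1, LBox 2 y'), (0, LBox 2 z')] | x' y' z'.
        x' \<in> P 2 t \<and> y' \<in> P 2 (flip t) \<and> z' \<in> P 2 t}"
    using R by (intro Collect_cong) metis
  show "eval 3 t [(1, LBox 2 x), (0, LBox 2 y), (1, LBox 2 z)] \<in>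
      span {eval 3 t [(0, LBox 2 x'), (1, LBox 2 y'), (0, LBox 2 z')] | x' y' z'.
        x' \<in> P 2 t \<and> y' \<in> P 2 (flip t) \<and> z' \<in> P 2 t}"
    using yb[unfolded yang_baxter_def, rule_format, OF xyz] unfolding S L[OF xyz] .
qed auto

end

context brick_algebra
begin

text \<open>Each tangle in the spanning set of \<open>generated_by\<close> is a word in cups, caps
  and copies of \<open>R\<close>, to which \<open>eval_3_span\<close> applies.\<close>

theorem P_3_bricks:
  assumes R: "generated_by R 2 Plus" "R \<in> Q Plus"
  shows "P 3 s \<subseteq> span {eval 3 s [(0, LBox 2 x), (1, LBox 2 y), (0, LBox 2 z)] | x y z.
    x \<in> Q s \<and> y \<in> Q (flip s) \<and> z \<in> Q s}" (is "_ \<subseteq> span ?S")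
proof -
  have "Z 3 s T (\<lambda>_. R) \<in> span ?S"
    if T: "is_tangle 3 T" "\<forall>(i, n', t')\<in>inputs s T. n' = 2 \<and> t' = Plus" for T
  proof -
    have RP: "R \<in> P 2 Plus" using R unfolding generated_by_def by blast
    have in_T: "R \<in> P l t" if "(i, l, t) \<in> inputs s T" for i l t using that T(2) RP by auto
    have ok: "ok 3 s (fill (\<lambda>_. R) T) 3"
      using T(1) in_T by (auto simp: ok_fill is_tangle_def)
    have "fill (\<lambda>_. R) T \<in> letters s"
      unfolding letters_def mem_Collect_eq
    proof
      fix a assume "a \<in> set (fill (\<lambda>_. R) T)"
      then obtain k e where e: "(k, e) \<in> set T" and a: "a = (k, fill1 (\<lambda>_. R) e)"
        by (auto simp: fill_def)
      have "n = 2 \<and> (flip ^^ k) s = Plus" if "e = Box i n" for i n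
      proof -
        have "(i, n, (flip ^^ k) s) \<in> inputs s T" using e that by (auto simp: inputs_def)
        then show ?thesis using T(2) by auto
      qed
      then show "case a of (k, x) \<Rightarrow> x = LCup \<or> x = LCap \<or> (\<exists>v\<in>Q ((flip ^^ k) s). x = LBox 2 v)"
        using R(2) by (cases e) (auto simp: a)
    qed
    from eval_3_span[OF this ok] show ?thesis using Z_eq_eval[OF T(1) in_T] by simp
  qed
  then have "{Z 3 s T (\<lambda>_. R) | T. is_tangle 3 T \<and> (\<forall>(i, n', t') \<in> inputs s T. n' = 2 \<and> t' = Plus)} \<subseteq> span ?S"
    by auto
  then have "span {Z 3 s T (\<lambda>_. R) | T. is_tangle 3 T \<and> (\<forall>(i, n', t') \<in> inputs s T. n' = 2 \<and> t' = Plus)} \<subseteq> span ?S"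
    by (rule span_minimal) simp
  then show ?thesis using R(1) unfolding generated_by_def by blast
qed

end

context shaded_planar_algebra
begin

text \<open>If \<open>R\<close> were a combination of \<open>id\<close> and \<open>h\<close>, all
  bricks could be taken from the Temperley-Lieb part, and five diagrams would span a space of
  dimension 15.\<close>

theorem generator_not_TL:
  assumes R: "generated_by R 2 Plus" and dim: "dim (P 3 Plus) = 15"
  shows "R \<notin> span {eval 2 Plus [], eval 2 Plus [(0, LCap), (0, LCup)]}"
proof
  assume R2: "R \<in> span {eval 2 Plus [], eval 2 Plus [(0, LCap), (0, LCup)]}"
  interpret brick_algebra scale P Z \<delta> "\<lambda>t. span (TL2 t)" by (rule brick_algebra_TL)
  have "eval 3 Plus [(0, LBox 2 x), (1, LBox 2 y), (0, LBox 2 z)] \<in> span (TL3 Plus)"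
    if xyz: "x \<in> span (TL2 Plus)" "y \<in> span (TL2 (flip Plus))" "z \<in> span (TL2 Plus)" for x y z
  proof (rule eval3_span[OF TL2_P TL2_P xyz])
    fix a b c assume "a \<in> TL2 Plus" "b \<in> TL2 (flip Plus)" "c \<in> TL2 Plus"
    then obtain p q r where "a = eval 2 Plus (tlw p 0)" "b = eval 2 (flip Plus) (tlw q 0)" "c = eval 2 Plus (tlw r 0)"
      by (auto simp: TL2_def)
    then show "eval 3 Plus [(0, LBox 2 a), (1, LBox 2 b), (0, LBox 2 c)] \<in> span (TL3 Plus)"
      using tl_boxes[of 0 3 1 0 Plus p q r] TL3_words(1) by simp
  qed
  then have S: "{eval 3 Plus [(0, LBox 2 x), (1, LBox 2 y), (0, LBox 2 z)] | x y z.
      x \<in> span (TL2 Plus) \<and> y \<in> span (TL2 (flip Plus)) \<and> z \<in> span (TL2 Plus)} \<subseteq> span (TL3 Plus)"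
    by auto
  have "P 3 Plus \<subseteq> span (TL3 Plus)"
    by (rule order_trans[OF P_3_bricks[OF R R2[folded TL2_eq]] span_minimal[OF S subspace_span]])
  moreover have "TL3 Plus = set [eval 3 Plus [], eval 3 Plus [(0, LCap), (0, LCup)], eval 3 Plus [(1, LCap), (1, LCup)],
      eval 3 Plus [(0, LCap), (0, LCup), (1, LCap), (1, LCup)], eval 3 Plus [(1, LCap), (1, LCup), (0, LCap), (0, LCup)]]"
    by (simp add: TL3_def)
  then have "card (TL3 Plus) \<le> 5" using card_length[of "[eval 3 Plus [], eval 3 Plus [(0, LCap), (0, LCup)],
      eval 3 Plus [(1, LCap), (1, LCup)], eval 3 Plus [(0, LCap), (0, LCup), (1, LCap), (1, LCup)],
      eval 3 Plus [(1, LCap), (1, LCup), (0, LCap), (0, LCup)]]"] by simp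
  moreover have "finite (TL3 Plus)" by (simp add: TL3_def)
  ultimately show False using dim_le_card[of "P 3 Plus" "TL3 Plus"] dim by simp
qed

end

text \<open>A repetition or a linear dependence in the list would leave a spanning set with fewer
  than \<open>dim V\<close> vectors.\<close>

lemma (in vector_space) basis_independent:
  assumes "V \<subseteq> span (set bs)" "length bs = dim V"
  shows "distinct bs \<and> independent (set bs)"
proof -
  have "dim V \<le> card (set bs)" using assms by (intro dim_le_card) auto
  then have card: "card (set bs) = length bs" using assms(2) card_length[of bs] by simp
  have "independent (set bs)"
  proof
    assume "dependent (set bs)"
    then obtain b where b: "b \<in> set bs" "b \<in> span (set bs - {b})" by (auto simp: dependent_def)
    then have "V \<subseteq> span (set bs - {b})" using assms(1) span_redundant[OF b(2)] by (simp add: insert_absorb)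
    then have "dim V \<le> card (set bs - {b})" by (intro dim_le_card) auto
    moreover have "card (set bs - {b}) < card (set bs)" using b(1) by (intro card_Diff1_less) auto
    ultimately show False using card assms(2) by simp
  qed
  then show ?thesis using card card_distinct by blast
qed

section \<open>The algebra of 3-boxes\<close>

text \<open>The facts about \<open>P 3\<close> that the comparison of coefficients uses, without
  diagrams. The trace enters as a linear functional with a table of values; the product is total and
  always lands in \<open>V\<close>, so rewriting meets few membership conditions.\<close>

locale three_box = vector_space scale
  for scale :: "complex \<Rightarrow> 'v::ab_group_add \<Rightarrow> 'v" (infixr "*s" 75) +
  fixes V :: "'v set" and mul :: "'v \<Rightarrow> 'v \<Rightarrow> 'v" (infixr "\<odot>" 80) and tr :: "'v \<Rightarrow> complex"
    and \<delta> a a' A B C D E F G :: complex and R1 F2 h1 h2 one :: 'v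
  assumes subspace_V: "subspace V" and dim_V: "dim V = 15" and delta: "\<delta> \<noteq> 0"
    and mul_closed: "x \<odot> y \<in> V"
    and mul_add: "(x + y) \<odot> z = x \<odot> z + y \<odot> z" "x \<odot> (y + z) = x \<odot> y + x \<odot> z"
    and mul_scale: "(c *s x) \<odot> z = c *s (x \<odot> z)" "x \<odot> (c *s z) = c *s (x \<odot> z)"
    and assoc: "(x \<odot> y) \<odot> z = x \<odot> y \<odot> z"
    and atoms: "R1 \<in> V" "F2 \<in> V" "h1 \<in> V" "h2 \<in> V" "one \<in> V"
    and unit: "x \<in> V \<Longrightarrow> one \<odot> x = x" "x \<in> V \<Longrightarrow> x \<odot> one = x"
    and h1_h1: "h1 \<odot> h1 = \<delta> *s h1" and h2_h2: "h2 \<odot> h2 = \<delta> *s h2"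
    and h1_h2_h1: "h1 \<odot> h2 \<odot> h1 = h1" and h2_h1_h2: "h2 \<odot> h1 \<odot> h2 = h2"
    and zeros: "h1 \<odot> R1 = 0" "R1 \<odot> h1 = 0" "h2 \<odot> F2 = 0" "F2 \<odot> h2 = 0"
    and R1_R1: "R1 \<odot> R1 = a *s R1 + one - (1 / \<delta>) *s h1"
    and F2_F2: "F2 \<odot> F2 = a' *s F2 + one - (1 / \<delta>) *s h2"
    and slide_left: "h1 \<odot> h2 \<odot> R1 = h1 \<odot> F2" and slide_right: "R1 \<odot> h2 \<odot> h1 = F2 \<odot> h1"
    and spanning: "V \<subseteq> span {x \<odot> y \<odot> z | x y z. x \<in> {one, h1, R1} \<and> y \<in> {one, h2, F2} \<and> z \<in> {one, h1, R1}}"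
    and star: "R1 \<odot> F2 \<odot> R1 = A *s h2 + B *s h1 + C *s (one + h1 \<odot> h2 + h2 \<odot> h1)
           + D *s (R1 + h1 \<odot> F2 + F2 \<odot> h1) + E *s (F2 + R1 \<odot> h2 + h2 \<odot> R1)
           + F *s (R1 \<odot> h2 \<odot> R1 + F2 \<odot> R1 + R1 \<odot> F2) + G *s (F2 \<odot> R1 \<odot> F2)"
    and tr_linear: "tr (x + y) = tr x + tr y" "tr (c *s x) = c * tr x"
    and tr_one: "tr one = \<delta> ^ 3" and tr_TL: "tr h1 = \<delta>\<^sup>2" "tr h2 = \<delta>\<^sup>2" "tr (h1 \<odot> h2) = \<delta>" "tr (h2 \<odot> h1) = \<delta>"
    and tr_zero: "tr R1 = 0" "tr F2 = 0" "tr (h1 \<odot> F2) = 0" "tr (F2 \<odot> h1) = 0" "tr (R1 \<odot> h2) = 0"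
      "tr (h2 \<odot> R1) = 0" "tr (F2 \<odot> R1) = 0" "tr (R1 \<odot> F2) = 0" "tr (R1 \<odot> F2 \<odot> R1) = 0"
    and tr_R1_h2_R1: "tr (R1 \<odot> h2 \<odot> R1) = \<delta>\<^sup>2 - 1"
    and nondegenerate: "w \<in> V \<Longrightarrow> (\<And>z. z \<in> V \<Longrightarrow> tr (w \<odot> z) = 0) \<Longrightarrow> w = 0"
begin

lemma mul_minus: "(- x) \<odot> z = - (x \<odot> z)" "x \<odot> (- z) = - (x \<odot> z)"
  using mul_scale(1)[of "- 1" x z] mul_scale(2)[of x "- 1" z] by simp_all

lemma mul_diff: "(x - y) \<odot> z = x \<odot> z - y \<odot> z" "x \<odot> (y - z) = x \<odot> y - x \<odot> z"
  using mul_add(1)[of x "- y" z] mul_add(2)[of x y "- z"] by (simp_all add: mul_minus)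

lemma mul_0: "0 \<odot> x = 0" "x \<odot> 0 = 0"
  using mul_diff(1)[of 0 0 x] mul_diff(2)[of x 0 0] by simp_all

lemmas mul_linear = mul_add mul_scale mul_diff mul_minus mul_0

lemma unit_simps: "one \<odot> x \<odot> y = x \<odot> y" "one \<odot> one = one"
  "one \<odot> R1 = R1" "one \<odot> F2 = F2" "one \<odot> h1 = h1" "one \<odot> h2 = h2"
  "R1 \<odot> one = R1" "F2 \<odot> one = F2" "h1 \<odot> one = h1" "h2 \<odot> one = h2"
  by (simp_all add: unit atoms mul_closed)

lemma unit_inner: "x \<odot> one \<odot> y = x \<odot> y" if "x \<in> {R1, F2, h1, h2}"
  using that atoms unit assoc[of x one y] by auto

text \<open>Products are associated to the right, so a rule for \<open>x y\<close> must also apply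
  when the word continues; this lemma and \<open>ext3\<close> supply the versions with a
  tail.\<close>

lemma ext: "x \<odot> y = z \<Longrightarrow> x \<odot> y \<odot> w = z \<odot> w"
  by (simp flip: assoc)

lemma ext3: "x \<odot> y \<odot> u = z \<Longrightarrow> x \<odot> y \<odot> u \<odot> w = z \<odot> w"
  by (simp flip: assoc)

lemma h2_h1_F2: "h2 \<odot> h1 \<odot> F2 = h2 \<odot> R1"
  using ext3[OF h2_h1_h2, of R1] slide_left by simp

lemma F2_h1_h2: "F2 \<odot> h1 \<odot> h2 = R1 \<odot> h2"
proof -
  have "F2 \<odot> h1 \<odot> h2 = (R1 \<odot> h2 \<odot> h1) \<odot> h2" using slide_right assoc by simp
  then show ?thesis by (simp add: assoc h2_h1_h2)
qed

text \<open>Next to \<open>h1\<close>, the box \<open>F2\<close> can be rewritten through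
  \<open>h2 R1\<close>, which brings two copies of \<open>R1\<close> together for the quadratic
  relation. The next three lemmas are variants for the other side and for \<open>F2\<close>.\<close>

lemma h1_F2_R1: "h1 \<odot> F2 \<odot> R1 = a *s (h1 \<odot> F2) + h1 \<odot> h2 - (1 / \<delta>) *s h1"
proof -
  have "h1 \<odot> F2 \<odot> R1 = h1 \<odot> h2 \<odot> R1 \<odot> R1" using ext3[OF slide_left, of R1] assoc by metis
  then show ?thesis by (simp add: assoc R1_R1 mul_linear slide_left h1_h2_h1 unit_simps)
qed

lemma R1_F2_h1: "R1 \<odot> F2 \<odot> h1 = a *s (F2 \<odot> h1) + h2 \<odot> h1 - (1 / \<delta>) *s h1"
proof -
  have "R1 \<odot> F2 \<odot> h1 = R1 \<odot> R1 \<odot> h2 \<odot> h1" using slide_right by simp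
  then show ?thesis unfolding ext[OF R1_R1] by (simp add: mul_linear slide_right h1_h2_h1 unit_simps)
qed

lemma h2_R1_F2: "h2 \<odot> R1 \<odot> F2 = a' *s (h2 \<odot> R1) + h2 \<odot> h1 - (1 / \<delta>) *s h2"
proof -
  have "h2 \<odot> R1 \<odot> F2 = h2 \<odot> h1 \<odot> F2 \<odot> F2" using ext3[OF h2_h1_F2, of F2] assoc by metis
  then show ?thesis by (simp add: assoc F2_F2 mul_linear h2_h1_F2 h2_h1_h2 unit_simps)
qed

lemma F2_R1_h2: "F2 \<odot> R1 \<odot> h2 = a' *s (R1 \<odot> h2) + h1 \<odot> h2 - (1 / \<delta>) *s h2"
proof -
  have "F2 \<odot> R1 \<odot> h2 = F2 \<odot> F2 \<odot> h1 \<odot> h2" using F2_h1_h2 by simp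
  then show ?thesis unfolding ext[OF F2_F2] by (simp add: mul_linear F2_h1_h2 h2_h1_h2 unit_simps)
qed

lemma h1_F2_h1: "h1 \<odot> F2 \<odot> h1 = 0"
  using ext3[OF slide_left, of h1] ext3[of h1 h2 R1 "h1 \<odot> F2" h1] by (simp add: slide_left zeros mul_0 assoc)

lemma h2_R1_h2: "h2 \<odot> R1 \<odot> h2 = 0"
  using ext3[OF h2_h1_F2, of h2] by (simp add: zeros mul_0 assoc)

lemma F2_h1_F2: "F2 \<odot> h1 \<odot> F2 = R1 \<odot> h2 \<odot> R1"
proof -
  have "F2 \<odot> h1 \<odot> F2 = (R1 \<odot> h2 \<odot> h1) \<odot> F2" using slide_right assoc by simp
  then show ?thesis by (simp add: assoc h2_h1_F2)
qed

lemmas base_rules = h1_h1 h2_h2 zeros R1_R1 F2_F2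
lemmas long_rules = h1_h2_h1 h2_h1_h2 slide_left slide_right h2_h1_F2 F2_h1_h2 h1_F2_R1 R1_F2_h1
  h2_R1_F2 F2_R1_h2 h1_F2_h1 h2_R1_h2 F2_h1_F2

text \<open>No rule rewrites \<open>R1 F2 R1\<close> or \<open>F2 R1 F2\<close>; trading one for the
  other is left to \<open>star\<close>.\<close>

lemmas rules = assoc mul_linear unit_simps unit_inner base_rules base_rules[THEN ext] long_rules long_rules[THEN ext3]

text \<open>The diagrams on the right of \<open>star\<close> other than
  \<open>F2 R1 F2\<close>.\<close>

definition lower :: "'v list" where
  "lower = [one, h1, h2, h1 \<odot> h2, h2 \<odot> h1, R1, F2, h1 \<odot> F2, F2 \<odot> h1, R1 \<odot> h2, h2 \<odot> R1,
    R1 \<odot> h2 \<odot> R1, F2 \<odot> R1, R1 \<odot> F2]"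

lemma lower_mem:
  assumes "set lower \<subseteq> W"
  shows "one \<in> W" "h1 \<in> W" "h2 \<in> W" "h1 \<odot> h2 \<in> W" "h2 \<odot> h1 \<in> W" "R1 \<in> W" "F2 \<in> W"
    "h1 \<odot> F2 \<in> W" "F2 \<odot> h1 \<in> W" "R1 \<odot> h2 \<in> W" "h2 \<odot> R1 \<in> W" "R1 \<odot> h2 \<odot> R1 \<in> W"
    "F2 \<odot> R1 \<in> W" "R1 \<odot> F2 \<in> W"
  using assms by (simp_all add: lower_def)

text \<open>Of the 27 products in \<open>spanning\<close>, \<open>R1 F2 R1\<close> alone is not
  reduced to \<open>lower\<close> by \<open>rules\<close>.\<close>

lemma spanning_T: "V \<subseteq> span (insert (R1 \<odot> F2 \<odot> R1) (set lower))"
proof (rule order_trans[OF spanning span_minimal[OF subsetI subspace_span]])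
  let ?S = "span (insert (R1 \<odot> F2 \<odot> R1) (set lower))"
  fix w assume "w \<in> {x \<odot> y \<odot> z | x y z. x \<in> {one, h1, R1} \<and> y \<in> {one, h2, F2} \<and> z \<in> {one, h1, R1}}"
  then obtain x y z where w: "w = x \<odot> y \<odot> z" and x: "x = one \<or> x = h1 \<or> x = R1"
    and y: "y = one \<or> y = h2 \<or> y = F2" and z: "z = one \<or> z = h1 \<or> z = R1" by blast
  have "insert (R1 \<odot> F2 \<odot> R1) (set lower) \<subseteq> ?S" by (rule span_superset)
  then have mem: "set lower \<subseteq> ?S" "R1 \<odot> F2 \<odot> R1 \<in> ?S" by auto
  show "w \<in> ?S"
    unfolding w using x y z
    by (elim disjE; simp only: rules; intro span_add span_diff span_scale span_zero mem(2) lower_mem[OF mem(1)])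
qed

text \<open>Without the last term of \<open>star\<close>, 14 elements would span a space of
  dimension 15.\<close>

lemma G_nonzero: "G \<noteq> 0"
proof
  assume G: "G = 0"
  have "R1 \<odot> F2 \<odot> R1 \<in> span (set lower)"
    unfolding star G scale_zero_left
    by (intro span_add span_scale span_zero lower_mem[OF span_superset])
  then have "V \<subseteq> span (set lower)" using spanning_T span_redundant by metis
  then have "dim V \<le> card (set lower)" by (rule dim_le_card) simp
  also have "\<dots> \<le> 14" using card_length[of lower] by (simp add: lower_def)
  finally show False using dim_V by simp
qed

definition basis :: "'v list" where
  "basis = (F2 \<odot> R1 \<odot> F2) # lower"

lemma spanning_basis: "V \<subseteq> span (set basis)"
proof -
  have "set basis \<subseteq> span (set basis)" by (rule span_superset)
  then have b: "F2 \<odot> R1 \<odot> F2 \<in> span (set basis)" "set lower \<subseteq> span (set basis)"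
    by (auto simp: basis_def)
  have T: "R1 \<odot> F2 \<odot> R1 \<in> span (set basis)"
    unfolding star by (intro span_add span_scale b(1) lower_mem[OF b(2)])
  have "insert (R1 \<odot> F2 \<odot> R1) (set lower) \<subseteq> span (set basis)"
    using T b(2) by auto
  then show ?thesis using spanning_T span_minimal[OF _ subspace_span] by blast
qed

section \<open>Coordinates and comparison of coefficients\<close>

lemma functional:
  fixes v :: "nat \<Rightarrow> complex"
  obtains g :: "'v \<Rightarrow> complex" where "\<And>x y. g (x + y) = g x + g y" "\<And>c x. g (c *s x) = c * g x"
    "\<And>i. i < 15 \<Longrightarrow> g (basis ! i) = v i"
proof -
  interpret vector_space_pair scale "(*) :: complex \<Rightarrow> complex \<Rightarrow> complex"
    by unfold_locales (simp_all add: algebra_simps)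
  have l: "length basis = 15" by (simp add: basis_def lower_def)
  have B: "distinct basis" "independent (set basis)"
    using basis_independent[OF spanning_basis] l dim_V by simp_all
  obtain g where g: "Vector_Spaces.linear scale (*) g"
    and gb: "\<forall>x\<in>set basis. g x = v (THE i. i < 15 \<and> basis ! i = x)"
    using linear_independent_extend[OF B(2), of "\<lambda>x. v (THE i. i < 15 \<and> basis ! i = x)"] by blast
  have "g (basis ! i) = v i" if "i < 15" for i
  proof -
    have "(THE j. j < 15 \<and> basis ! j = basis ! i) = i"
      using that B(1) l by (intro the_equality) (auto simp: nth_eq_iff_index_eq)
    then show ?thesis using gb that l by simp
  qed
  then show ?thesis
    using that[of g] module_hom.add[OF Vector_Spaces.linear.axioms(3)[OF g]]
      module_hom.scale[OF Vector_Spaces.linear.axioms(3)[OF g]] by blast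
qed


text \<open>Linear functionals are used to read off coefficients; \<open>v\<close> lists the values on
  \<open>basis\<close>.\<close>

definition functional_with :: "(nat \<Rightarrow> complex) \<Rightarrow> ('v \<Rightarrow> complex) \<Rightarrow> bool" where
  "functional_with v g \<longleftrightarrow> (\<forall>x y. g (x + y) = g x + g y) \<and> (\<forall>x y. g (x - y) = g x - g y) \<and>
    (\<forall>c x. g (c *s x) = c * g x) \<and> g 0 = 0 \<and>
    g (F2 \<odot> R1 \<odot> F2) = v 0 \<and> g one = v 1 \<and> g h1 = v 2 \<and> g h2 = v 3 \<and>
    g (h1 \<odot> h2) = v 4 \<and> g (h2 \<odot> h1) = v 5 \<and> g R1 = v 6 \<and> g F2 = v 7 \<and>
    g (h1 \<odot> F2) = v 8 \<and> g (F2 \<odot> h1) = v 9 \<and> g (R1 \<odot> h2) = v 10 \<and> g (h2 \<odot> R1) = v 11 \<and>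
    g (R1 \<odot> h2 \<odot> R1) = v 12 \<and> g (F2 \<odot> R1) = v 13 \<and> g (R1 \<odot> F2) = v 14"

lemma functional_exists: "\<exists>g. functional_with v g"
proof -
  obtain g :: "'v \<Rightarrow> complex" where g: "\<And>x y. g (x + y) = g x + g y" "\<And>c x. g (c *s x) = c * g x"
    and gb: "\<And>i. i < 15 \<Longrightarrow> g (basis ! i) = v i"
    using functional[where v = v] by blast
  have m: "g (- x) = - g x" for x using g(2)[of "- 1" x] by simp
  have d: "g (x - y) = g x - g y" for x y using g(1)[of x "- y"] m by simp
  have z: "g 0 = 0" using d[of 0 0] by simp
  have "functional_with v g"
    unfolding functional_with_def
    using gb[of 0] gb[of 1] gb[of 2] gb[of 3] gb[of 4] gb[of 5] gb[of 6] gb[of 7] gb[of 8] gb[of 9] gb[of 10]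
        gb[of 11] gb[of 12] gb[of 13] gb[of 14]
    by (simp add: g d z basis_def lower_def numeral_eq_Suc)
  then show ?thesis by blast
qed

text \<open>\<open>h1 R1 = 0\<close> kills the left side of \<open>star\<close>. Here and in the
  next two lemmas \<open>v\<close> is an arbitrary list of coordinates, so one statement contains
  the equations for all basis elements.\<close>

lemma h1_star:
  fixes v :: "nat \<Rightarrow> complex"
  shows "A * v 4 + B * \<delta> * v 2 + C * (2 * v 2 + \<delta> * v 4) + D * \<delta> * v 8 + E * (2 * v 8)
    + F * (a * v 8 + v 4 - v 2 / \<delta>) + G * (a * (a' * v 8 + v 2 - v 4 / \<delta>) - v 8 / \<delta>) = 0"
proof -
  obtain g where "functional_with v g" using functional_exists by blast
  note g = this[unfolded functional_with_def]
  have "g (h1 \<odot> R1 \<odot> F2 \<odot> R1) = 0" by (simp add: rules g)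
  then show ?thesis unfolding star by (simp add: rules g algebra_simps)
qed

lemma h2_star:
  fixes v :: "nat \<Rightarrow> complex"
  shows "A * \<delta> * v 3 + B * v 5 + C * (2 * v 3 + \<delta> * v 5) + D * (2 * v 11) + E * \<delta> * v 11
    + F * (a' * v 11 + v 5 - v 3 / \<delta>) = a' * (a * v 11 + v 3 - v 5 / \<delta>) - v 11 / \<delta>"
proof -
  obtain g where "functional_with v g" using functional_exists by blast
  note g = this[unfolded functional_with_def]
  have "g (h2 \<odot> R1 \<odot> F2 \<odot> R1) = a' * (a * v 11 + v 3 - v 5 / \<delta>) - v 11 / \<delta>"
    by (simp add: rules g algebra_simps)
  then show ?thesis unfolding star by (simp add: rules g algebra_simps)
qed

text \<open>\<open>R1 R1 F2 R1\<close> is computed once by the quadratic relation and once by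
  \<open>star\<close>. The second way meets \<open>R1 F2 R1\<close> and \<open>R1 F2 R1 F2\<close>,
  which \<open>star\<close> expands again; \<open>T\<close> and \<open>Y\<close> are the values of
  these two.\<close>

lemma R1_star:
  fixes v :: "nat \<Rightarrow> complex"
  defines "T \<equiv> \<lambda>v. A * v 3 + B * v 2 + C * (v 1 + v 4 + v 5) + D * (v 6 + v 8 + v 9)
    + E * (v 7 + v 10 + v 11) + F * (v 12 + v 13 + v 14) + G * v 0"
  defines "Y \<equiv> \<lambda>v. B * v 8 + C * (v 7 + v 11) + D * (v 14 + (a' * v 8 + v 2 - v 4 / \<delta>) + v 12)
    + E * (a' * v 7 + v 1 - v 3 / \<delta> + (a' * v 11 + v 5 - v 3 / \<delta>))
    + F * (a' * v 12 + v 9 - v 10 / \<delta> + v 0 + (a' * v 14 + v 6 - v 10 / \<delta>))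
    + G * (a' * v 0 + v 13 - (a' * v 10 + v 4 - v 3 / \<delta>) / \<delta>)"
  shows "a * T v + v 13 - (a * v 8 + v 4 - v 2 / \<delta>) / \<delta> =
    A * v 10 + C * (v 6 + v 9) + D * (a * v 6 + v 1 - v 2 / \<delta> + (a * v 9 + v 5 - v 2 / \<delta>))
    + E * (v 14 + (a * v 10 + v 3 - v 4 / \<delta>) + v 12)
    + F * (a * v 12 + v 11 - v 8 / \<delta> + T v + (a * v 14 + v 7 - v 8 / \<delta>)) + G * Y v"
proof -
  obtain g where "functional_with v g" using functional_exists by blast
  note g = this[unfolded functional_with_def]
  have T: "g (R1 \<odot> F2 \<odot> R1) = T v"
    unfolding star T_def by (simp add: g)
  have "R1 \<odot> F2 \<odot> R1 \<odot> F2 = (R1 \<odot> F2 \<odot> R1) \<odot> F2" by (simp add: assoc)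
  then have Y: "g (R1 \<odot> F2 \<odot> R1 \<odot> F2) = Y v"
    unfolding star Y_def by (simp add: rules g)
  have "g (R1 \<odot> R1 \<odot> F2 \<odot> R1) = a * T v + v 13 - (a * v 8 + v 4 - v 2 / \<delta>) / \<delta>"
    unfolding ext[OF R1_R1] by (simp add: mul_linear unit_simps h1_F2_R1 g T)
  moreover have "g (R1 \<odot> R1 \<odot> F2 \<odot> R1) = A * v 10 + C * (v 6 + v 9)
    + D * (a * v 6 + v 1 - v 2 / \<delta> + (a * v 9 + v 5 - v 2 / \<delta>))
    + E * (v 14 + (a * v 10 + v 3 - v 4 / \<delta>) + v 12)
    + F * (a * v 12 + v 11 - v 8 / \<delta> + T v + (a * v 14 + v 7 - v 8 / \<delta>)) + G * Y v"
    unfolding star by (simp add: rules g T Y)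
  ultimately show ?thesis by simp
qed

end

lemma (in three_box) scalar_equations:
  "A + C * \<delta> + F = G * a / \<delta>"
  "a' = A * \<delta> + 2 * C - F / \<delta>"
  "a * a' - 1 / \<delta> = 2 * D + \<delta> * E + a' * F"
  "a = 2 * F + G * a'"
  "a * F + 1 = F\<^sup>2 + G\<^sup>2"
  "0 = E + F\<^sup>2 + G * (D + F * a')"
  "a * C - 1 / \<delta> = F * C - E / \<delta> - G * (D + G) / \<delta>"
  "0 = C + F * D + G * F"
  "a * D - a / \<delta> = F * D - 2 * F / \<delta> + G * (B + D * a')"
  "0 = A + F * E - 2 * G * F / \<delta> - G * a' * G / \<delta>"
proof -
  \<comment> \<open>The indicator of one position in \<open>basis\<close> reads off one
    coefficient.\<close>
  let ?u = "\<lambda>i j :: nat. if j = i then 1 else 0 :: complex"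
  show "A + C * \<delta> + F = G * a / \<delta>" using h1_star[of "?u 4"] by (simp add: algebra_simps)
  show "a' = A * \<delta> + 2 * C - F / \<delta>" using h2_star[of "?u 3"] by (simp add: algebra_simps)
  show "a * a' - 1 / \<delta> = 2 * D + \<delta> * E + a' * F" using h2_star[of "?u 11"] by (simp add: algebra_simps)
  have "G * a = G * (2 * F + G * a')" using R1_star[of "?u 0"] by (simp add: algebra_simps)
  then show "a = 2 * F + G * a'" using G_nonzero by simp
  show "a * F + 1 = F\<^sup>2 + G\<^sup>2" using R1_star[of "?u 13"] by (simp add: algebra_simps power2_eq_square)
  show "0 = E + F\<^sup>2 + G * (D + F * a')" using R1_star[of "?u 14"] by (simp add: algebra_simps power2_eq_square)
  show "a * C - 1 / \<delta> = F * C - E / \<delta> - G * (D + G) / \<delta>"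
    using R1_star[of "?u 4"] by (simp add: algebra_simps add_divide_distrib)
  show "0 = C + F * D + G * F" using R1_star[of "?u 6"] by (simp add: algebra_simps)
  show "a * D - a / \<delta> = F * D - 2 * F / \<delta> + G * (B + D * a')"
    using R1_star[of "?u 8"] by (simp add: algebra_simps)
  show "0 = A + F * E - 2 * G * F / \<delta> - G * a' * G / \<delta>"
    using R1_star[of "?u 10"] by (simp add: algebra_simps)
qed

lemma (in three_box) scalar_consequences:
  "E = - G * D - (G\<^sup>2 - 1)" "G\<^sup>2 - 1 = F * (a - F)" "C = - F * (D + G)" "(a - F) * C = 0"
  "A = G * a / \<delta> - F * E" "B = F * D / G - a' / \<delta>" "C * (\<delta> - G) = 0"
proof -
  \<comment> \<open>A variable with \<open>d * \<delta> = 1\<close> keeps all equations polynomial,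
    as the method \<open>algebra\<close> requires.\<close>
  define d where "d = inverse \<delta>"
  have d: "d * \<delta> = 1" using delta by (simp add: d_def)
  note eqs = scalar_equations[unfolded divide_inverse, folded d_def]
  show sq: "G\<^sup>2 - 1 = F * (a - F)" using eqs(5) by algebra
  show E: "E = - G * D - (G\<^sup>2 - 1)" using eqs(4,6) sq by algebra
  show C: "C = - F * (D + G)" using eqs(8) by algebra
  show "(a - F) * C = 0" using eqs(7) E by algebra
  have A: "A = G * a * d - F * E" using eqs(4,10) by algebra
  then show "A = G * a / \<delta> - F * E" by (simp add: d_def divide_inverse)
  have "G * B = F * D - G * a' * d" using eqs(4,9) by algebra
  then show "B = F * D / G - a' / \<delta>" using G_nonzero by (simp add: d_def field_simps)
  have "C * \<delta> = F * E - F" using eqs(1) A by algebra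
  then show "C * (\<delta> - G) = 0" using E C sq by algebra
qed

text \<open>The equation for \<open>D\<close> is the coefficient of \<open>h2 R1\<close> in
  \<open>h2_star\<close>, multiplied by \<open>\<delta>\<close>.\<close>

lemma (in three_box) conclusion_if_F_0:
  assumes "F = 0"
  shows "(G = 1 \<or> G = - 1) \<and> A = G * a / \<delta> \<and> B = - A \<and> C = 0 \<and>
         (G * \<delta>\<^sup>2 - 2 * \<delta>) * D = 1 - G * a\<^sup>2 * \<delta> \<and> E = - G * D \<and> F = 0 \<and> a' = G * a"
proof -
  note c = scalar_consequences[unfolded assms]
  have G2: "G\<^sup>2 = 1" using c(2) by simp
  then have G: "G = 1 \<or> G = - 1" by (simp add: power2_eq_1_iff)
  have E: "E = - G * D" using c(1) G2 by simp
  have a': "a' = G * a" using scalar_equations(4) assms G2 by algebra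
  have "a * a' * \<delta> - 1 = (2 * D + \<delta> * E) * \<delta>"
    using scalar_equations(3) delta assms by (simp add: field_simps)
  then have "(G * \<delta>\<^sup>2 - 2 * \<delta>) * D = 1 - G * a\<^sup>2 * \<delta>" using a' E by algebra
  then show ?thesis using c G E a' assms by simp
qed

text \<open>\<open>D \<noteq> - G\<close> would give \<open>C \<noteq> 0\<close>, hence
  \<open>a = F\<close>, \<open>\<delta> = G\<close> and \<open>G * G = 1\<close>, against the
  remaining equations. The other scalars follow from \<open>D = - G\<close>.\<close>

lemma (in three_box) exceptional_scalars:
  assumes "F \<noteq> 0"
  shows "D = - G" "C = 0" "E = 1" "A = G * a / \<delta> - F" "B = - F - a' / \<delta>"
    "a * (a - F) = G * (\<delta> + 1 / \<delta>) - 2"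
proof -
  note c = scalar_consequences
  show D: "D = - G"
  proof (rule ccontr)
    assume D: "D \<noteq> - G"
    then have "D + G \<noteq> 0" using add_eq_0_iff2 by blast
    then have "C \<noteq> 0" using c(3) assms by simp
    then have aF: "a = F" and dG: "\<delta> = G" using c(4,7) by auto
    have G2: "G * G = 1" using c(2) aF by (simp add: power2_eq_square)
    then have d: "inverse \<delta> = G" using dG G_nonzero by (metis inverse_unique)
    note eqs = scalar_equations(2,4)[unfolded divide_inverse d] c(5)[unfolded divide_inverse d]
    have "F * (D + G) = 0" using eqs aF dG c(1,3) G2 by algebra
    then show False using \<open>C \<noteq> 0\<close> c(3) by simp
  qed
  show "C = 0" using c(3) D by simp
  show E: "E = 1" using c(1) D by (simp add: power2_eq_square)
  show "A = G * a / \<delta> - F" using c(5) E by simp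
  show "B = - F - a' / \<delta>" using c(6) D G_nonzero by simp
  have "a * a' - 1 / \<delta> = - 2 * G + \<delta> + a' * F" using scalar_equations(3) D E by simp
  then have "G * a' * (a - F) = G * (\<delta> + 1 / \<delta>) - 2 * G\<^sup>2" by algebra
  then show "a * (a - F) = G * (\<delta> + 1 / \<delta>) - 2" using scalar_equations(4) c(2) by algebra
qed

lemma quadratic_solution:
  fixes a' :: complex
  obtains y where "y\<^sup>2 + a' * y = 1"
proof
  show "((- a' + csqrt (a'\<^sup>2 + 4)) / 2)\<^sup>2 + a' * ((- a' + csqrt (a'\<^sup>2 + 4)) / 2) = 1"
    using power2_csqrt[of "a'\<^sup>2 + 4"] by (simp add: field_simps power2_eq_square)
qed

text \<open>For a root \<open>y\<close> of \<open>y^2 + a' y = 1\<close>, the desired form of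
  \<open>F\<close> forces \<open>x = G y - F\<close>, which then satisfies
  \<open>x^2 + a x = 1\<close>. Up to the factor \<open>G\<close>, the last equation of
  \<open>exceptional_scalars\<close> becomes
  \<open>(\<delta> - x y) (\<delta> x y - 1) = 0\<close>.\<close>

lemma (in three_box) exceptional_parameters:
  assumes "F \<noteq> 0"
  obtains s t where "s \<noteq> 0" "t \<noteq> 0" "s\<^sup>2 + a * s = 1" "t\<^sup>2 + a' * t = 1" "s * t * \<delta> = 1" "F = G * t - s"
    "s + 1 / s = G * (t + 1 / t)"
proof -
  obtain y where y: "y\<^sup>2 + a' * y = 1" using quadratic_solution .
  define x where "x = G * y - F"
  have x: "x\<^sup>2 + a * x = 1"
    using y scalar_equations(4) scalar_consequences(2) unfolding x_def by algebra
  have y0: "y \<noteq> 0" and x0: "x \<noteq> 0" using x y by auto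
  have ax: "a = 1 / x - x" using x x0 by (simp add: field_simps power2_eq_square)
  have ay: "a' = 1 / y - y" using y y0 by (simp add: field_simps power2_eq_square)
  have F: "F = G * y - x" by (simp add: x_def)
  have sym: "x + 1 / x = G * (y + 1 / y)"
    using scalar_equations(4) unfolding ax ay F by algebra
  define d where "d = 1 / \<delta>"
  define u v where "u = 1 / x" and "v = 1 / y"
  have units: "d * \<delta> = 1" "u * x = 1" "v * y = 1"
    using delta x0 y0 by (simp_all add: d_def u_def v_def)
  have "(u - x) * (u - G * y) = G * (\<delta> + d) - 2"
    using exceptional_scalars(6)[OF assms] by (simp add: ax F d_def u_def algebra_simps)
  moreover have "x + u = G * (y + v)" using sym by (simp add: u_def v_def)
  ultimately have "G * ((\<delta> - x * y) * (\<delta> * x * y - 1)) = 0"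
    using units by algebra
  then consider "\<delta> * x * y = 1" | "\<delta> = x * y" using G_nonzero by auto
  then show ?thesis
  proof cases
    case 1
    then show ?thesis using that[of x y] x0 y0 x y F sym by (simp add: mult.commute mult.left_commute)
  next
    \<comment> \<open>Each quadratic has roots with product \<open>-1\<close>. Passing to the other
      roots \<open>- 1 / x\<close> and \<open>- 1 / y\<close> inverts \<open>x y\<close> and so
      leads to \<open>s t \<delta> = 1\<close> in this case as well.\<close>
    case 2
    have "(- 1 / x)\<^sup>2 + a * (- 1 / x) = 1" "(- 1 / y)\<^sup>2 + a' * (- 1 / y) = 1"
      using x0 y0 unfolding ax ay by (simp_all add: field_simps power2_eq_square)
    moreover have "F = G * (- 1 / y) - (- 1 / x)" using F sym by algebra
    moreover have "- 1 / x + 1 / (- 1 / x) = G * (- 1 / y + 1 / (- 1 / y))" using sym by simp algebra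
    ultimately show ?thesis using that[of "- 1 / x" "- 1 / y"] x0 y0 2 by simp
  qed
qed

lemma (in three_box) functional_with_values:
  assumes "\<And>x y. g (x + y) = g x + g y" "\<And>c x. g (c *s x) = c * g x"
  shows "functional_with (\<lambda>i. g (basis ! i)) g"
proof -
  have m: "g (- x) = - g x" for x using assms(2)[of "- 1" x] by simp
  have d: "g (x - y) = g x - g y" for x y using assms(1)[of x "- y"] m by simp
  show ?thesis using d[of 0 0]
    unfolding functional_with_def by (simp add: assms d basis_def lower_def numeral_eq_Suc)
qed

text \<open>Linear functionals separate points. Identities between 3-boxes thus become identities
  between complex numbers, where \<open>1 / s\<close> and \<open>1 / t\<close> can be
  simplified.\<close>

lemma (in three_box) eq_if_functionals:
  assumes "\<And>v g. functional_with v g \<Longrightarrow> g x = g y"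
  shows "x = y"
proof (rule ccontr)
  assume "x \<noteq> y"
  interpret vector_space_pair scale "(*) :: complex \<Rightarrow> complex \<Rightarrow> complex"
    by unfold_locales (simp_all add: algebra_simps)
  have "independent {x - y}" using \<open>x \<noteq> y\<close> by simp
  then obtain g where g: "Vector_Spaces.linear scale (*) g" and g1: "g (x - y) = 1"
    using linear_independent_extend[of "{x - y}" "\<lambda>_. 1"] by auto
  have "g (x + y) = g x + g y" "g (c *s x) = c * g x" for c x y
    using module_hom.add[OF Vector_Spaces.linear.axioms(3)[OF g]]
      module_hom.scale[OF Vector_Spaces.linear.axioms(3)[OF g]] by blast+
  then have f: "functional_with (\<lambda>i. g (basis ! i)) g" by (rule functional_with_values)
  then have "g (x - y) = g x - g y" unfolding functional_with_def by blast
  then show False using g1 assms[OF f] by simp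
qed

section \<open>The exceptional case\<close>

text \<open>Modulo \<open>h1\<close>, the relation for \<open>R1\<close> has the roots
  \<open>- s\<close> and \<open>1 / s\<close>, so \<open>R1 + s\<close> takes the values
  \<open>0\<close> and \<open>s + 1 / s\<close>. On \<open>h1\<close>, which \<open>R1\<close>
  annihilates, the summand \<open>t h1\<close> contributes \<open>t \<delta> = 1 / s\<close>, so
  \<open>p\<close> again takes the value \<open>s + 1 / s\<close>. This is why \<open>p\<close>
  squares to a multiple of itself; for \<open>q\<close> the roles of \<open>s\<close> and
  \<open>t\<close> are exchanged.\<close>

locale exceptional_three_box = three_box +
  fixes s t :: complex and p q :: 'a
  assumes F_nonzero: "F \<noteq> 0" and st_nonzero: "s \<noteq> 0" "t \<noteq> 0"
    and st: "s\<^sup>2 + a * s = 1" "t\<^sup>2 + a' * t = 1" "s * t * \<delta> = 1" "F = G * t - s" "s + 1 / s = G * (t + 1 / t)"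
  defines "p \<equiv> R1 + s *s one + t *s h1" and "q \<equiv> F2 + t *s one + s *s h2"
begin

abbreviation "c \<equiv> s + 1 / s"
abbreviation "c' \<equiv> t + 1 / t"

lemma quadratics: "a = 1 / s - s" "a' = 1 / t - t" "1 / \<delta> = s * t" "x / \<delta> = x * s * t" "\<delta> = 1 / (s * t)"
  using st st_nonzero delta by (simp_all add: field_simps power2_eq_square)

lemma scalars: "A = s - G * s\<^sup>2 * t" "B = s * t\<^sup>2 - G * t" "C = 0" "D = - G" "E = 1" "F = G * t - s"
proof -
  have A: "A = G * (1 / s - s) * s * t - (G * t - s)" and B: "B = - (G * t - s) - (1 / t - t) * s * t"
    using exceptional_scalars(4,5)[OF F_nonzero] unfolding quadratics(4) quadratics(1,2) st(4) by simp_all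
  show "A = s - G * s\<^sup>2 * t" "B = s * t\<^sup>2 - G * t"
    using st_nonzero by (simp_all add: A B field_simps power2_eq_square)
qed (use exceptional_scalars[OF F_nonzero] st(4) in simp_all)

text \<open>The last two equations extend the slide relations from \<open>R1\<close> and
  \<open>F2\<close> to \<open>p\<close> and \<open>q\<close>; the additional summands agree because
  \<open>s\<close> and \<open>t\<close> change places between \<open>p\<close> and
  \<open>q\<close>.\<close>

lemma p_q_h:
  "p \<odot> p = c *s p" "q \<odot> q = c' *s q" "p \<odot> h1 = c *s h1" "h1 \<odot> p = c *s h1" "q \<odot> h2 = c' *s h2"
  "q \<odot> h1 = p \<odot> h2 \<odot> h1" "p \<odot> h2 = q \<odot> h1 \<odot> h2"
proof -
  have e: "t * (t * \<delta>) = t / s" "s * (s * \<delta>) = s / t" "t * \<delta> = 1 / s" "s * \<delta> = 1 / t"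
    using st_nonzero by (simp_all add: quadratics(5))
  have *: "g (p \<odot> p) = g (c *s p) \<and> g (q \<odot> q) = g (c' *s q) \<and> g (p \<odot> h1) = g (c *s h1) \<and>
    g (h1 \<odot> p) = g (c *s h1) \<and> g (q \<odot> h2) = g (c' *s h2) \<and>
    g (q \<odot> h1) = g (p \<odot> h2 \<odot> h1) \<and> g (p \<odot> h2) = g (q \<odot> h1 \<odot> h2)"
    if "functional_with v g" for v g
  proof -
    note g = that[unfolded functional_with_def]
    show ?thesis unfolding p_def q_def using st_nonzero
      by (simp add: rules g quadratics(1,2,4) e ring_distribs)
  qed
  show "p \<odot> p = c *s p" "q \<odot> q = c' *s q" "p \<odot> h1 = c *s h1" "h1 \<odot> p = c *s h1" "q \<odot> h2 = c' *s h2"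
    "q \<odot> h1 = p \<odot> h2 \<odot> h1" "p \<odot> h2 = q \<odot> h1 \<odot> h2"
    by (rule eq_if_functionals, use * in blast)+
qed


lemma p_q_p:
  assumes "functional_with v g"
  shows "g (p \<odot> q \<odot> p) = g (R1 \<odot> F2 \<odot> R1) + s * t * c * (v 1 + v 4 + v 5) + t * c * (v 6 + v 8 + v 9)
    + s\<^sup>2 * (v 7 + v 10 + v 11) + s * (v 12 + v 13 + v 14) + t\<^sup>2 / s * v 2 + s ^ 3 * v 3"
proof -
  note g = assms[unfolded functional_with_def]
  have e: "t * (t * (t * \<delta>)) = t\<^sup>2 / s" "\<delta> * (s * t) = 1"
    using st_nonzero by (simp_all add: quadratics(5) power2_eq_square)
  show ?thesis unfolding p_def q_def using st_nonzero
    by (simp add: rules g quadratics(1,2,4) e ring_distribs) (simp add: e field_simps power2_eq_square power3_eq_cube)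
qed

lemma q_p_q:
  assumes "functional_with v g"
  shows "g (q \<odot> p \<odot> q) = v 0 + s * t * c' * (v 1 + v 4 + v 5) + s * c' * (v 7 + v 10 + v 11)
    + t\<^sup>2 * (v 6 + v 8 + v 9) + t * (v 12 + v 13 + v 14) + t ^ 3 * v 2 + s\<^sup>2 / t * v 3"
proof -
  note g = assms[unfolded functional_with_def]
  have e: "s * (s * (s * \<delta>)) = s\<^sup>2 / t" "\<delta> * (s * t) = 1"
    using st_nonzero by (simp_all add: quadratics(5) power2_eq_square)
  show ?thesis unfolding p_def q_def using st_nonzero
    by (simp add: rules g quadratics(1,2,4) e ring_distribs) (simp add: e field_simps power2_eq_square power3_eq_cube)
qed

text \<open>After \<open>star\<close> with the exceptional scalars has replaced
  \<open>R1 F2 R1\<close>, the coefficients of \<open>p q p\<close> and \<open>G q p q\<close> agree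
  diagram by diagram. Besides \<open>F = G t - s\<close>, the reason is the equation
  \<open>s + 1 / s = G (t + 1 / t)\<close>.\<close>

lemma p_q_p_eq: "p \<odot> q \<odot> p = G *s (q \<odot> p \<odot> q)"
proof (rule eq_if_functionals)
  fix v g assume f: "functional_with v g"
  note g = f[unfolded functional_with_def]
  have coefficients: "s * t * c = G * (s * t * c')" "t * c - G = G * t\<^sup>2" "1 + s\<^sup>2 = G * (s * c')"
    "t\<^sup>2 / s + (s * t\<^sup>2 - G * t) = G * t ^ 3" "s ^ 3 + (s - G * s\<^sup>2 * t) = G * (s\<^sup>2 / t)"
  proof -
    define u w where "u = 1 / s" and "w = 1 / t"
    have "u * s = 1" "w * t = 1" "s + u = G * (t + w)"
      using st_nonzero st(5) by (simp_all add: u_def w_def)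
    then have "s * t * (s + u) = G * (s * t * (t + w))" "t * (s + u) - G = G * t\<^sup>2" "1 + s\<^sup>2 = G * (s * (t + w))"
      "t\<^sup>2 * u + (s * t\<^sup>2 - G * t) = G * t ^ 3" "s ^ 3 + (s - G * s\<^sup>2 * t) = G * (s\<^sup>2 * w)"
      by algebra+
    then show "s * t * c = G * (s * t * c')" "t * c - G = G * t\<^sup>2" "1 + s\<^sup>2 = G * (s * c')"
      "t\<^sup>2 / s + (s * t\<^sup>2 - G * t) = G * t ^ 3" "s ^ 3 + (s - G * s\<^sup>2 * t) = G * (s\<^sup>2 / t)"
      by (simp_all add: u_def w_def)
  qed
  have "g (p \<odot> q \<odot> p) = s * t * c * (v 1 + v 4 + v 5) + (t * c - G) * (v 6 + v 8 + v 9)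
    + (1 + s\<^sup>2) * (v 7 + v 10 + v 11) + G * t * (v 12 + v 13 + v 14)
    + (t\<^sup>2 / s + (s * t\<^sup>2 - G * t)) * v 2 + (s ^ 3 + (s - G * s\<^sup>2 * t)) * v 3 + G * v 0"
  proof -
    define k l where "k = t\<^sup>2 / s" and "l = c"
    show ?thesis
      unfolding p_q_p[OF f] star scalars k_def[symmetric] l_def[symmetric] by (simp add: g algebra_simps)
  qed
  also have "\<dots> = g (G *s (q \<odot> p \<odot> q))"
    unfolding coefficients q_p_q[OF f] by (simp only: g[THEN conjunct2, THEN conjunct2, THEN conjunct1, rule_format] q_p_q[OF f] distrib_left mult.assoc ac_simps)
  finally show "g (p \<odot> q \<odot> p) = g (G *s (q \<odot> p \<odot> q))" .
qed

lemma p_q_h1: "p \<odot> q \<odot> h1 = c *s (q \<odot> h1)"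
  using ext[OF p_q_h(1), of "h2 \<odot> h1"] by (simp add: p_q_h(6) mul_scale)

lemma q_p_h2: "q \<odot> p \<odot> h2 = c' *s (p \<odot> h2)"
  using ext[OF p_q_h(2), of "h1 \<odot> h2"] by (simp add: p_q_h(7) mul_scale)

definition "w = p \<odot> q - q \<odot> p"

lemma w_V: "w \<in> V"
  unfolding w_def by (intro subspace_diff[OF subspace_V] mul_closed)

text \<open>In front of \<open>h1\<close> both \<open>p q\<close> and \<open>q p\<close> act as
  \<open>c q\<close>, and in front of \<open>h2\<close> both act as \<open>c' p\<close>. The same
  cancellation survives one further factor \<open>q\<close> or \<open>p\<close>.\<close>

lemma w_h: "w \<odot> h1 = 0" "w \<odot> h2 = 0" "w \<odot> q \<odot> h1 = 0" "w \<odot> p \<odot> h2 = 0"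
proof -
  show "w \<odot> h1 = 0" by (simp add: w_def mul_diff assoc p_q_h1 p_q_h(3) mul_scale)
  show "w \<odot> h2 = 0" by (simp add: w_def mul_diff assoc q_p_h2 p_q_h(5) mul_scale)
  have "p \<odot> q \<odot> q \<odot> h1 = c' *s (c *s (q \<odot> h1))" "q \<odot> p \<odot> q \<odot> h1 = c *s (c' *s (q \<odot> h1))"
    using ext[OF p_q_h(2), of h1] by (simp_all only: p_q_h1 mul_scale)
  then show "w \<odot> q \<odot> h1 = 0" by (simp add: w_def mul_diff assoc mult.commute)
  have "p \<odot> q \<odot> p \<odot> h2 = c' *s (c *s (p \<odot> h2))" "q \<odot> p \<odot> p \<odot> h2 = c *s (c' *s (p \<odot> h2))"
    using ext[OF p_q_h(1), of h2] by (simp_all only: q_p_h2 mul_scale)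
  then show "w \<odot> p \<odot> h2 = 0" by (simp add: w_def mul_diff assoc mult.commute)
qed

text \<open>By \<open>p_q_p_eq\<close> and \<open>c = G c'\<close>, both terms of
  \<open>w p q\<close> equal \<open>c\<close> times \<open>q p q\<close>, and both terms of
  \<open>w q p\<close> equal \<open>c'\<close> times \<open>p q p\<close>.\<close>

lemma w_p_q: "w \<odot> p \<odot> q = 0" "w \<odot> q \<odot> p = 0"
proof -
  have c: "G * c' = c" using st(5) by simp
  have 1: "q \<odot> p \<odot> p \<odot> q = c *s (q \<odot> p \<odot> q)" "p \<odot> q \<odot> q \<odot> p = c' *s (p \<odot> q \<odot> p)"
    using ext[OF p_q_h(1)] ext[OF p_q_h(2)] by (simp_all only: mul_scale)
  have 2: "p \<odot> q \<odot> p \<odot> q = c *s (q \<odot> p \<odot> q)"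
    unfolding ext3[OF p_q_p_eq] c[symmetric] by (simp only: mul_scale assoc p_q_h(2) scale_scale)
  have "G *s (q \<odot> p \<odot> q \<odot> p) = c *s (p \<odot> q \<odot> p)"
    using ext3[OF p_q_p_eq, of p] by (simp only: mul_scale assoc p_q_h(1))
  then have "G *s (q \<odot> p \<odot> q \<odot> p) = G *s (c' *s (p \<odot> q \<odot> p))" by (simp only: scale_scale c)
  then have 3: "q \<odot> p \<odot> q \<odot> p = c' *s (p \<odot> q \<odot> p)" using G_nonzero scale_left_imp_eq by blast
  show "w \<odot> p \<odot> q = 0" "w \<odot> q \<odot> p = 0"
    by (simp_all only: w_def mul_diff assoc 1 2 3) simp_all
qed

definition "J = span {w, w \<odot> p, w \<odot> q}"

lemma J_mem: "w \<in> J" "w \<odot> p \<in> J" "w \<odot> q \<in> J"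
  by (auto simp: J_def intro: span_base)

text \<open>Beyond \<open>w\<close>, \<open>w p\<close> and \<open>w q\<close>, each further product
  is zero by \<open>w_h\<close> or \<open>w_p_q\<close>, or a multiple of one of these three by
  \<open>p_q_h\<close>.\<close>

lemma J_mul:
  assumes "x \<in> J" "z \<in> {one, h1, h2, p, q}"
  shows "x \<odot> z \<in> J"
  using assms(1)[unfolded J_def]
proof (induction rule: span_induct_alt)
  case base
  show ?case unfolding mul_0 J_def by (rule span_zero)
next
  case (step k u y)
  have w: "w \<odot> one = w" "(w \<odot> p) \<odot> one = w \<odot> p" "(w \<odot> q) \<odot> one = w \<odot> q"
    by (simp_all only: unit(2)[OF w_V] unit(2)[OF mul_closed])
  have "u \<odot> z \<in> J"
    using step(1) assms(2) J_mem w w_h w_p_q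
    by (auto simp: assoc p_q_h mul_scale span_zero J_def intro!: span_scale)
  then show ?case using step(2) by (auto simp: mul_add mul_scale J_def intro: span_add span_scale)
qed

text \<open>\<open>R1\<close> and \<open>F2\<close> differ from \<open>p\<close> and
  \<open>q\<close> by combinations of \<open>one\<close>, \<open>h1\<close> and \<open>h2\<close>,
  so stability passes to all factors of the spanning products of \<open>V\<close>.\<close>

lemma J_right_ideal:
  assumes "x \<in> J" "z \<in> V"
  shows "x \<odot> z \<in> J"
proof -
  have mul_atom: "x \<odot> z \<in> J" if "x \<in> J" "z \<in> {one, h1, h2, R1, F2}" for x z
  proof -
    have "x \<odot> one \<in> J" "x \<odot> h1 \<in> J" "x \<odot> h2 \<in> J" "x \<odot> p \<in> J" "x \<odot> q \<in> J"
      using J_mul[OF that(1)] by simp_all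
    moreover from this have "x \<odot> p - s *s (x \<odot> one) - t *s (x \<odot> h1) \<in> J"
      "x \<odot> q - t *s (x \<odot> one) - s *s (x \<odot> h2) \<in> J"
      unfolding J_def by (simp_all add: span_diff span_scale)
    moreover have "x \<odot> R1 = x \<odot> p - s *s (x \<odot> one) - t *s (x \<odot> h1)"
      "x \<odot> F2 = x \<odot> q - t *s (x \<odot> one) - s *s (x \<odot> h2)"
      by (simp_all add: p_def q_def mul_linear)
    ultimately show ?thesis using that(2) by auto
  qed
  show ?thesis
    using set_mp[OF spanning assms(2)]
  proof (induction rule: span_induct_alt)
    case base
    show ?case unfolding mul_0 J_def by (rule span_zero)
  next
    case (step k u y)
    obtain u1 u2 u3 where u: "u = u1 \<odot> u2 \<odot> u3" "u1 \<in> {one, h1, R1}" "u2 \<in> {one, h2, F2}" "u3 \<in> {one, h1, R1}"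
      using step(1) by blast
    have "((x \<odot> u1) \<odot> u2) \<odot> u3 \<in> J"
      by (intro mul_atom assms(1)) (use u in auto)
    then have "x \<odot> u \<in> J" unfolding u(1) by (simp only: assoc)
    then show ?case using step(2) by (auto simp: mul_add mul_scale J_def intro: span_add span_scale)
  qed
qed

text \<open>\<open>p q\<close> and \<open>q p\<close> have the same trace by the table of values,
  and \<open>s t \<delta> = 1\<close> gives \<open>tr (p q p) = c tr (q p)\<close>. The case of
  \<open>w q\<close> is multiplied by \<open>G\<close>, which turns \<open>q p q\<close> into
  \<open>p q p\<close>.\<close>

lemma tr_J:
  assumes "x \<in> J"
  shows "tr x = 0"
proof -
  have f: "functional_with (\<lambda>i. tr (basis ! i)) tr" using tr_linear by (rule functional_with_values)
  note g = f[unfolded functional_with_def, THEN conjunct2, THEN conjunct1]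
  note tr_simps = tr_linear tr_one tr_TL tr_zero tr_R1_h2_R1
  have pq: "tr (p \<odot> q) = s * t * \<delta> ^ 3 + s\<^sup>2 * \<delta>\<^sup>2 + t\<^sup>2 * \<delta>\<^sup>2 + s * t * \<delta>"
    and qp: "tr (q \<odot> p) = s * t * \<delta> ^ 3 + s\<^sup>2 * \<delta>\<^sup>2 + t\<^sup>2 * \<delta>\<^sup>2 + s * t * \<delta>"
    unfolding p_def q_def by (simp_all add: rules tr_simps algebra_simps power2_eq_square)
  have pqp: "tr (p \<odot> q \<odot> p) = s * t * c * (\<delta> ^ 3 + 2 * \<delta>) + s * (\<delta>\<^sup>2 - 1) + t\<^sup>2 / s * \<delta>\<^sup>2 + s ^ 3 * \<delta>\<^sup>2"
    unfolding p_q_p[OF f] by (simp add: basis_def lower_def numeral_eq_Suc tr_simps)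
  define u where "u = 1 / s"
  have u: "u * s = 1" "s * t * \<delta> = 1" using st_nonzero st(3) by (simp_all add: u_def)
  have "s * t * (s + u) * (\<delta> ^ 3 + 2 * \<delta>) + s * (\<delta>\<^sup>2 - 1) + t\<^sup>2 * u * \<delta>\<^sup>2 + s ^ 3 * \<delta>\<^sup>2
    = (s + u) * (s * t * \<delta> ^ 3 + s\<^sup>2 * \<delta>\<^sup>2 + t\<^sup>2 * \<delta>\<^sup>2 + s * t * \<delta>)"
    using u by algebra
  then have e: "tr (p \<odot> q \<odot> p) = c * tr (q \<odot> p)" unfolding pqp qp by (simp add: u_def)
  have "tr w = 0" by (simp add: w_def g pq qp)
  moreover have "tr (w \<odot> p) = 0"
    by (simp add: w_def mul_diff assoc g p_q_h(1) mul_scale tr_linear e)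
  moreover have "tr (w \<odot> q) = 0"
  proof -
    have "G * tr (w \<odot> q) = G * c' * tr (p \<odot> q) - tr (G *s (q \<odot> p \<odot> q))"
      by (simp add: w_def mul_diff assoc g p_q_h(2) mul_scale tr_linear right_diff_distrib)
    also have "\<dots> = c * tr (p \<odot> q) - tr (p \<odot> q \<odot> p)" using st(5) p_q_p_eq by simp
    also have "\<dots> = 0" using e pq qp by simp
    finally show ?thesis using G_nonzero by simp
  qed
  ultimately have *: "tr u = 0" if "u \<in> {w, w \<odot> p, w \<odot> q}" for u using that by auto
  show ?thesis
    using assms unfolding J_def
    by (induction rule: span_induct_alt) (use tr_linear(2)[of 0 0] * in \<open>simp_all add: tr_linear\<close>)
qed

lemma contradiction: False
proof -
  have w: "w = 0" using w_V nondegenerate tr_J J_right_ideal J_mem(1) by blast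
  \<comment> \<open>Position 13 of \<open>basis\<close> is \<open>F2 R1\<close>, which occurs in
    \<open>q p\<close> with coefficient 1 and does not occur in \<open>p q\<close>.\<close>
  obtain g where "functional_with (\<lambda>i. if i = 13 then 1 else 0) g" using functional_exists by blast
  note g = this[unfolded functional_with_def]
  have "g w = - 1" unfolding w_def p_def q_def by (simp add: rules g)
  then show False using w g by simp
qed
end

theorem (in three_box) conclusion:
  "(G = 1 \<or> G = - 1) \<and> A = G * a / \<delta> \<and> B = - A \<and> C = 0 \<and>
   (G * \<delta>\<^sup>2 - 2 * \<delta>) * D = 1 - G * a\<^sup>2 * \<delta> \<and> E = - G * D \<and> F = 0 \<and> a' = G * a"
proof (rule conclusion_if_F_0, rule ccontr)
  assume "F \<noteq> 0"
  then obtain s t where "s \<noteq> 0" "t \<noteq> 0" "s\<^sup>2 + a * s = 1" "t\<^sup>2 + a' * t = 1" "s * t * \<delta> = 1" "F = G * t - s"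
    "s + 1 / s = G * (t + 1 / t)"
    by (rule exceptional_parameters)
  then interpret exceptional_three_box scale V "(\<odot>)" tr \<delta> a a' A B C D E F G R1 F2 h1 h2 one s t
    "R1 + s *s one + t *s h1" "F2 + t *s one + s *s h2"
    using \<open>F \<noteq> 0\<close> by unfold_locales
  show False by (rule contradiction)
qed

section \<open>Proof of the theorem\<close>

locale yang_baxter_generator = shaded_planar_algebra +
  fixes a a' :: complex and R :: 'a
  assumes delta: "\<delta> \<noteq> 0" and nondegenerate: nondegenerate and generated: "generated_by R 2 Plus"
    and yang_baxter: yang_baxter and dim_P_3: "dim (P 3 s) = 15"
    and uncappable: "uncappable Z Plus R" and rotation: "click Z Minus (click Z Plus R) = R"
    and square_R: "box_mult Z 2 Plus R R = a *s R + box_id Z 2 Plus - (1 / \<delta>) *s box_h Z Plus"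
    and square_F: "box_mult Z 2 Minus (click Z Plus R) (click Z Plus R) =
           a' *s click Z Plus R + box_id Z 2 Minus - (1 / \<delta>) *s box_h Z Minus"
begin

abbreviation "F \<equiv> click Z Plus R"
abbreviation "e s \<equiv> eval 2 s []"
abbreviation "h s \<equiv> eval 2 s [(0, LCap), (0, LCup)]"

lemma R_P [simp]: "R \<in> P 2 Plus"
  using generated unfolding generated_by_def by blast

lemma F_P [simp]: "F \<in> P 2 Minus"
  using click_P[OF R_P] by simp

lemma e_P [simp]: "e s \<in> P 2 s" and h_P [simp]: "h s \<in> P 2 s"
  by (auto intro!: eval_in_P)

lemma R_caps:
  "eval 1 Plus [(1, LCup), (0, LBox 2 R), (0, LCap)] = 0"
  "eval 1 Plus [(0, LCup), (0, LBox 2 R), (1, LCap)] = 0"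
  "eval 1 Plus [(1, LCup), (0, LBox 2 R), (1, LCap)] = 0"
  "eval 1 Minus [(0, LCup), (1, LBox 2 R), (0, LCap)] = 0"
  using uncappable unfolding uncappable_eval[OF R_P] by simp_all

lemma F_caps:
  "eval 2 Minus [(0, LBox 2 F), (0, LCap), (0, LCup)] = 0"
  "eval 2 Minus [(0, LCap), (0, LCup), (0, LBox 2 F)] = 0"
  "eval 1 Minus [(1, LCup), (0, LBox 2 F), (1, LCap)] = 0"
  using click_top[OF R_P R_caps(3)] click_bottom[of R Plus] click_right[OF R_P R_caps(2)] R_caps(4) by simp_all

lemma P_1: "P 1 s \<subseteq> span {eval 1 s []}"
  using delta nondegenerate dim_P_3 by (rule P_1_scalar)

lemma P_2_Plus: "P 2 Plus \<subseteq> span {e Plus, h Plus, R}"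
proof (rule P_2_span[OF delta nondegenerate P_1 dim_P_3 R_P generator_not_TL[OF generated dim_P_3]])
  show "eval 2 Plus [(0, LCap), (0, LCup), (0, LBox 2 R)] = 0"
    by (rule bottom_zero[of 0 Plus R 2 "[(0, LCap)]" 0 "[]", unfolded append.simps]) (use R_caps in simp_all)
qed

lemma P_2_Minus: "P 2 Minus \<subseteq> span {e Minus, h Minus, F}"
proof (rule P_2_span[OF delta nondegenerate P_1 dim_P_3 F_P])
  show "F \<notin> span {e Minus, h Minus}"
  proof
    assume F: "F \<in> span {e Minus, h Minus}"
    \<comment> \<open>\<open>click\<close> exchanges \<open>id\<close> and \<open>h\<close>, so it
      would carry this membership over to \<open>R\<close>.\<close>
    have "click Z Minus F \<in> span {e Plus, h Plus}"
      by (rule linear_on_span[OF click_linear subspace_P _ F])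
        (auto simp: click_id[of Minus] click_h[of Minus] intro: span_base)
    then show False using generator_not_TL[OF generated dim_P_3] by (simp add: rotation)
  qed
qed (rule F_caps)

definition x1 :: "'a \<Rightarrow> 'a" where "x1 x = eval 3 Plus [(0, LBox 2 x)]"
definition x2 :: "'a \<Rightarrow> 'a" where "x2 x = eval 3 Plus [(1, LBox 2 x)]"

lemma x1_P [simp]: "x \<in> P 2 Plus \<Longrightarrow> x1 x \<in> P 3 Plus" and x2_P [simp]: "x \<in> P 2 Minus \<Longrightarrow> x2 x \<in> P 3 Plus"
  by (simp_all add: x1_def x2_def)

lemma x1_word: "x1 (e Plus) = eval 3 Plus []" "x1 (h Plus) = eval 3 Plus [(0, LCap), (0, LCup)]"
  using id_box[of "e Plus" 0 Plus 3 "[]" 3 "[]"] h_box[of "h Plus" 0 Plus 3 "[]" 3 "[]"]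
  by (simp_all add: x1_def)

lemma x2_word: "x2 (e Minus) = eval 3 Plus []" "x2 (h Minus) = eval 3 Plus [(1, LCap), (1, LCup)]"
  using id_box[of "e Minus" 1 Plus 3 "[]" 3 "[]"] h_box[of "h Minus" 1 Plus 3 "[]" 3 "[]"]
  by (simp_all add: x2_def)

text \<open>The projection makes the product of \<open>P 3 Plus\<close> a total bilinear operation.\<close>

definition project :: "'a \<Rightarrow> 'a" where
  "project = (SOME f. range f \<subseteq> P 3 Plus \<and> Vector_Spaces.linear scale scale f \<and> (\<forall>x\<in>P 3 Plus. f x = x))"

lemma project: "project x \<in> P 3 Plus" "project (x + y) = project x + project y"
  "project (c *s x) = c *s project x" "x \<in> P 3 Plus \<Longrightarrow> project x = x"
proof -
  interpret vector_space_pair scale scale by unfold_locales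
  have "Vector_Spaces.linear scale scale id" by (rule linear_id)
  then have "\<exists>f. range f \<subseteq> P 3 Plus \<and> Vector_Spaces.linear scale scale f \<and> (\<forall>x\<in>P 3 Plus. f (id x) = x)"
    by (rule linear_exists_left_inverse_on[OF _ subspace_P]) simp
  then have *: "range project \<subseteq> P 3 Plus \<and> Vector_Spaces.linear scale scale project \<and> (\<forall>x\<in>P 3 Plus. project x = x)"
    unfolding project_def id_apply by (rule someI_ex)
  then have l: "Vector_Spaces.linear scale scale project" by blast
  show "project x \<in> P 3 Plus" "x \<in> P 3 Plus \<Longrightarrow> project x = x" using * by blast+
  show "project (x + y) = project x + project y" "project (c *s x) = c *s project x"
    using linear_add[OF l] linear_scale[OF l] by blast+
qed

section \<open>Product and trace on the space of 3-boxes\<close>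

definition mul :: "'a \<Rightarrow> 'a \<Rightarrow> 'a" (infixr "\<odot>" 80) where
  "x \<odot> y = box_mult Z 3 Plus (project x) (project y)"

definition trace :: "'a \<Rightarrow> complex" where
  "trace x = coef Plus (right_closure Z 3 Plus (project x))"

lemma mul_box: "x \<in> P 3 Plus \<Longrightarrow> y \<in> P 3 Plus \<Longrightarrow> x \<odot> y = box_mult Z 3 Plus x y"
  by (simp add: mul_def project)

lemma mul_eval: "ok 3 Plus u 3 \<Longrightarrow> ok 3 Plus v 3 \<Longrightarrow> eval 3 Plus u \<odot> eval 3 Plus v = eval 3 Plus (u @ v)"
  by (simp add: mul_box word_mult)

lemma mul_boxes: "x \<odot> y = eval 3 Plus [(0, LBox 3 (project x)), (0, LBox 3 (project y))]"
  by (simp add: mul_def project(1) box_mult_eval)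

lemma mul_closed: "x \<odot> y \<in> P 3 Plus"
  by (simp add: mul_def project box_mult_eval)

lemma linear_on_add: "linear_on V f \<Longrightarrow> x \<in> V \<Longrightarrow> y \<in> V \<Longrightarrow> f (x + y) = f x + f y"
  unfolding linear_on_def by (metis scale_one)

lemma linear_on_scale: "linear_on V f \<Longrightarrow> subspace V \<Longrightarrow> x \<in> V \<Longrightarrow> f (c *s x) = c *s f x"
  using linear_on_0[of V f] subspace_0[of V] unfolding linear_on_def by (metis add.right_neutral)

lemma mul_linear:
  "(x + y) \<odot> z = x \<odot> z + y \<odot> z" "x \<odot> (y + z) = x \<odot> y + x \<odot> z"
  "(c *s x) \<odot> z = c *s (x \<odot> z)" "x \<odot> (c *s z) = c *s (x \<odot> z)"
proof -
  have l: "linear_on (P 3 Plus) (\<lambda>x. eval 3 Plus [(0, LBox 3 x), (0, LBox 3 (project z))])"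
    "linear_on (P 3 Plus) (\<lambda>y. eval 3 Plus [(0, LBox 3 (project z)), (0, LBox 3 y)])" for z
    using linear_on_eval[of 3 Plus "[]" 3 "[(0, LBox 3 (project z))]" 0 3]
      linear_on_eval[of 3 Plus "[(0, LBox 3 (project z))]" 3 "[]" 0 3] project(1) by simp_all
  show "(x + y) \<odot> z = x \<odot> z + y \<odot> z" "x \<odot> (y + z) = x \<odot> y + x \<odot> z"
    unfolding mul_boxes project(2)
    by (rule linear_on_add[OF l(1) project(1) project(1)] linear_on_add[OF l(2) project(1) project(1)])+
  show "(c *s x) \<odot> z = c *s (x \<odot> z)" "x \<odot> (c *s z) = c *s (x \<odot> z)"
    unfolding mul_boxes project(3)
    by (rule linear_on_scale[OF l(1) subspace_P project(1)] linear_on_scale[OF l(2) subspace_P project(1)])+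
qed

text \<open>Every projected vector is the value of a one-letter word, and a product of values of
  words is the value of their concatenation.\<close>

lemma mul_assoc: "(x \<odot> y) \<odot> z = x \<odot> y \<odot> z"
proof -
  have word: "\<exists>w. project x = eval 3 Plus w \<and> ok 3 Plus w 3" for x
    using eval_single[OF project(1)] project(1) by (intro exI[of _ "[(0, LBox 3 (project x))]"]) simp
  obtain u v w where "project x = eval 3 Plus u" "ok 3 Plus u 3" "project y = eval 3 Plus v" "ok 3 Plus v 3"
    "project z = eval 3 Plus w" "ok 3 Plus w 3" using word by metis
  then show ?thesis
    by (simp add: mul_def project word_mult box_mult_eval[symmetric] ok_append exI[of _ 3])
qed


lemma trace_unique:
  assumes "x \<in> P 3 Plus" "right_closure Z 3 Plus x = c *s eval 0 Plus []"
  shows "trace x = c"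
proof -
  have "c *s eval 0 Plus [] \<in> P 0 Plus" by (intro subspace_scale[OF subspace_P]) simp
  then show ?thesis
    unfolding trace_def project(4)[OF assms(1)] assms(2) using coef coef_unique by metis
qed

lemma upt_3: "[0..<3] = [0, 1, 2]"
  by (simp add: upt_rec)

lemma right_closure_3: "x \<in> P 3 Plus \<Longrightarrow> right_closure Z 3 Plus x =
    eval 0 Plus [(0, LCup), (1, LCup), (2, LCup), (0, LBox 3 x), (2, LCap), (1, LCap), (0, LCap)]"
  using right_closure_eval[of x 3 Plus] by (simp add: upt_3)

lemma trace_eq: "right_closure Z 3 Plus (project x) = trace x *s eval 0 Plus []"
  unfolding trace_def by (rule coef) (simp add: right_closure_3 project(1))

lemma trace_linear: "trace (x + y) = trace x + trace y" "trace (c *s x) = c * trace x"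
proof -
  have l: "linear_on (P 3 Plus) (\<lambda>x. eval 0 Plus [(0, LCup), (1, LCup), (2, LCup), (0, LBox 3 x), (2, LCap), (1, LCap), (0, LCap)])"
    using linear_on_eval[of 0 Plus "[(0, LCup), (1, LCup), (2, LCup)]" 6 "[(2, LCap), (1, LCap), (0, LCap)]" 0 3]
    by simp
  note eq = trace_eq[unfolded right_closure_3[OF project(1)]]
  have "trace (x + y) *s eval 0 Plus [] = (trace x + trace y) *s eval 0 Plus []"
    unfolding scale_left_distrib eq[symmetric] project(2) by (rule linear_on_add[OF l project(1) project(1)])
  then show "trace (x + y) = trace x + trace y" by (rule coef_unique)
  have "trace (c *s x) *s eval 0 Plus [] = (c * trace x) *s eval 0 Plus []"
    unfolding scale_scale[symmetric] eq[symmetric] project(3) by (rule linear_on_scale[OF l subspace_P project(1)])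
  then show "trace (c *s x) = c * trace x" by (rule coef_unique)
qed

lemma trace_nondegenerate:
  assumes "w \<in> P 3 Plus" "\<And>z. z \<in> P 3 Plus \<Longrightarrow> trace (w \<odot> z) = 0"
  shows "w = 0"
proof (rule nondegenerate_right[OF nondegenerate assms(1)])
  fix z assume z: "z \<in> P 3 Plus"
  then have "right_closure Z 3 Plus (w \<odot> z) = 0"
    using trace_eq[of "w \<odot> z"] assms(2)[OF z] by (simp add: project(4)[OF mul_closed])
  then show "right_closure Z 3 Plus (box_mult Z 3 Plus w z) = 0" using mul_box[OF assms(1) z] by simp
qed

lemma brick: "x \<in> P 2 Plus \<Longrightarrow> y \<in> P 2 Minus \<Longrightarrow> z \<in> P 2 Plus \<Longrightarrow>
    x1 x \<odot> x2 y \<odot> x1 z = eval 3 Plus [(0, LBox 2 x), (1, LBox 2 y), (0, LBox 2 z)]"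
  unfolding x1_def x2_def by (simp add: mul_eval)

definition right_cap :: "shading \<Rightarrow> 'a \<Rightarrow> 'a" where
  "right_cap s x = eval 1 s [(1, LCup), (0, LBox 2 x), (1, LCap)]"

lemma right_cap_linear: "linear_on (P 2 s) (right_cap s)"
  unfolding right_cap_def using linear_on_eval[of 1 s "[(1, LCup)]" 3 "[(1, LCap)]" 0 2] by simp

lemma right_cap_e: "right_cap s (e s) = \<delta> *s eval 1 s []"
proof -
  have "right_cap s (e s) = eval 1 s [(1, LCup), (1, LCap)]"
    unfolding right_cap_def
    by (rule id_box[where U = "[(1, LCup)]" and V = "[(1, LCap)]" and l = 3, unfolded append.simps]) simp_all
  also have "\<dots> = \<delta> *s eval 1 s []"
    by (rule eval_circle[of 1 s "[]" 1 "[]" 1, unfolded append.simps]) simp_all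
  finally show ?thesis .
qed

lemma right_cap_h: "right_cap s (h s) = 1 *s eval 1 s []"
proof -
  have "right_cap s (h s) = eval 1 s [(1, LCup), (0, LCap), (0, LCup), (1, LCap)]"
    unfolding right_cap_def
    by (rule h_box[where U = "[(1, LCup)]" and V = "[(1, LCap)]" and l = 3, unfolded append.simps]) simp_all
  also have "\<dots> = eval 1 s [(0, LCup), (1, LCap)]"
    by (rule eval_zr[of 1 s "[]" 1 "[(0, LCup), (1, LCap)]" 0 1, unfolded append.simps]) simp_all
  also have "\<dots> = eval 1 s []"
    by (rule eval_zl[of 1 s "[]" 1 "[]" 0 1, unfolded append.simps]) simp_all
  finally show ?thesis by simp
qed

lemma square_R': "eval 2 Plus [(0, LBox 2 R), (0, LBox 2 R)] = a *s R + (1 *s e Plus + (- (1 / \<delta>)) *s h Plus)"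
  using square_R by (simp add: box_mult_eval box_id_eval box_h_eval)

lemma square_F': "eval 2 Minus [(0, LBox 2 F), (0, LBox 2 F)] = a' *s F + (1 *s e Minus + (- (1 / \<delta>)) *s h Minus)"
  using square_F by (simp add: box_mult_eval box_id_eval box_h_eval)

lemma linear_combination:
  assumes "linear_on (P 2 s) f" "x \<in> P 2 s"
  shows "f (c *s x + (1 *s e s + k *s h s)) = c *s f x + (f (e s) + k *s f (h s))"
proof -
  have "k *s h s \<in> P 2 s" "1 *s e s + k *s h s \<in> P 2 s"
    by (auto intro!: subspace_add[OF subspace_P] subspace_scale[OF subspace_P])
  then have "f (c *s x + (1 *s e s + k *s h s)) = c *s f x + (1 *s f (e s) + f (k *s h s))"
    using assms(1) assms(2) e_P unfolding linear_on_def by metis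
  then show ?thesis using linear_on_scale[OF assms(1) subspace_P h_P] by simp
qed

text \<open>The quadratic relation is capped on the right: \<open>R\<close> contributes 0,
  \<open>id\<close> a circle, and \<open>h\<close> a straight string.\<close>

lemma right_cap_square: "eval 1 Plus [(1, LCup), (0, LBox 2 R), (0, LBox 2 R), (1, LCap)] = (\<delta> - 1 / \<delta>) *s eval 1 Plus []"
proof -
  have "eval 1 Plus [(1, LCup), (0, LBox 2 R), (0, LBox 2 R), (1, LCap)] =
      right_cap Plus (eval 2 Plus [(0, LBox 2 R), (0, LBox 2 R)])"
    unfolding right_cap_def
    by (rule word_box'[OF _ _ _ _ _ refl, where U = "[(1, LCup)]" and V = "[(1, LCap)]" and l = 3
      and S' = "[(0, LBox 2 R), (0, LBox 2 R)]", unfolded append.simps, symmetric]) simp_all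
  also have "\<dots> = a *s right_cap Plus R + (right_cap Plus (e Plus) + (- (1 / \<delta>)) *s right_cap Plus (h Plus))"
    unfolding square_R' by (rule linear_combination[OF right_cap_linear R_P])
  also have "\<dots> = (\<delta> - 1 / \<delta>) *s eval 1 Plus []"
    using R_caps(3) by (simp add: right_cap_def[of Plus R] right_cap_e right_cap_h scale_left_diff_distrib)
  finally show ?thesis .
qed

lemma trace_brick:
  assumes "x \<in> P 2 Plus" "y \<in> P 2 Minus" "z \<in> P 2 Plus" "right_cap Minus y = l *s eval 1 Minus []"
    and "eval 1 Plus [(1, LCup), (0, LBox 2 x), (0, LBox 2 z), (1, LCap)] = m *s eval 1 Plus []"
  shows "trace (x1 x \<odot> x2 y \<odot> x1 z) = l * m * \<delta>"
proof (rule trace_unique[OF mul_closed])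
  have "eval 0 Plus [(0, LCup), (1, LCup), (2, LCup), (0, LBox 2 x), (1, LBox 2 y), (0, LBox 2 z), (2, LCap), (1, LCap), (0, LCap)]
      = (l * m * \<delta>) *s eval 0 Plus []"
    by (rule trace_3) (use assms in \<open>simp_all add: right_cap_def\<close>)
  then show "right_closure Z 3 Plus (x1 x \<odot> x2 y \<odot> x1 z) = (l * m * \<delta>) *s eval 0 Plus []"
    unfolding brick[OF assms(1-3)]
    using right_closure_word[of 3 Plus "[(0, LBox 2 x), (1, LBox 2 y), (0, LBox 2 z)]"] assms(1-3)
    by (simp add: upt_3)
qed

lemma right_cap_pairs:
  assumes "x \<in> P 2 Plus"
  shows "eval 1 Plus [(1, LCup), (0, LBox 2 x), (0, LBox 2 (e Plus)), (1, LCap)] = right_cap Plus x"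
    "eval 1 Plus [(1, LCup), (0, LBox 2 (e Plus)), (0, LBox 2 x), (1, LCap)] = right_cap Plus x"
  unfolding right_cap_def
  using id_box[of "e Plus" 0 Plus 1 "[(1, LCup), (0, LBox 2 x)]" 3 "[(1, LCap)]"]
    id_box[of "e Plus" 0 Plus 1 "[(1, LCup)]" 3 "[(0, LBox 2 x), (1, LCap)]"] assms
  by simp_all

definition "one = eval 3 Plus []"
definition "h1 = eval 3 Plus [(0, LCap), (0, LCup)]"
definition "h2 = eval 3 Plus [(1, LCap), (1, LCup)]"
definition "R1 = eval 3 Plus [(0, LBox 2 R)]"
definition "F2 = eval 3 Plus [(1, LBox 2 F)]"

lemmas atom_defs = one_def h1_def h2_def R1_def F2_def

lemma bricks: "one = x1 (e Plus)" "h1 = x1 (h Plus)" "R1 = x1 R" "one = x2 (e Minus)" "h2 = x2 (h Minus)" "F2 = x2 F"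
  by (simp_all add: atom_defs x1_word x2_word x1_def[of R] x2_def[of F])

lemma one_mul: "x \<in> P 3 Plus \<Longrightarrow> one \<odot> x = x" "x \<in> P 3 Plus \<Longrightarrow> x \<odot> one = x"
  using mul_eval[of "[]" "[(0, LBox 3 x)]"] mul_eval[of "[(0, LBox 3 x)]" "[]"] eval_single[of x 3 Plus]
  by (simp_all add: one_def)

lemma atoms_P: "one \<in> P 3 Plus" "h1 \<in> P 3 Plus" "h2 \<in> P 3 Plus" "R1 \<in> P 3 Plus" "F2 \<in> P 3 Plus"
  by (simp_all add: atom_defs)

text \<open>All elements in the list have the form treated by \<open>trace_brick\<close>, with
  identity factors where necessary. The zeros come from the vanishing right caps of \<open>R\<close>
  and \<open>F\<close>.\<close>

lemma trace_values:
  "trace one = \<delta> ^ 3" "trace h1 = \<delta>\<^sup>2" "trace h2 = \<delta>\<^sup>2" "trace (h1 \<odot> h2) = \<delta>" "trace (h2 \<odot> h1) = \<delta>"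
  "trace R1 = 0" "trace F2 = 0" "trace (h1 \<odot> F2) = 0" "trace (F2 \<odot> h1) = 0" "trace (R1 \<odot> h2) = 0"
  "trace (h2 \<odot> R1) = 0" "trace (F2 \<odot> R1) = 0" "trace (R1 \<odot> F2) = 0" "trace (R1 \<odot> F2 \<odot> R1) = 0"
  "trace (R1 \<odot> h2 \<odot> R1) = \<delta>\<^sup>2 - 1"
proof -
  have F: "right_cap Minus F = 0 *s eval 1 Minus []" and R: "right_cap Plus R = 0 *s eval 1 Plus []"
    using F_caps(3) R_caps(3) by (simp_all add: right_cap_def)
  note pairs = right_cap_pairs[OF e_P] right_cap_pairs[OF h_P] right_cap_pairs[OF R_P]
  note xz = pairs(1)[unfolded right_cap_e] pairs(3,4)[unfolded right_cap_h] pairs(5,6)[unfolded R]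
  note t = trace_brick[OF _ _ _ _ xz(1)] trace_brick[OF _ _ _ _ xz(2)] trace_brick[OF _ _ _ _ xz(3)]
    trace_brick[OF _ _ _ _ xz(4)] trace_brick[OF _ _ _ _ xz(5)]
  have e: "e Plus \<in> P 2 Plus" "e Minus \<in> P 2 Minus" "h Plus \<in> P 2 Plus" "h Minus \<in> P 2 Minus" by simp_all
  note t1 = t(1)[OF e(1) e(2) e(1) right_cap_e] t(1)[OF e(1) e(4) e(1) right_cap_h] t(1)[OF e(1) F_P e(1) F]
  note t2 = t(2)[OF e(3) e(2) e(1) right_cap_e] t(2)[OF e(3) e(4) e(1) right_cap_h] t(2)[OF e(3) F_P e(1) F]
  note t3 = t(3)[OF e(1) e(4) e(3) right_cap_h] t(3)[OF e(1) F_P e(3) F]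
  note t4 = t(4)[OF R_P e(2) e(1) right_cap_e] t(4)[OF R_P e(4) e(1) right_cap_h] t(4)[OF R_P F_P e(1) F]
  note t5 = t(5)[OF e(1) e(4) R_P right_cap_h] t(5)[OF e(1) F_P R_P F]
  note t6 = trace_brick[OF R_P e(4) R_P right_cap_h right_cap_square] trace_brick[OF R_P F_P R_P F right_cap_square]
  have d: "(\<delta> - 1 / \<delta>) * \<delta> = \<delta> * \<delta> - 1" using delta by (simp add: left_diff_distrib)
  note all = t1 t2 t3 t4 t5 t6
  show "trace one = \<delta> ^ 3" "trace h1 = \<delta>\<^sup>2" "trace h2 = \<delta>\<^sup>2" "trace (h1 \<odot> h2) = \<delta>" "trace (h2 \<odot> h1) = \<delta>"
    "trace R1 = 0" "trace F2 = 0" "trace (h1 \<odot> F2) = 0" "trace (F2 \<odot> h1) = 0" "trace (R1 \<odot> h2) = 0"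
    "trace (h2 \<odot> R1) = 0" "trace (F2 \<odot> R1) = 0" "trace (R1 \<odot> F2) = 0" "trace (R1 \<odot> F2 \<odot> R1) = 0"
    "trace (R1 \<odot> h2 \<odot> R1) = \<delta>\<^sup>2 - 1"
    using all[folded bricks] d by (simp_all add: one_mul atoms_P mul_closed power2_eq_square power3_eq_cube)
qed

text \<open>The 2-boxes of either shading are spanned by three elements, so by trilinearity 27
  products suffice.\<close>

lemma spanning:
  "P 3 Plus \<subseteq> span {x \<odot> y \<odot> z | x y z. x \<in> {one, h1, R1} \<and> y \<in> {one, h2, F2} \<and> z \<in> {one, h1, R1}}"
    (is "_ \<subseteq> span ?S")
proof -
  have "eval 3 Plus [(0, LBox 2 x), (1, LBox 2 y), (0, LBox 2 z)] \<in> span ?S"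
    if "x \<in> P 2 Plus" "y \<in> P 2 (flip Plus)" "z \<in> P 2 Plus" for x y z
  proof (rule eval3_span)
    show "{e Plus, h Plus, R} \<subseteq> P 2 Plus" "{e Minus, h Minus, F} \<subseteq> P 2 (flip Plus)" by simp_all
    show "x \<in> span {e Plus, h Plus, R}" "z \<in> span {e Plus, h Plus, R}" using that P_2_Plus by auto
    show "y \<in> span {e Minus, h Minus, F}" using that P_2_Minus by auto
    fix x y z assume xyz: "x \<in> {e Plus, h Plus, R}" "y \<in> {e Minus, h Minus, F}" "z \<in> {e Plus, h Plus, R}"
    have "x1 x \<in> {one, h1, R1}" "x2 y \<in> {one, h2, F2}" "x1 z \<in> {one, h1, R1}"
      using xyz bricks by auto
    then have "x1 x \<odot> x2 y \<odot> x1 z \<in> ?S" by blast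
    then have "x1 x \<odot> x2 y \<odot> x1 z \<in> span ?S" by (rule span_base)
    moreover have "x1 x \<odot> x2 y \<odot> x1 z = eval 3 Plus [(0, LBox 2 x), (1, LBox 2 y), (0, LBox 2 z)]"
      by (rule brick) (use xyz in auto)
    ultimately show "eval 3 Plus [(0, LBox 2 x), (1, LBox 2 y), (0, LBox 2 z)] \<in> span ?S" by (rule back_subst)
  qed
  then have "span {eval 3 Plus [(0, LBox 2 x), (1, LBox 2 y), (0, LBox 2 z)] | x y z.
      x \<in> P 2 Plus \<and> y \<in> P 2 (flip Plus) \<and> z \<in> P 2 Plus} \<subseteq> span ?S"
    by (intro span_minimal subspace_span) blast
  then show ?thesis using brick_algebra.P_3_bricks[OF brick_algebra_P_2[OF yang_baxter P_1] generated R_P, of Plus] by blast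
qed

lemma x1_linear: "linear_on (P 2 Plus) x1" and x2_linear: "linear_on (P 2 Minus) x2"
  unfolding x1_def x2_def
  using linear_on_eval[of 3 Plus "[]" 3 "[]" 0 2] linear_on_eval[of 3 Plus "[]" 3 "[]" 1 2] by simp_all

lemma squares: "R1 \<odot> R1 = a *s R1 + one - (1 / \<delta>) *s h1" "F2 \<odot> F2 = a' *s F2 + one - (1 / \<delta>) *s h2"
proof -
  have "R1 \<odot> R1 = x1 (eval 2 Plus [(0, LBox 2 R), (0, LBox 2 R)])"
    unfolding R1_def x1_def using word_box'[OF _ _ _ _ _ refl, of 3 Plus "[]" 3 "[]" 0 2 Plus
      "[(0, LBox 2 R), (0, LBox 2 R)]" "[(0, LBox 2 R), (0, LBox 2 R)]"] by (simp add: mul_eval)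
  also have "\<dots> = a *s R1 + (one + (- (1 / \<delta>)) *s h1)"
    unfolding square_R' bricks(1,2,3) by (rule linear_combination[OF x1_linear R_P])
  finally show "R1 \<odot> R1 = a *s R1 + one - (1 / \<delta>) *s h1" by simp
  have "F2 \<odot> F2 = x2 (eval 2 Minus [(0, LBox 2 F), (0, LBox 2 F)])"
    unfolding F2_def x2_def using word_box'[OF _ _ _ _ _ refl, of 3 Plus "[]" 3 "[]" 1 2 Minus
      "[(0, LBox 2 F), (0, LBox 2 F)]" "[(1, LBox 2 F), (1, LBox 2 F)]"] by (simp add: mul_eval)
  also have "\<dots> = a' *s F2 + (one + (- (1 / \<delta>)) *s h2)"
    unfolding square_F' bricks(4,5,6) by (rule linear_combination[OF x2_linear F_P])
  finally show "F2 \<odot> F2 = a' *s F2 + one - (1 / \<delta>) *s h2" by simp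
qed

lemma zeros: "h1 \<odot> R1 = 0" "R1 \<odot> h1 = 0" "h2 \<odot> F2 = 0" "F2 \<odot> h2 = 0"
proof -
  have "eval 3 Plus [(0, LCap), (0, LCup), (0, LBox 2 R)] = 0"
    by (rule bottom_zero[of 0 Plus R 3 "[(0, LCap)]" 1 "[]", unfolded append.simps]) (use R_caps in simp_all)
  then show "h1 \<odot> R1 = 0" by (simp add: atom_defs mul_eval)
  have "eval 3 Plus [(0, LBox 2 R), (0, LCap), (0, LCup)] = 0"
    by (rule top_zero[of 0 Plus R 3 "[]" 3 "[(0, LCup)]", unfolded append.simps]) (use R_caps in simp_all)
  then show "R1 \<odot> h1 = 0" by (simp add: atom_defs mul_eval)
  have "eval 3 Plus [(1, LCap), (1, LCup), (1, LBox 2 F)] = 0"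
    using zero_at[OF F_caps(2), of 3 Plus "[]" 3 "[]" 1] by simp
  then show "h2 \<odot> F2 = 0" by (simp add: atom_defs mul_eval)
  have "eval 3 Plus [(1, LBox 2 F), (1, LCap), (1, LCup)] = 0"
    using zero_at[OF F_caps(1), of 3 Plus "[]" 3 "[]" 1] by simp
  then show "F2 \<odot> h2 = 0" by (simp add: atom_defs mul_eval)
qed

lemma three_box:
  assumes "R1 \<odot> F2 \<odot> R1 = A *s h2 + B *s h1 + C *s (one + h1 \<odot> h2 + h2 \<odot> h1)
           + D *s (R1 + h1 \<odot> F2 + F2 \<odot> h1) + E *s (F2 + R1 \<odot> h2 + h2 \<odot> R1)
           + K *s (R1 \<odot> h2 \<odot> R1 + F2 \<odot> R1 + R1 \<odot> F2) + G *s (F2 \<odot> R1 \<odot> F2)"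
  shows "three_box scale (P 3 Plus) (\<odot>) trace \<delta> a a' A B C D E K G R1 F2 h1 h2 one"
proof unfold_locales
  show "h1 \<odot> h1 = \<delta> *s h1" "h2 \<odot> h2 = \<delta> *s h2"
    using h1_square h2_square by (simp_all add: atom_defs mul_eval)
  show "h1 \<odot> h2 \<odot> h1 = h1" "h2 \<odot> h1 \<odot> h2 = h2"
    using h1_h2_h1 h2_h1_h2 by (simp_all add: atom_defs mul_eval)
  \<comment> \<open>The second equation uses that \<open>R\<close> equals its rotation by 180
    degrees.\<close>
  show "h1 \<odot> h2 \<odot> R1 = h1 \<odot> F2" "R1 \<odot> h2 \<odot> h1 = F2 \<odot> h1"
    using h1_click[OF R_P] click_h1[OF R_P] rotation by (simp_all add: atom_defs mul_eval)
qed (use subspace_P dim_P_3 delta mul_closed mul_linear mul_assoc one_mul atoms_P zeros squares spanning assms trace_linear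
    trace_values trace_nondegenerate in \<open>auto\<close>)

end

theorem theorem4p1:
  fixes scale :: "complex \<Rightarrow> 'v::ab_group_add \<Rightarrow> 'v" (infixr "*s" 75)
    and P :: "nat \<Rightarrow> shading \<Rightarrow> 'v set"
    and Z :: "nat \<Rightarrow> shading \<Rightarrow> tangle \<Rightarrow> (nat \<Rightarrow> 'v) \<Rightarrow> 'v"
    and \<delta> a a' A B C D E F G :: complex
    and R R1 F2 h1 h2 one :: 'v
    and mult3 :: "'v \<Rightarrow> 'v \<Rightarrow> 'v" (infixl "\<bullet>" 80)
  assumes "shaded_planar_algebra scale P Z \<delta>"
    and "\<delta> \<noteq> 0"
    and "shaded_planar_algebra.nondegenerate scale P Z"
    and "shaded_planar_algebra.generated_by scale P Z R 2 Plus"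
    and "shaded_planar_algebra.yang_baxter scale P Z"
    and "\<And>s. vector_space.dim scale (P 3 s) = 15"
    and "uncappable Z Plus R"
    and "R = click Z Minus (click Z Plus R)"
    and "box_mult Z 2 Plus R R = a *s R + box_id Z 2 Plus - (1 / \<delta>) *s box_h Z Plus"
    and "box_mult Z 2 Minus (click Z Plus R) (click Z Plus R) =
           a' *s click Z Plus R + box_id Z 2 Minus - (1 / \<delta>) *s box_h Z Minus"
    and "\<And>x y. x \<bullet> y = box_mult Z 3 Plus x y"
    and "R1 = add_right Z 2 Plus R"
    and "F2 = add_left Z 2 Plus (click Z Plus R)"
    and "h1 = add_right Z 2 Plus (box_h Z Plus)"
    and "h2 = add_left Z 2 Plus (box_h Z Minus)"
    and "one = box_id Z 3 Plus"
    and "R1 \<bullet> F2 \<bullet> R1 =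
           A *s h2 + B *s h1 + C *s (one + h1 \<bullet> h2 + h2 \<bullet> h1)
           + D *s (R1 + h1 \<bullet> F2 + F2 \<bullet> h1)
           + E *s (F2 + R1 \<bullet> h2 + h2 \<bullet> R1)
           + F *s (R1 \<bullet> h2 \<bullet> R1 + F2 \<bullet> R1 + R1 \<bullet> F2)
           + G *s (F2 \<bullet> R1 \<bullet> F2)"
  shows "(G = 1 \<or> G = - 1) \<and> A = G * a / \<delta> \<and> B = - A \<and> C = 0 \<and>
         (G * \<delta>\<^sup>2 - 2 * \<delta>) * D = 1 - G * a\<^sup>2 * \<delta> \<and>
         E = - G * D \<and> F = 0 \<and> a' = G * a"
proof -
  interpret shaded_planar_algebra scale P Z \<delta> by (rule assms(1))
  interpret Q: yang_baxter_generator scale P Z \<delta> a a' R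
    using assms(2-10) by unfold_locales simp_all
  have atoms: "R1 = Q.R1" "F2 = Q.F2" "h1 = Q.h1" "h2 = Q.h2" "one = Q.one"
    unfolding assms(12-16) Q.bricks(2,3,5,6) Q.x1_def Q.x2_def Q.one_def box_h_eval
    by (simp_all add: add_right_eval add_left_eval box_id_eval)
  have mul: "x \<bullet> y = Q.mul x y" if "x \<in> P 3 Plus" "y \<in> P 3 Plus" for x y
    using assms(11) Q.mul_box[OF that] by simp
  \<comment> \<open>The given relation associates products to the left and \<open>Q.mul\<close> to
    the right; as all factors lie in \<open>P 3 Plus\<close>, associativity identifies the two
    forms.\<close>
  interpret three_box scale "P 3 Plus" Q.mul Q.trace \<delta> a a' A B C D E F G Q.R1 Q.F2 Q.h1 Q.h2 Q.one
    by (rule Q.three_box) (use assms(17) in \<open>simp add: atoms mul Q.atoms_P Q.mul_closed Q.mul_assoc\<close>)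
  show ?thesis by (rule conclusion)
qed

end
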